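(* Let $f$, $A_1,\dots,A_m\in\mathbb{S}^n$, $b\in\mathbb{R}^m$, $r\ge1$, $\gamma,\rho>0$ be as in the context, and assume (A1), (A2), (A3), (A4) stated there, with $\alpha\in[0,1)$ the Łojasiewicz exponent in (A4). Let the initial point $(U^0,V^0,\lambda^0)$ satisfy $$\mathcal{L}_\rho(U^0,V^0,\lambda^0)+\tfrac1\rho\|\lambda^0\|_2^2\le\beta^0<\hat\beta,$$ where $\beta^0,\hat\beta$ are constants independent of $\rho$, and let $\rho$ and $\gamma$ satisfy $$\rho>\max\left\{2\rho_0,\ \frac{2c_1}{\gamma},\ \frac{2c_2}{\gamma},\ \frac{1}{\hat\beta-\beta^0}\left(\frac{L_f^\delta\delta+2\gamma\delta}{\eta}\right)^2\right\},\qquad \gamma>\rho_0,$$ where $$c_1=\frac{2}{\eta^2}\left(L^\delta\delta^2+L_f^\delta+\gamma+\frac1\eta L_f^\delta\delta\sqrt{s_A}+\frac2\eta\gamma\delta\sqrt{s_A}\right)^2,\qquad c_2=\frac{2}{\eta^2}\left(L^\delta\delta^2+\gamma\right)^2.$$ Let $\{(U^k,V^k,\lambda^k)\}_{k=0}^\infty$ be generated by the low-rank ADMM algorithm from this initial point. Then: (i) If $\alpha=0$, the sequence $\{(U^k,V^k,\lambda^k)\}_{k=0}^\infty$ converges in a finite number of steps. (ii) If $\alpha\in(0,\frac12]$, there exist $k_0\ge0$, $\xi>0$ and $\mu\in[0,1)$ such that for any $k>k_0$, $$\operatorname{dist}((U^k,V^k,\lambda^k),\mathcal{W})\le\xi\mu^{k-k_0}.$$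 (iii) If $\alpha\in(\frac12,1)$, there exist $k_0\ge0$ and $\xi>0$ such that for any $k>k_0$, $$\operatorname{dist}((U^k,V^k,\lambda^k),\mathcal{W})\le\xi(k-k_0)^{-\frac{1-\alpha}{2\alpha-1}}.$$
   Context: $\mathbb{S}^n$: real symmetric $n\times n$ matrices; $\langle X,Y\rangle=\operatorname{tr}(X^\top Y)$; $\|\cdot\|_F$ Frobenius norm, $\|\cdot\|_2$ Euclidean norm. $\mathcal{A}(X)=(\langle A_1,X\rangle,\dots,\langle A_m,X\rangle)^\top$ for $X\in\mathbb{R}^{n\times n}$; $s_A=\sum_{i=1}^m\|A_i\|_F^2$. $f:\mathbb{R}^{n\times n}\to\mathbb{R}$ is convex and continuously differentiable (with the further smoothness in (A1)). Penalized problem: $\min_{U,V\in\mathbb{R}^{n\times r}}f(UV^\top)+\frac\gamma2\|U-V\|_F^2$ s.t. $\mathcal{A}(UV^\top)=b$. $\mathcal{W}$ is the set of its KKT points, i.e. of triples $(U,V,\lambda)\in\mathbb{R}^{n\times r}\times\mathbb{R}^{n\times r}\times\mathbb{R}^m$ with $\nabla f(UV^\top)V+\gamma(U-V)+\sum_i\lambda_iA_iV=0$, $\nabla f(VU^\top)U+\gamma(V-U)+\sum_i\lambda_iA_iU=0$, $\mathcal{A}(UV^\top)=b$. Augmented Lagrangian: $\mathcal{L}_\rho(U,V,\lambda)=f(UV^\top)+\frac\gamma2\|U-V\|_F^2+\langle\lambda,\mathcal{A}(UV^\top)-b\rangle+\frac\rho2\|\mathcal{A}(UV^\top)-b\|_2^2$.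 Low-rank ADMM: for $k=0,1,\dots$, $U^{k+1}=\operatorname{argmin}_U\mathcal{L}_\rho(U,V^k,\lambda^k)$, $V^{k+1}=\operatorname{argmin}_V\mathcal{L}_\rho(U^{k+1},V,\lambda^k)$, $\lambda^{k+1}=\lambda^k+\rho(\mathcal{A}(U^{k+1}(V^{k+1})^\top)-b)$. Assumptions: (A1) $\mathcal{W}$ is nonempty; $f(X)=f(X^\top)$ for all $X\in\mathbb{R}^{n\times n}$; $\nabla f$ and $\nabla^2f$ are Lipschitz continuous on any convex compact set. (A2) There is $\rho_0>0$ such that for any given $\beta$ the level set $S_\beta=\{(U,V): f(UV^\top)+\frac{\rho_0}{2}\|U-V\|_F^2+\frac{\rho_0}{2}\|\mathcal{A}(UV^\top)-b\|_2^2\le\beta\}$ is either compact or empty. (This $\rho_0$ is fixed.) By (A2), $S_{\hat\beta}$ is bounded, and $\delta>0$ denotes a constant with $\|U\|_F\le\delta$ and $\|V\|_F\le\delta$ for all $(U,V)\in S_{\hat\beta}$. (A3) There is a constant $\eta>0$ with $\min_{(U,V)\in S_{\hat\beta}}\sigma_{\min}(\mathcal{C}(U))\ge\eta$, where $\mathcal{C}(U)=[\operatorname{vec}(A_1U),\dots,\operatorname{vec}(A_mU)]\in\mathbb{R}^{nr\times m}$ and $\sigma_{\min}$ denotes the least singular value, understood as $\sigma_{\min}(\mathcal C(U))=\min_{\|x\|_2=1}\|\mathcal{C}(U)x\|_2$ (so the columns are linearly independent; this is the linear independence constraint qualification). (A4) (Łojasiewicz inequality) $\mathcal{L}_\rho$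 satisfies the Łojasiewicz inequality with exponent $\alpha\in[0,1)$ at any KKT point of the penalized problem, i.e. there exist constants $c,\delta_c>0$ such that for any $(U,V,\lambda)\in\mathbb{R}^{n\times r}\times\mathbb{R}^{n\times r}\times\mathbb{R}^m$ and $(\overline U,\overline V,\overline\lambda)\in\mathcal{W}$ with $\operatorname{dist}((U,V,\lambda),(\overline U,\overline V,\overline\lambda))\le\delta_c$, $$|\mathcal{L}_\rho(U,V,\lambda)-\mathcal{L}_\rho(\overline U,\overline V,\overline\lambda)|^\alpha\le c\,\|\nabla\mathcal{L}_\rho(U,V,\lambda)\|_F.$$ Here $\nabla$ is the gradient in all of $(U,V,\lambda)$, and norms and distances on triples are Euclidean (distance to a set is the infimum). Constants: $L_f^\delta$ and $L^\delta$ are such that $\|\nabla f(X)\|_F\le L_f^\delta$ and $\nabla f$ is $L^\delta$-Lipschitz continuous (Frobenius norm) on the ball $\{X\in\mathbb{R}^{n\times n}:\|X\|_F\le\delta^2\}$. *)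

theory Defs
  imports "HOL-Analysis.Analysis"
begin

text \<open>
  Matrices of size n x r are elements of \<^typ>\<open>real^'r^'n\<close> (rows indexed by 'n). On this type the
  library's inner product and norm are the trace inner product and the Frobenius norm:
\<close>

lemma inner_matrix_eq_trace:
  fixes X Y :: "real^'r^'n"
  shows "X \<bullet> Y = trace (transpose X ** Y)"
proof -
  have "X \<bullet> Y = (\<Sum>i\<in>UNIV. \<Sum>j\<in>UNIV. X $ i $ j * Y $ i $ j)"
    by (simp add: inner_vec_def)
  also have "\<dots> = (\<Sum>j\<in>UNIV. \<Sum>i\<in>UNIV. X $ i $ j * Y $ i $ j)"
    by (rule sum.swap)
  also have "\<dots> = trace (transpose X ** Y)"
    by (simp add: trace_def matrix_matrix_mult_def transpose_def)
  finally show ?thesis .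
qed

lemma norm_matrix_eq_frobenius:
  fixes X :: "real^'r^'n"
  shows "norm X = sqrt (\<Sum>i\<in>UNIV. \<Sum>j\<in>UNIV. (X $ i $ j)\<^sup>2)"
  by (simp add: norm_eq_sqrt_inner inner_vec_def power2_eq_square)

definition grad :: "('a::euclidean_space \<Rightarrow> real) \<Rightarrow> 'a \<Rightarrow> 'a" where
  "grad f x = (THE D. GDERIV f x :> D)"

lemma grad_eqI:
  assumes "GDERIV f x :> D"
  shows "grad f x = D"
  unfolding grad_def
proof (rule the_equality[of "\<lambda>D. GDERIV f x :> D"])
  show "GDERIV f x :> D" by fact
next
  fix D' assume "GDERIV f x :> D'"
  then have "(\<lambda>h. h \<bullet> D') = (\<lambda>h. h \<bullet> D)"
    using assms has_derivative_unique unfolding gderiv_def by blast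
  then show "D' = D"
    by (metis euclidean_eqI inner_commute)
qed

text \<open>The Hessian as a bounded linear operator; meaningful where \<^term>\<open>grad f\<close> is differentiable.\<close>

definition hess :: "('a::euclidean_space \<Rightarrow> real) \<Rightarrow> 'a \<Rightarrow> ('a \<Rightarrow>\<^sub>L 'a)" where
  "hess f x = Blinfun (frechet_derivative (grad f) (at x))"

definition meas_map :: "('m \<Rightarrow> real^'n^'n) \<Rightarrow> real^'n^'n \<Rightarrow> real^'m" where
  "meas_map A X = (\<chi> i. A i \<bullet> X)"

definition kkt_set ::
  "(real^'n^'n \<Rightarrow> real) \<Rightarrow> ('m::finite \<Rightarrow> real^'n^'n) \<Rightarrow> real^'m \<Rightarrow> real
    \<Rightarrow> ((real^'r^'n) \<times> (real^'r^'n) \<times> (real^'m)) set" where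
  "kkt_set f A b \<gamma> = {(U, V, y).
     grad f (U ** transpose V) ** V + \<gamma> *\<^sub>R (U - V) + (\<Sum>i\<in>UNIV. (y $ i) *\<^sub>R (A i ** V)) = 0 \<and>
     grad f (V ** transpose U) ** U + \<gamma> *\<^sub>R (V - U) + (\<Sum>i\<in>UNIV. (y $ i) *\<^sub>R (A i ** U)) = 0 \<and>
     meas_map A (U ** transpose V) = b}"

definition aug_lag ::
  "(real^'n^'n \<Rightarrow> real) \<Rightarrow> ('m::finite \<Rightarrow> real^'n^'n) \<Rightarrow> real^'m \<Rightarrow> real \<Rightarrow> real
    \<Rightarrow> (real^'r^'n) \<times> (real^'r^'n) \<times> (real^'m) \<Rightarrow> real" where
  "aug_lag f A b \<gamma> \<rho> = (\<lambda>(U, V, y).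
     f (U ** transpose V) + \<gamma> / 2 * (norm (U - V))\<^sup>2
       + y \<bullet> (meas_map A (U ** transpose V) - b)
       + \<rho> / 2 * (norm (meas_map A (U ** transpose V) - b))\<^sup>2)"

definition low_rank_admm ::
  "(real^'n^'n \<Rightarrow> real) \<Rightarrow> ('m::finite \<Rightarrow> real^'n^'n) \<Rightarrow> real^'m \<Rightarrow> real \<Rightarrow> real
    \<Rightarrow> (nat \<Rightarrow> real^'r^'n) \<Rightarrow> (nat \<Rightarrow> real^'r^'n) \<Rightarrow> (nat \<Rightarrow> real^'m) \<Rightarrow> bool" where
  "low_rank_admm f A b \<gamma> \<rho> U V \<Lambda> \<longleftrightarrow> (\<forall>k.
     is_arg_min (\<lambda>X. aug_lag f A b \<gamma> \<rho> (X, V k, \<Lambda> k)) (\<lambda>_. True) (U (Suc k)) \<and>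
     is_arg_min (\<lambda>Y. aug_lag f A b \<gamma> \<rho> (U (Suc k), Y, \<Lambda> k)) (\<lambda>_. True) (V (Suc k)) \<and>
     \<Lambda> (Suc k) = \<Lambda> k + \<rho> *\<^sub>R (meas_map A (U (Suc k) ** transpose (V (Suc k))) - b))"

definition level_set ::
  "(real^'n^'n \<Rightarrow> real) \<Rightarrow> ('m::finite \<Rightarrow> real^'n^'n) \<Rightarrow> real^'m \<Rightarrow> real \<Rightarrow> real
    \<Rightarrow> ((real^'r^'n) \<times> (real^'r^'n)) set" where
  "level_set f A b \<rho>\<^sub>0 \<beta> = {(U, V).
     f (U ** transpose V) + \<rho>\<^sub>0 / 2 * (norm (U - V))\<^sup>2
       + \<rho>\<^sub>0 / 2 * (norm (meas_map A (U ** transpose V) - b))\<^sup>2 \<le> \<beta>}"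

text \<open>
  The columns of \<open>constr_jac A U\<close> are the vectorizations of the matrices \<open>A i ** U\<close>; a vector of
  length nr is indexed by pairs (row, column), so no ordering of the entries has to be chosen.
\<close>

definition constr_jac ::
  "('m::finite \<Rightarrow> real^'n^'n) \<Rightarrow> real^'r^'n \<Rightarrow> real^'m^('n \<times> 'r)" where
  "constr_jac A U = (\<chi> p. \<chi> i. (A i ** U) $ fst p $ snd p)"

definition sigma_min :: "real^'m^'p \<Rightarrow> real" where
  "sigma_min M = (INF x\<in>sphere 0 1. norm (M *v x))"

text \<open>
  Lojasiewicz inequality with exponent \<open>\<alpha>\<close> for \<open>L\<close> near the points of \<open>W\<close>. Since \<open>0 powr 0 = 0\<close>, the
  case \<open>\<alpha> = 0\<close> uses the usual convention that the left-hand side vanishes when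
  \<open>L z = L w\<close>; with \<open>0\<^sup>0 = 1\<close> the inequality would fail at every critical point \<open>z = w\<close>.
\<close>

definition lojasiewicz_on ::
  "('a::euclidean_space \<Rightarrow> real) \<Rightarrow> 'a set \<Rightarrow> real \<Rightarrow> bool" where
  "lojasiewicz_on L W \<alpha> \<longleftrightarrow> (\<exists>c>0. \<exists>\<delta>\<^sub>c>0. \<forall>z. \<forall>w\<in>W.
     dist z w \<le> \<delta>\<^sub>c \<longrightarrow> \<bar>L z - L w\<bar> powr \<alpha> \<le> c * norm (grad L z))"

end

theory Submission
  imports Defs
begin

text \<open>
  Write \<open>F U V = f (U V\<^sup>T) + \<gamma>/2 |U - V|\<^sup>2\<close> and \<open>h U V = \<A> (U V\<^sup>T) - b\<close>, let \<open>C U y = \<Sum>\<^sub>i y\<^sub>i A\<^sub>i U\<close> be the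
  adjoint of the linear map \<open>V \<mapsto> \<A> (U V\<^sup>T)\<close>, and let \<open>G U V\<close> be the gradient of \<open>F U\<close> at \<open>V\<close>.
  The augmented Lagrangian \<open>Lag U V y = F U V + \<langle>y, h U V\<rangle> + \<rho>/2 |h U V|\<^sup>2\<close> is symmetric in \<open>U\<close>
  and \<open>V\<close> and strongly convex in each of them, so both minimization steps decrease it by
  \<open>\<gamma>/2\<close> times a squared step length. The multiplier update increases it by \<open>|y' - y|\<^sup>2 / \<rho>\<close>.

  The heart of the proof is that the increase is paid for by the decrease. This follows from
  the stationarity relation \<open>C U y + G U V = 0\<close>, which holds after every step in \<open>V\<close>, as soon as the
  iterates satisfy the bounds collected in \<open>crit\<close>: \<open>|U| \<le> \<delta>\<close>, \<open>|C U x| \<ge> \<eta> |x|\<close> and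
  \<open>|U| + |V| \<le> 2 \<delta>\<close>. The last one gives \<open>|U V\<^sup>T| \<le> \<delta>\<^sup>2\<close>, hence the bounds on the gradient
  of \<open>f\<close>; then \<open>|y| \<le> M = (L\<^sub>f \<delta> + 2 \<gamma> \<delta>) / \<eta>\<close> and \<open>|y' - y|\<^sup>2 \<le> c\<^sub>1 |U' - U|\<^sup>2 + c\<^sub>2 |V' - V|\<^sup>2\<close>
  (lemma \<open>crit_multiplier_lipschitz\<close>).

  These bounds are not proved by showing that \<open>(U, V)\<close> stays in the level set: an infeasible pair can
  leave it, because \<open>\<langle>y, h\<rangle>\<close> may be negative. What stays in the level set is \<open>U\<close> together with its
  best feasible partner \<open>Y\<close>, the minimizer of \<open>F U\<close> subject to \<open>h U Y = 0\<close>. If \<open>\<nu>\<close> is the multiplier of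
  \<open>Y\<close>, convex duality gives \<open>F U' Y \<le> Lag U' V y + |y - \<nu>|\<^sup>2 / (2 \<rho>) - \<gamma>/2 |V - Y|\<^sup>2\<close>, and the multiplier
  estimate shows that the middle term is at most half of what the step in \<open>U\<close> and the last term
  have gained (\<open>feasible_value_bound\<close>). The other half is room inside the level set; since
  \<open>(c U, Y / c)\<close> has the same product as \<open>(U, Y)\<close>, this room bounds \<open>|U| + |Y|\<close> strictly below \<open>2 \<delta>\<close>
  (\<open>norm_sum_room\<close>), by more than the distance from \<open>Y\<close> to the new \<open>V\<close> (\<open>prox_displacement\<close>). The
  estimate of \<open>\<nu>\<close> presupposes that \<open>Y\<close> is in the level set, which is obtained by a continuity argument
  along the segment from the old to the new \<open>U\<close> (\<open>level_continuation\<close>).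

  The first step is different, since the initial multiplier satisfies no stationarity relation and
  the Lagrangian after the first multiplier update may exceed the level. Expanding the squares shows
  that only the multiplier \<open>\<mu>\<close> of the second step in \<open>U\<close> matters, and
  \<open>Lag (U 2) (V 1) (\<Lambda> 1) \<le> \<beta>\<^sub>0 + |\<mu>|\<^sup>2 / \<rho>\<close> with \<open>|\<mu>| \<le> M\<close> (\<open>second_multiplier_bound\<close>,
  \<open>second_half_step\<close>); this is below the level by the choice of \<open>\<rho>\<close>.

  With sufficient decrease and a gradient bounded by the last step length, the rates are those of
  any descent sequence under a Lojasiewicz inequality (\<open>lojasiewicz_descent_rates\<close>). All of this
  is carried out in Euclidean spaces with a bilinear map; matrices enter only at the end, where the
  assumptions on that map are verified.
\<close>

section \<open>Rates for descent sequences under a Lojasiewicz inequality\<close>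

lemma powr_concave_tangent:
  fixes x y a :: real
  assumes "0 < x" "0 \<le> y" "0 < a" "a \<le> 1"
  shows "y powr a \<le> x powr a + a * x powr (a - 1) * (y - x)"
proof (cases "y = 0")
  case True
  have "x powr a = x powr (a - 1) * x" using assms by (simp add: powr_diff)
  then have "x powr a + a * x powr (a - 1) * (0 - x) = (1 - a) * x powr a" by (simp add: algebra_simps)
  with True assms show ?thesis by simp
next
  case False
  then have y: "y > 0" using assms by simp
  have d: "((\<lambda>x. - (x powr a)) has_real_derivative - (a * z powr (a - 1))) (at z)" if "z > 0" for z
    using that by (auto intro!: derivative_eq_intros)
  have d2: "((\<lambda>x. - (a * x powr (a - 1))) has_real_derivative - (a * ((a - 1) * z powr (a - 1 - 1)))) (at z)"
    if "z > 0" for z using that by (auto intro!: derivative_eq_intros)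
  have "convex_on {0<..} (\<lambda>x. - (x powr a))"
  proof (rule f''_ge0_imp_convex)
    show "- (a * ((a - 1) * z powr (a - 1 - 1))) \<ge> 0" if "z \<in> {0<..}" for z
      using that assms by (simp add: mult_nonneg_nonpos2 mult_le_0_iff mult_nonneg_nonpos)
  qed (use d d2 in auto)
  then have "- (y powr a) - (- (x powr a)) \<ge> - (a * x powr (a - 1)) * (y - x)"
    by (rule convex_on_imp_above_tangent[where A = "{0<..}"])
      (use assms y d[of x] in \<open>auto intro: has_field_derivative_at_within simp: interior_open\<close>)
  then show ?thesis by simp
qed

lemma powr_convex_tangent:
  fixes x y a :: real
  assumes "0 < x" "0 < y" "0 < a"
  shows "y powr (- a) \<ge> x powr (- a) - a * x powr (- a - 1) * (y - x)"
proof -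
  have d: "((\<lambda>x. x powr (- a)) has_real_derivative (- a) * z powr (- a - 1)) (at z)" if "z > 0" for z
    using that by (auto intro!: derivative_eq_intros)
  have d2: "((\<lambda>x. (- a) * x powr (- a - 1)) has_real_derivative (- a) * ((- a - 1) * z powr (- a - 1 - 1))) (at z)"
    if "z > 0" for z using that by (auto intro!: derivative_eq_intros)
  have "convex_on {0<..} (\<lambda>x. x powr (- a))"
  proof (rule f''_ge0_imp_convex)
    show "(- a) * ((- a - 1) * z powr (- a - 1 - 1)) \<ge> 0" if "z \<in> {0<..}" for z
      using that assms by (simp add: zero_le_mult_iff mult_le_0_iff)
  qed (use d d2 in auto)
  then have "(y powr (- a)) - (x powr (- a)) \<ge> (- a) * x powr (- a - 1) * (y - x)"
    by (rule convex_on_imp_above_tangent[where A = "{0<..}"])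
      (use assms d[of x] in \<open>auto intro: has_field_derivative_at_within simp: interior_open\<close>)
  then show ?thesis by simp
qed

text \<open>
  Below 1 the power \<open>e (Suc k) powr a\<close> with \<open>a \<le> 1\<close> dominates \<open>e (Suc k)\<close>, so the recursion contracts by a fixed factor.
\<close>

lemma linear_decay:
  fixes e :: "nat \<Rightarrow> real"
  assumes e: "\<And>k. 0 \<le> e k" and dec: "\<And>k. e (Suc k) \<le> e k" and e1: "e 0 \<le> 1"
    and a: "0 < a" "a \<le> 1" and D: "D > 0"
    and rec: "\<And>k. e (Suc k) powr a \<le> D * (e k - e (Suc k))"
  shows "e k \<le> (D / (1 + D)) ^ k"
proof (induction k)
  case (Suc k)
  have le: "e j \<le> 1" for j using lift_Suc_antimono_le[of e 0 j, OF dec] e1 by simp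
  have "e (Suc k) \<le> e (Suc k) powr a"
  proof (cases "e (Suc k) = 0")
    case False
    then have "e (Suc k) powr 1 \<le> e (Suc k) powr a"
      using e[of "Suc k"] le[of "Suc k"] a by (intro powr_mono') auto
    then show ?thesis using e[of "Suc k"] by simp
  qed simp
  then have "e (Suc k) * (1 + D) \<le> D * e k" using rec[of k] by (simp add: algebra_simps)
  then have "e (Suc k) \<le> D / (1 + D) * e k" using D by (simp add: field_simps)
  also have "\<dots> \<le> D / (1 + D) * (D / (1 + D)) ^ k" using Suc D by (intro mult_left_mono) auto
  finally show ?case by simp
qed (use e1 in simp)

text \<open>
  The quantity \<open>e k powr (- a)\<close> grows by at least a fixed amount \<open>d\<close> in every step, hence at least
  linearly. If \<open>e\<close> does not halve, the growth comes from the recursion and the convexity of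
  \<open>x powr (- a)\<close>; if \<open>e\<close> halves, the power is multiplied by \<open>2 powr a\<close>.
\<close>

lemma sublinear_decay:
  fixes e :: "nat \<Rightarrow> real"
  assumes e: "\<And>k. 0 \<le> e k" and dec: "\<And>k. e (Suc k) \<le> e k"
    and a: "0 < a" and D: "D > 0"
    and rec: "\<And>k. e (Suc k) powr (1 + a) \<le> D * (e k - e (Suc k))"
  shows "\<exists>c>0. \<forall>k>0. e k \<le> c * real k powr (- (1 / a))"
proof (cases "\<exists>j. e j = 0")
  case True
  then obtain j where j: "e j = 0" by blast
  have z: "e k = 0" if "k \<ge> j" for k
  proof -
    have "e (j + i) = 0" for i
    proof (induction i)
      case (Suc i)
      then show ?case using dec[of "j + i"] e[of "Suc (j + i)"] by simp
    qed (use j in simp)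
    from this[of "k - j"] that show ?thesis by simp
  qed
  \<comment> \<open>large enough for the finitely many indices before \<open>j\<close>\<close>
  define c where "c = (e 0 + 1) * real (Suc j) powr (1 / a)"
  have e0: "e k \<le> e 0" for k by (rule lift_Suc_antimono_le[of e, OF dec]) simp
  have c: "c > 0" using e[of 0] by (simp add: c_def)
  moreover have "e k \<le> c * real k powr (- (1 / a))" if k: "k > 0" for k
  proof (cases "k \<ge> j")
    case True
    then show ?thesis using z c by simp
  next
    case False
    have "1 \<le> (real (Suc j) / real k) powr (1 / a)"
      using False k a by (intro ge_one_powr_ge_zero) (auto simp: field_simps)
    also have "\<dots> = real (Suc j) powr (1 / a) * real k powr (- (1 / a))"
      using powr_divide[of "real (Suc j)" "real k" "1 / a"] by (simp only: powr_minus divide_inverse)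
    finally have "(e 0 + 1) * 1 \<le> (e 0 + 1) * (real (Suc j) powr (1 / a) * real k powr (- (1 / a)))"
      using e[of 0] by (intro mult_left_mono) auto
    then show ?thesis using e0[of k] by (simp add: c_def mult.assoc)
  qed
  ultimately show ?thesis by blast
next
  case False
  then have pos: "e k > 0" for k using e[of k] by (metis less_eq_real_def)
  define g where "g k = e k powr (- a)" for k
  define d where "d = min (a / (D * 2 powr (1 + a))) ((2 powr a - 1) * g 0)"
  have g0: "g 0 > 0" using pos[of 0] by (simp add: g_def)
  have d: "d > 0" using a D g0 by (simp add: d_def)
  have gmono: "g k \<le> g (Suc k)" for k
    unfolding g_def using pos dec[of k] a by (intro powr_mono2') auto
  then have gge: "g 0 \<le> g k" for k by (rule lift_Suc_mono_le[of g]) auto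
  have inc: "g k + d \<le> g (Suc k)" for k
  proof (cases "e k \<le> 2 * e (Suc k)")
    case True
    have "a / (D * 2 powr (1 + a)) \<le> a * e k powr (- a - 1) * (e k - e (Suc k))"
    proof -
      have "e k powr (1 + a) \<le> (2 * e (Suc k)) powr (1 + a)" using True pos[of k] a by (intro powr_mono2) auto
      also have "\<dots> = 2 powr (1 + a) * e (Suc k) powr (1 + a)" using pos[of "Suc k"] by (simp add: powr_mult)
      also have "\<dots> \<le> 2 powr (1 + a) * (D * (e k - e (Suc k)))" by (intro mult_left_mono rec) simp
      finally have "1 \<le> D * 2 powr (1 + a) * ((e k - e (Suc k)) / e k powr (1 + a))"
        using pos[of k] by (simp add: field_simps)
      then have "1 / (D * 2 powr (1 + a)) \<le> (e k - e (Suc k)) / e k powr (1 + a)"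
        using D by (simp add: field_simps)
      then have "a * (1 / (D * 2 powr (1 + a))) \<le> a * ((e k - e (Suc k)) / e k powr (1 + a))"
        using a by (intro mult_left_mono) auto
      moreover have "e k powr (- a - 1) = 1 / e k powr (1 + a)"
      proof -
        have "- a - 1 = - (1 + a)" by simp
        then show ?thesis by (simp only: powr_minus_divide)
      qed
      ultimately show ?thesis by simp
    qed
    then have "d \<le> - (a * e k powr (- a - 1) * (e (Suc k) - e k))"
      using min.cobounded1[of "a / (D * 2 powr (1 + a))" "(2 powr a - 1) * g 0"]
      unfolding d_def by (simp only: minus_mult_right minus_diff_eq)
    then show ?thesis
      using powr_convex_tangent[OF pos[of k] pos[of "Suc k"] a] unfolding g_def by linarith
  next
    case False
    have "2 powr a * g k = (e k / 2) powr (- a)"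
      using powr_divide[of "e k" 2 "- a"] powr_minus_divide[of 2 a] by (simp add: g_def)
    also have "\<dots> \<le> g (Suc k)" unfolding g_def using False pos[of "Suc k"] a by (intro powr_mono2') auto
    finally have "2 powr a * g k \<le> g (Suc k)" .
    moreover have "(2 powr a - 1) * g 0 \<le> (2 powr a - 1) * g k"
      using gge a by (intro mult_left_mono) (auto simp: ge_one_powr_ge_zero)
    ultimately show ?thesis
      using min.cobounded2[of "a / (D * 2 powr (1 + a))" "(2 powr a - 1) * g 0"]
      unfolding d_def by (simp only: left_diff_distrib mult_1)
  qed
  have gk: "d * real k \<le> g k" for k
  proof (induction k)
    case (Suc k)
    then show ?case using inc[of k] by (simp add: algebra_simps)
  qed (use g0 in simp)
  have "e k \<le> d powr (- (1 / a)) * real k powr (- (1 / a))" if k: "k > 0" for k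
  proof -
    have "g k powr (- (1 / a)) \<le> (d * real k) powr (- (1 / a))"
      using gk[of k] d k a by (intro powr_mono2') auto
    moreover have "g k powr (- (1 / a)) = e k"
      using pos[of k] a by (simp add: g_def powr_powr)
    ultimately show ?thesis using d by (simp add: powr_mult)
  qed
  then show ?thesis using d by (intro exI[of _ "d powr (- (1 / a))"]) auto
qed

text \<open>
  Let \<open>e k\<close> be the excess of \<open>\<Phi> (z k)\<close> over its limit and \<open>s k\<close> the step length. Every cluster point is
  critical and has the limit value, so eventually each \<open>z k\<close> is close to such a point and the
  inequality reads \<open>e (Suc k) powr \<alpha> \<le> C * s k\<close>. Together with the descent \<open>\<tau> * (s k)\<^sup>2 \<le> e k - e (Suc k)\<close>
  this yields a recursion for \<open>e\<close> alone, solved by \<open>linear_decay\<close> and \<open>sublinear_decay\<close>. The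
  same two inequalities and the concavity of \<open>x powr (1 - \<alpha>)\<close> make the remaining path length, and with
  it the distance to \<open>W\<close>, a multiple of a power of \<open>e k\<close>.
\<close>

theorem lojasiewicz_descent_rates:
  fixes z :: "nat \<Rightarrow> 'c::euclidean_space" and \<Phi> :: "'c \<Rightarrow> real" and g :: "'c \<Rightarrow> 'c"
  assumes bounded: "bounded (range z)"
    and \<Phi>_cont: "continuous_on UNIV \<Phi>" and g_cont: "continuous_on UNIV g"
    and descent: "\<And>k. \<Phi> (z (Suc k)) + \<tau> * (norm (z (Suc k) - z k))\<^sup>2 \<le> \<Phi> (z k)" and \<tau>: "\<tau> > 0"
    and grad: "\<And>k. norm (g (z (Suc k))) \<le> K * norm (z (Suc k) - z k)"
    and W: "\<And>x. g x = 0 \<Longrightarrow> x \<in> W"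
    and loj: "\<And>x w. w \<in> W \<Longrightarrow> dist x w \<le> d \<Longrightarrow> \<bar>\<Phi> x - \<Phi> w\<bar> powr \<alpha> \<le> c * norm (g x)"
    and c: "c > 0" and d: "d > 0"
  shows "\<alpha> = 0 \<Longrightarrow> \<exists>k0. \<forall>k\<ge>k0. z k = z k0"
    and "0 < \<alpha> \<Longrightarrow> \<alpha> \<le> 1 / 2 \<Longrightarrow> \<exists>(k0::nat) \<xi> \<mu>. \<xi> > 0 \<and> 0 \<le> \<mu> \<and> \<mu> < 1 \<and>
           (\<forall>k>k0. infdist (z k) W \<le> \<xi> * \<mu> ^ (k - k0))"
    and "1 / 2 < \<alpha> \<Longrightarrow> \<alpha> < 1 \<Longrightarrow> \<exists>(k0::nat) \<xi>. \<xi> > 0 \<and>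
           (\<forall>k>k0. infdist (z k) W \<le> \<xi> * real (k - k0) powr (- ((1 - \<alpha>) / (2 * \<alpha> - 1))))"
proof -
  define s where "s k = norm (z (Suc k) - z k)" for k
  obtain R where R: "\<And>k. norm (z k) \<le> R" using bounded by (auto simp: bounded_iff)
  have dec: "\<Phi> (z (Suc k)) \<le> \<Phi> (z k)" for k
  proof -
    have "\<tau> * (norm (z (Suc k) - z k))\<^sup>2 \<ge> 0" using \<tau> by simp
    then show ?thesis using descent[of k] by linarith
  qed
  have "compact (\<Phi> ` cball 0 R)" by (intro compact_continuous_image continuous_on_subset[OF \<Phi>_cont]) auto
  then have "bounded (\<Phi> ` cball 0 R)" by (rule compact_imp_bounded)
  then obtain m where m: "\<And>x. x \<in> cball 0 R \<Longrightarrow> \<bar>\<Phi> x\<bar> \<le> m"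
    unfolding bounded_iff by (metis image_eqI real_norm_def)
  have lower: "- m \<le> \<Phi> (z k)" for k using m[of "z k"] R[of k] by (simp add: abs_le_iff)
  have "decseq (\<lambda>k. \<Phi> (z k))" by (intro decseq_SucI dec)
  then obtain L where L: "(\<lambda>k. \<Phi> (z k)) \<longlonglongrightarrow> L" "\<And>k. L \<le> \<Phi> (z k)"
    using decseq_convergent[of "\<lambda>k. \<Phi> (z k)" "- m"] lower by blast
  define e where "e k = \<Phi> (z k) - L" for k
  have e0: "e k \<ge> 0" for k using L(2) by (simp add: e_def)
  have edec: "e (Suc k) \<le> e k" for k using dec by (simp add: e_def)
  have elim: "e \<longlonglongrightarrow> 0" using tendsto_diff[OF L(1) tendsto_const[of L]] by (simp add: e_def[abs_def])
  have s2: "\<tau> * (s k)\<^sup>2 \<le> e k - e (Suc k)" for k using descent[of k] by (simp add: s_def e_def)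
  have s0: "s k \<ge> 0" for k by (simp add: s_def)
  have slim: "s \<longlonglongrightarrow> 0"
  proof -
    have "(\<lambda>k. (e k - e (Suc k)) / \<tau>) \<longlonglongrightarrow> (0 - 0) / \<tau>"
      using \<tau> by (intro tendsto_intros elim LIMSEQ_Suc) auto
    then have "(\<lambda>k. (e k - e (Suc k)) / \<tau>) \<longlonglongrightarrow> 0" by simp
    then have "(\<lambda>k. (s k)\<^sup>2) \<longlonglongrightarrow> 0"
      by (rule tendsto_sandwich[rotated 2, OF tendsto_const])
        (use s2 \<tau> in \<open>auto simp: field_simps\<close>)
    then have "(\<lambda>k. sqrt ((s k)\<^sup>2)) \<longlonglongrightarrow> sqrt 0" by (rule tendsto_real_sqrt)
    then show ?thesis using s0 by simp
  qed
  have glim: "(\<lambda>k. g (z k)) \<longlonglongrightarrow> 0"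
  proof -
    have "(\<lambda>k. K * s k) \<longlonglongrightarrow> K * 0" by (intro tendsto_intros slim)
    then have "(\<lambda>k. K * s k) \<longlonglongrightarrow> 0" by simp
    then have "(\<lambda>k. g (z (Suc k))) \<longlonglongrightarrow> 0"
      by (rule Lim_null_comparison[rotated]) (use grad in \<open>auto simp: s_def\<close>)
    then show ?thesis by (rule LIMSEQ_imp_Suc)
  qed
  have cluster: "\<exists>r x. strict_mono r \<and> (\<lambda>j. z (r0 (r j))) \<longlonglongrightarrow> x \<and> x \<in> W \<and> \<Phi> x = L"
    if r0: "strict_mono r0" for r0 :: "nat \<Rightarrow> nat"
  proof -
    have "compact (cball 0 R :: 'c set)" by simp
    moreover have "\<forall>j. (z \<circ> r0) j \<in> cball 0 R" using R by simp
    ultimately obtain x r where r: "strict_mono r" and x: "((z \<circ> r0) \<circ> r) \<longlonglongrightarrow> x"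
      unfolding compact_def by meson
    have x': "(\<lambda>j. z (r0 (r j))) \<longlonglongrightarrow> x" using x by (simp add: o_def)
    have sm: "strict_mono (\<lambda>j. r0 (r j))" using r r0 by (simp add: strict_mono_def)
    have "(\<lambda>j. \<Phi> (z (r0 (r j)))) \<longlonglongrightarrow> \<Phi> x"
      using continuous_on_tendsto_compose[OF \<Phi>_cont x'] by simp
    moreover have "(\<lambda>j. \<Phi> (z (r0 (r j)))) \<longlonglongrightarrow> L"
      using LIMSEQ_subseq_LIMSEQ[OF L(1) sm] by (simp add: o_def)
    ultimately have "\<Phi> x = L" by (rule LIMSEQ_unique)
    have "(\<lambda>j. g (z (r0 (r j)))) \<longlonglongrightarrow> g x"
      using continuous_on_tendsto_compose[OF g_cont x'] by simp
    moreover have "(\<lambda>j. g (z (r0 (r j)))) \<longlonglongrightarrow> 0"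
      using LIMSEQ_subseq_LIMSEQ[OF glim sm] by (simp add: o_def)
    ultimately have "g x = 0" by (rule LIMSEQ_unique)
    then have "x \<in> W" by (rule W)
    then show ?thesis using r x' \<open>\<Phi> x = L\<close> by blast
  qed
  have near: "\<exists>N. \<forall>k\<ge>N. \<exists>w\<in>W. dist (z k) w \<le> d \<and> \<Phi> w = L"
  proof (rule ccontr)
    assume neg: "\<not> ?thesis"
    define bad where "bad = {k. \<not> (\<exists>w\<in>W. dist (z k) w \<le> d \<and> \<Phi> w = L)}"
    have "\<forall>N. \<exists>k\<ge>N. k \<in> bad" using neg unfolding bad_def mem_Collect_eq by metis
    then have "infinite bad" by (simp add: infinite_nat_iff_unbounded_le)
    then obtain r0 :: "nat \<Rightarrow> nat" where r0: "strict_mono r0" and r0_bad: "\<forall>j. r0 j \<in> bad"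
      using infinite_enumerate[of bad] by blast
    have bad: "\<not> (\<exists>w\<in>W. dist (z (r0 j)) w \<le> d \<and> \<Phi> w = L)" for j
      using r0_bad[rule_format, of j] unfolding bad_def by (rule CollectD)
    obtain r x where x: "(\<lambda>j. z (r0 (r j))) \<longlonglongrightarrow> x" "x \<in> W" "\<Phi> x = L"
      using cluster[OF r0] by blast
    have "\<forall>\<^sub>F j in sequentially. dist (z (r0 (r j))) x < d" by (rule tendstoD[OF x(1) d])
    then obtain j where j: "dist (z (r0 (r j))) x < d" unfolding eventually_sequentially by blast
    have "\<exists>w\<in>W. dist (z (r0 (r j))) w \<le> d \<and> \<Phi> w = L" using x less_imp_le[OF j] by blast
    then show False using bad[of "r j"] by blast
  qed
  obtain N1 where N1: "\<And>k. k \<ge> N1 \<Longrightarrow> \<exists>w\<in>W. dist (z k) w \<le> d \<and> \<Phi> w = L" using near by blast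
  have "\<forall>\<^sub>F k in sequentially. e k < 1" using order_tendstoD(2)[OF elim, of 1] by simp
  then obtain N2 where N2: "\<And>k. k \<ge> N2 \<Longrightarrow> e k < 1" unfolding eventually_sequentially by blast
  define N where "N = max N1 N2"
  have near: "\<exists>w\<in>W. dist (z k) w \<le> d \<and> \<Phi> w = L" if "k \<ge> N" for k using N1[of k] that by (simp add: N_def)
  have e1: "e k \<le> 1" if "k \<ge> N" for k using N2[of k] that by (simp add: N_def)
  \<comment> \<open>The summand 1 makes the constant positive also when \<open>K\<close> is not.\<close>
  define C where "C = c * max K 0 + 1"
  have C: "C > 0" using c by (simp add: C_def add_nonneg_pos)
  have KL: "e (Suc k) powr \<alpha> \<le> C * s k" if k: "k \<ge> N" for k
  proof -
    obtain w where w: "w \<in> W" "dist (z (Suc k)) w \<le> d" "\<Phi> w = L" using near[of "Suc k"] k by auto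
    have "e (Suc k) powr \<alpha> = \<bar>\<Phi> (z (Suc k)) - \<Phi> w\<bar> powr \<alpha>" using w e0[of "Suc k"] by (simp add: e_def)
    also have "\<dots> \<le> c * norm (g (z (Suc k)))" by (rule loj) (use w in auto)
    also have "\<dots> \<le> c * (K * s k)" using c grad[of k] by (intro mult_left_mono) (auto simp: s_def)
    also have "\<dots> \<le> c * (max K 0 * s k)" using c s0 by (intro mult_left_mono mult_right_mono) auto
    also have "\<dots> \<le> C * s k" using s0[of k] by (simp add: C_def algebra_simps)
    finally show ?thesis .
  qed
  show "\<exists>k0. \<forall>k\<ge>k0. z k = z k0" if "\<alpha> = 0"
  proof -
    have "(\<lambda>k. C * s k) \<longlonglongrightarrow> C * 0" by (intro tendsto_intros slim)
    then obtain N1 where N1: "\<And>k. k \<ge> N1 \<Longrightarrow> C * s k < 1"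
      using order_tendstoD(2)[of "\<lambda>k. C * s k" 0 sequentially 1] unfolding eventually_sequentially by auto
    define k0 where "k0 = Suc (max N N1)"
    have ez: "e k = 0" if k: "k \<ge> k0" for k
    proof (rule ccontr)
      assume nz: "e k \<noteq> 0"
      obtain j where j: "k = Suc j" "j \<ge> N" "j \<ge> N1" using k by (cases k) (auto simp: k0_def)
      then have "e k powr 0 < 1" using KL[of j] N1[of j] \<open>\<alpha> = 0\<close> by simp
      then show False using nz by simp
    qed
    have "z (k0 + i) = z k0" for i
    proof (induction i)
      case (Suc i)
      have "\<tau> * (s (k0 + i))\<^sup>2 \<le> 0" using s2[of "k0 + i"] ez[of "k0 + i"] ez[of "Suc (k0 + i)"] by simp
      then have "s (k0 + i) = 0" using \<tau> by (simp add: mult_le_0_iff)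
      then show ?case using Suc by (simp add: s_def)
    qed simp
    then have "\<forall>k\<ge>k0. z k = z k0" by (metis le_iff_add)
    then show ?thesis ..
  qed
  have am_gm: "4 * (x * y) \<le> (x + y)\<^sup>2" for x y :: real
    using zero_le_power2[of "x - y"] by (simp add: power2_sum power2_diff)
  have dist_bound: "\<exists>D>0. \<forall>k\<ge>N. infdist (z (Suc k)) W \<le> D * e k powr min (1 - \<alpha>) (1 / 2)"
    if \<alpha>: "0 < \<alpha>" "\<alpha> < 1"
  proof -
    define P where "P k = e k powr (1 - \<alpha>)" for k
    define C' where "C' = C / ((1 - \<alpha>) * \<tau>)"
    have C': "C' > 0" using C \<alpha> \<tau> by (simp add: C'_def)
    have Pdec: "P (Suc k) \<le> P k" for k unfolding P_def using e0 edec \<alpha> by (intro powr_mono2) auto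
    have P0: "P k \<ge> 0" for k by (simp add: P_def)
    have step: "2 * s (Suc k) \<le> s k + C' * (P (Suc k) - P (Suc (Suc k)))" if k: "k \<ge> N" for k
    proof (cases "e (Suc k) = 0")
      case True
      have "\<tau> * (s (Suc k))\<^sup>2 \<le> 0" using s2[of "Suc k"] True e0[of "Suc (Suc k)"] by simp
      then have "s (Suc k) = 0" using \<tau> by (simp add: mult_le_0_iff)
      moreover have "C' * (P (Suc k) - P (Suc (Suc k))) \<ge> 0" using C' Pdec by simp
      ultimately show ?thesis using s0[of k] by simp
    next
      case False
      define x y where "x = e (Suc k)" and "y = e (Suc (Suc k))"
      have x: "x > 0" using False e0[of "Suc k"] by (simp add: x_def)
      have y: "y \<ge> 0" using e0 by (simp add: y_def)
      have "y powr (1 - \<alpha>) \<le> x powr (1 - \<alpha>) + (1 - \<alpha>) * x powr (1 - \<alpha> - 1) * (y - x)"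
        by (rule powr_concave_tangent) (use x y \<alpha> in auto)
      then have "(1 - \<alpha>) * x powr (- \<alpha>) * (x - y) \<le> P (Suc k) - P (Suc (Suc k))"
        by (simp add: P_def x_def y_def algebra_simps)
      moreover have "(1 - \<alpha>) * x powr (- \<alpha>) * (\<tau> * (s (Suc k))\<^sup>2) \<le> (1 - \<alpha>) * x powr (- \<alpha>) * (x - y)"
        using s2[of "Suc k"] \<alpha> by (intro mult_left_mono) (auto simp: x_def y_def)
      ultimately have "(1 - \<alpha>) * x powr (- \<alpha>) * (\<tau> * (s (Suc k))\<^sup>2) \<le> P (Suc k) - P (Suc (Suc k))"
        by linarith
      then have "x powr \<alpha> * ((1 - \<alpha>) * x powr (- \<alpha>) * (\<tau> * (s (Suc k))\<^sup>2)) \<le> x powr \<alpha> * (P (Suc k) - P (Suc (Suc k)))"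
        by (intro mult_left_mono) auto
      also have "x powr \<alpha> * ((1 - \<alpha>) * x powr (- \<alpha>) * (\<tau> * (s (Suc k))\<^sup>2)) = (1 - \<alpha>) * \<tau> * (s (Suc k))\<^sup>2"
        using x by (simp add: powr_minus field_simps)
      also have "x powr \<alpha> * (P (Suc k) - P (Suc (Suc k))) \<le> (C * s k) * (P (Suc k) - P (Suc (Suc k)))"
        using KL[OF k] Pdec by (intro mult_right_mono) (auto simp: x_def)
      finally have "(s (Suc k))\<^sup>2 \<le> s k * (C' * (P (Suc k) - P (Suc (Suc k))))"
        using \<alpha> \<tau> by (simp add: C'_def field_simps)
      also have "4 * (s k * (C' * (P (Suc k) - P (Suc (Suc k))))) \<le> (s k + C' * (P (Suc k) - P (Suc (Suc k))))\<^sup>2"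
        by (rule am_gm)
      finally have "(2 * s (Suc k))\<^sup>2 \<le> (s k + C' * (P (Suc k) - P (Suc (Suc k))))\<^sup>2" by (simp add: power_mult_distrib)
      then show ?thesis by (rule power2_le_imp_le) (use s0[of k] C' Pdec in \<open>simp add: add_nonneg_nonneg\<close>)
    qed
    have sum: "(\<Sum>i<n. s (Suc k + i)) + s (k + n) \<le> s k + C' * (P (Suc k) - P (Suc k + n))"
      if k: "k \<ge> N" for k n
    proof (induction n)
      case (Suc n)
      have "2 * s (Suc (k + n)) \<le> s (k + n) + C' * (P (Suc (k + n)) - P (Suc (Suc (k + n))))"
        using step[of "k + n"] k by simp
      then show ?case using Suc by (simp add: algebra_simps)
    qed simp
    have move: "norm (z (Suc k + n) - z (Suc k)) \<le> s k + C' * P (Suc k)" if k: "k \<ge> N" for k n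
    proof -
      have "norm (z (Suc k + n) - z (Suc k)) \<le> (\<Sum>i<n. s (Suc k + i))"
      proof (induction n)
        case (Suc n)
        have "norm (z (Suc k + Suc n) - z (Suc k)) \<le> norm (z (Suc (Suc k + n)) - z (Suc k + n)) + norm (z (Suc k + n) - z (Suc k))"
          using norm_triangle_ineq[of "z (Suc (Suc k + n)) - z (Suc k + n)" "z (Suc k + n) - z (Suc k)"] by simp
        then show ?case using Suc by (simp add: s_def)
      qed simp
      moreover have "C' * (P (Suc k) - P (Suc k + n)) \<le> C' * P (Suc k)"
        using C' P0 by (intro mult_left_mono) auto
      ultimately show ?thesis using sum[OF k, of n] s0[of "k + n"] by linarith
    qed
    define D where "D = 1 / sqrt \<tau> + C'"
    have D: "D > 0" using \<tau> C' by (simp add: D_def add_pos_pos)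
    have "infdist (z (Suc k)) W \<le> D * e k powr min (1 - \<alpha>) (1 / 2)" if k: "k \<ge> N" for k
    proof -
      have sm: "strict_mono (\<lambda>n. Suc k + n)" by (simp add: strict_mono_def)
      obtain r x where r: "strict_mono r" "(\<lambda>j. z (Suc k + r j)) \<longlonglongrightarrow> x" "x \<in> W"
        using cluster[OF sm] by blast
      have "(\<lambda>j. norm (z (Suc k + r j) - z (Suc k))) \<longlonglongrightarrow> norm (x - z (Suc k))"
        by (intro tendsto_intros r)
      then have "norm (x - z (Suc k)) \<le> s k + C' * P (Suc k)"
        by (rule LIMSEQ_le_const2) (use move[OF k] in auto)
      then have 1: "infdist (z (Suc k)) W \<le> s k + C' * P (Suc k)"
        using infdist_le[OF r(3), of "z (Suc k)"] by (simp add: dist_norm norm_minus_commute)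
      have mono: "e k powr a \<le> e k powr min (1 - \<alpha>) (1 / 2)" if "a \<ge> min (1 - \<alpha>) (1 / 2)" for a
      proof (cases "e k = 0")
        case False
        then show ?thesis using that e0[of k] e1[OF k] \<alpha> by (intro powr_mono') auto
      qed simp
      have "(s k)\<^sup>2 \<le> e k / \<tau>" using s2[of k] e0[of "Suc k"] \<tau> by (simp add: field_simps)
      then have "s k \<le> sqrt (e k / \<tau>)" by (rule real_le_rsqrt)
      also have "\<dots> = 1 / sqrt \<tau> * e k powr (1 / 2)" using e0[of k] by (simp add: real_sqrt_divide powr_half_sqrt)
      also have "\<dots> \<le> 1 / sqrt \<tau> * e k powr min (1 - \<alpha>) (1 / 2)" using \<tau> by (intro mult_left_mono mono min.cobounded2) auto
      finally have 2: "s k \<le> 1 / sqrt \<tau> * e k powr min (1 - \<alpha>) (1 / 2)" .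
      have "C' * P (Suc k) \<le> C' * e k powr min (1 - \<alpha>) (1 / 2)"
        using C' Pdec[of k] mono[of "1 - \<alpha>"] by (intro mult_left_mono) (auto simp: P_def)
      with 1 2 show ?thesis by (simp add: D_def algebra_simps)
    qed
    then show ?thesis using D by blast
  qed
  have rec: "e (Suc k) powr (2 * \<alpha>) \<le> (C\<^sup>2 / \<tau>) * (e k - e (Suc k))" if k: "k \<ge> N" for k
  proof -
    have "e (Suc k) powr (2 * \<alpha>) = (e (Suc k) powr \<alpha>)\<^sup>2"
      by (simp add: power2_eq_square flip: powr_add)
    also have "\<dots> \<le> (C * s k)\<^sup>2" using KL[OF k] by (intro power_mono) auto
    also have "\<dots> = C\<^sup>2 / \<tau> * (\<tau> * (s k)\<^sup>2)" using \<tau> by (simp add: power_mult_distrib)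
    also have "\<dots> \<le> C\<^sup>2 / \<tau> * (e k - e (Suc k))" using s2 \<tau> by (intro mult_left_mono) auto
    finally show ?thesis .
  qed
  have CT: "C\<^sup>2 / \<tau> > 0" using C \<tau> by simp
  show "\<exists>(k0::nat) \<xi> \<mu>. \<xi> > 0 \<and> 0 \<le> \<mu> \<and> \<mu> < 1 \<and> (\<forall>k>k0. infdist (z k) W \<le> \<xi> * \<mu> ^ (k - k0))"
    if \<alpha>: "0 < \<alpha>" "\<alpha> \<le> 1 / 2"
  proof -
    obtain D where D: "D > 0" "\<And>k. k \<ge> N \<Longrightarrow> infdist (z (Suc k)) W \<le> D * e k powr min (1 - \<alpha>) (1 / 2)"
      using dist_bound \<alpha> by auto
    define Q where "Q = C\<^sup>2 / \<tau>"
    have Q: "Q > 0" using CT by (simp add: Q_def)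
    define q where "q = Q / (1 + Q)"
    have q: "0 \<le> q" "q < 1" using Q by (simp_all add: q_def)
    have lin: "e (N + j) \<le> q ^ j" for j
      unfolding q_def
    proof (rule linear_decay[where e = "\<lambda>j. e (N + j)" and a = "2 * \<alpha>"])
      show "e (N + Suc k) powr (2 * \<alpha>) \<le> Q * (e (N + k) - e (N + Suc k))" for k
        using rec[of "N + k"] by (simp add: Q_def)
    qed (use \<alpha> Q e0 edec e1[of N] in simp_all)
    have "infdist (z k) W \<le> D * sqrt q ^ (k - Suc N)" if k: "k > Suc N" for k
    proof -
      obtain j where j: "k = Suc (N + j)" using k by (metis Suc_lessE less_imp_Suc_add add_Suc_right)
      have "infdist (z k) W \<le> D * sqrt (e (N + j))"
      proof -
        have half: "min (1 - \<alpha>) (1 / 2) = 1 / 2" using \<alpha> by simp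
        show ?thesis using D(2)[of "N + j", unfolded half] e0[of "N + j"] by (simp add: j powr_half_sqrt)
      qed
      also have "\<dots> \<le> D * sqrt (q ^ j)" using D lin[of j] by (intro mult_left_mono) auto
      finally show ?thesis by (simp add: j real_sqrt_power)
    qed
    then show ?thesis using D(1) q by (intro exI[of _ "Suc N"] exI[of _ D] exI[of _ "sqrt q"]) auto
  qed
  show "\<exists>(k0::nat) \<xi>. \<xi> > 0 \<and> (\<forall>k>k0. infdist (z k) W \<le> \<xi> * real (k - k0) powr (- ((1 - \<alpha>) / (2 * \<alpha> - 1))))"
    if \<alpha>: "1 / 2 < \<alpha>" "\<alpha> < 1"
  proof -
    obtain D where D: "D > 0" "\<And>k. k \<ge> N \<Longrightarrow> infdist (z (Suc k)) W \<le> D * e k powr min (1 - \<alpha>) (1 / 2)"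
      using dist_bound \<alpha> by auto
    have "\<exists>b>0. \<forall>j>0. e (N + j) \<le> b * real j powr (- (1 / (2 * \<alpha> - 1)))"
    proof (rule sublinear_decay[where e = "\<lambda>j. e (N + j)"])
      show "e (N + Suc k) powr (1 + (2 * \<alpha> - 1)) \<le> C\<^sup>2 / \<tau> * (e (N + k) - e (N + Suc k))" for k
        using rec[of "N + k"] by simp
    qed (use \<alpha> CT e0 edec in simp_all)
    then obtain b where b: "b > 0" "\<And>j. j > 0 \<Longrightarrow> e (N + j) \<le> b * real j powr (- (1 / (2 * \<alpha> - 1)))" by blast
    define \<xi> where "\<xi> = D * b powr (1 - \<alpha>)"
    have "infdist (z k) W \<le> \<xi> * real (k - Suc N) powr (- ((1 - \<alpha>) / (2 * \<alpha> - 1)))" if k: "k > Suc N" for k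
    proof -
      define j where "j = k - Suc N"
      have j: "k = Suc (N + j)" "j > 0" using k by (auto simp: j_def)
      have "infdist (z k) W \<le> D * e (N + j) powr (1 - \<alpha>)"
      proof -
        have "min (1 - \<alpha>) (1 / 2) = 1 - \<alpha>" using \<alpha> by simp
        then show ?thesis using D(2)[of "N + j"] by (simp add: j)
      qed
      also have "e (N + j) powr (1 - \<alpha>) \<le> (b * real j powr (- (1 / (2 * \<alpha> - 1)))) powr (1 - \<alpha>)"
        using e0 b(2)[OF j(2)] \<alpha> by (intro powr_mono2) auto
      also have "\<dots> = b powr (1 - \<alpha>) * real j powr (- (1 / (2 * \<alpha> - 1)) * (1 - \<alpha>))"
        using b(1) by (simp add: powr_mult powr_powr)
      also have "- (1 / (2 * \<alpha> - 1)) * (1 - \<alpha>) = - ((1 - \<alpha>) / (2 * \<alpha> - 1))" by simp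
      finally show ?thesis using D(1) by (simp add: \<xi>_def j_def[symmetric] mult.assoc)
    qed
    then show ?thesis using D(1) b(1) by (intro exI[of _ "Suc N"] exI[of _ \<xi>]) (auto simp: \<xi>_def)
  qed
qed

section \<open>Augmented Lagrangians of bilinearly constrained problems\<close>

text \<open>
  The data of an augmented Lagrangian for minimizing \<open>F U V\<close> subject to \<open>B U V = b\<close>. Here \<open>C U\<close> is the adjoint
  of \<open>B U\<close>, and \<open>G U V\<close> is the gradient of \<open>F U\<close> at \<open>V\<close>. The assumption \<open>F_scale\<close> says that \<open>F\<close> depends
  on the pair only through the distance \<open>|U - V|\<close> when \<open>U\<close> and \<open>V\<close> are scaled inversely. The assumption
  \<open>level\<close> turns membership in a level set into norm bounds and a lower bound for \<open>C U\<close>, and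
  \<open>G_bound\<close> and \<open>G_lip\<close> only require \<open>|U| \<le> \<delta>\<close> and \<open>|U| + |V| \<le> 2 \<delta>\<close>. The last two assumptions
  are the lower bounds \<open>\<rho> > 2 c\<^sub>1 / \<gamma>\<close> and \<open>\<rho> > 2 c\<^sub>2 / \<gamma>\<close> for the penalty parameter, where
  \<open>c\<^sub>1 = 2 (p + s M)\<^sup>2 / \<eta>\<^sup>2\<close> and \<open>c\<^sub>2 = 2 q\<^sup>2 / \<eta>\<^sup>2\<close>.
\<close>

locale bilinear_lagrangian =
  fixes F :: "'a::euclidean_space \<Rightarrow> 'a \<Rightarrow> real"
    and G :: "'a \<Rightarrow> 'a \<Rightarrow> 'a"
    and B :: "'a \<Rightarrow> 'a \<Rightarrow> 'b::euclidean_space"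
    and C :: "'a \<Rightarrow> 'b \<Rightarrow> 'a"
    and b :: 'b
    and \<gamma> \<rho> \<delta> \<eta> \<beta> M s p q :: real
  assumes gamma_pos: "\<gamma> > 0" and rho_pos: "\<rho> > 0" and eta_pos: "\<eta> > 0"
    and delta_pos: "\<delta> > 0" and M_nonneg: "M \<ge> 0"
    and s_nonneg: "s \<ge> 0" and p_nonneg: "p \<ge> 0" and q_nonneg: "q \<ge> 0"
    and B_bilinear: "bounded_bilinear B"
    and C_bilinear: "bounded_bilinear C"
    and B_sym: "B U V = B V U"
    and adjoint: "C U y \<bullet> V = y \<bullet> B U V"
    and F_sym: "F U V = F V U"
    and F_total: "((\<lambda>z. F (fst z) (snd z)) has_derivative
         (\<lambda>h. G (snd z) (fst z) \<bullet> fst h + G (fst z) (snd z) \<bullet> snd h)) (at z)"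
    and F_strong: "F U Y \<ge> F U V + G U V \<bullet> (Y - V) + \<gamma> / 2 * (norm (Y - V))\<^sup>2"
    and F_scale: "c \<noteq> 0 \<Longrightarrow> F (c *\<^sub>R U) (inverse c *\<^sub>R V) =
         F U V + \<gamma> / 2 * ((norm (c *\<^sub>R U - inverse c *\<^sub>R V))\<^sup>2 - (norm (U - V))\<^sup>2)"
    and level: "F U V + \<rho> / 4 * (norm (B U V - b))\<^sup>2 \<le> \<beta> \<Longrightarrow>
         norm U \<le> \<delta> \<and> norm V \<le> \<delta> \<and> (\<forall>y. \<eta> * norm y \<le> norm (C U y))"
    and G_bound: "norm U \<le> \<delta> \<Longrightarrow> norm U + norm V \<le> 2 * \<delta> \<Longrightarrow> norm (G U V) \<le> \<eta> * M"
    and G_lip: "norm U \<le> \<delta> \<Longrightarrow> norm U + norm V \<le> 2 * \<delta> \<Longrightarrow>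
         norm U' \<le> \<delta> \<Longrightarrow> norm U' + norm V' \<le> 2 * \<delta> \<Longrightarrow>
         norm (G U' V' - G U V) \<le> p * norm (U' - U) + q * norm (V' - V)"
    and C_norm: "norm (C U y) \<le> s * norm U * norm y"
    and rho_U: "4 * (p + s * M)\<^sup>2 < \<gamma> * \<rho> * \<eta>\<^sup>2"
    and rho_V: "4 * q\<^sup>2 < \<gamma> * \<rho> * \<eta>\<^sup>2"
begin

sublocale B: bounded_bilinear B by (rule B_bilinear)
sublocale C: bounded_bilinear C by (rule C_bilinear)

definition Lag :: "'a \<Rightarrow> 'a \<Rightarrow> 'b \<Rightarrow> real" where
  "Lag U V y = F U V + y \<bullet> (B U V - b) + \<rho> / 2 * (norm (B U V - b))\<^sup>2"

lemma F_cont: "continuous_on UNIV (\<lambda>z. F (fst z) (snd z))"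
  using F_total by (meson continuous_at_imp_continuous_on has_derivative_continuous)

lemma F_deriv: "(F U has_derivative (\<lambda>H. G U V \<bullet> H)) (at V)"
proof -
  have 1: "((\<lambda>Y. (U, Y)) has_derivative (\<lambda>H. (0, H))) (at V)"
    by (intro has_derivative_Pair has_derivative_const has_derivative_ident)
  have 2: "((\<lambda>z. F (fst z) (snd z)) has_derivative (\<lambda>h. G V U \<bullet> fst h + G U V \<bullet> snd h)) (at (U, V))"
    using F_total[of "(U, V)"] by simp
  show ?thesis using has_derivative_compose[OF 1 2] by simp
qed

lemma Lag_sym: "Lag U V y = Lag V U y"
  unfolding Lag_def using F_sym[of U V] B_sym[of U V] by simp

text \<open>
  Stationarity in \<open>V\<close> together with the bounds under which \<open>G\<close> is controlled. The bound on \<open>V\<close> is on the sum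
  of the norms because this is what survives when \<open>(U, V)\<close> itself is outside the level set.
\<close>

definition crit :: "'a \<Rightarrow> 'a \<Rightarrow> 'b \<Rightarrow> bool" where
  "crit U V y \<longleftrightarrow> norm U \<le> \<delta> \<and> norm U + norm V \<le> 2 * \<delta> \<and>
     (\<forall>x. \<eta> * norm x \<le> norm (C U x)) \<and> C U y + G U V = 0"

lemma crit_multiplier_bound:
  assumes "crit U V y" shows "norm y \<le> M"
proof -
  have "\<eta> * norm y \<le> norm (C U y)" using assms by (auto simp: crit_def)
  also have "C U y = - G U V" using assms by (simp add: crit_def eq_neg_iff_add_eq_0)
  also have "norm (- G U V) \<le> \<eta> * M" using G_bound[of U V] assms by (simp add: crit_def)
  finally show ?thesis using eta_pos by simp
qed

text \<open>
  Subtracting the two stationarity relations gives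
  \<open>C U' (y' - y) = - (G U' V' - G U V) - C (U' - U) y\<close>, and \<open>C U'\<close> is bounded below by \<open>\<eta>\<close>.
\<close>

lemma crit_multiplier_lipschitz:
  assumes 1: "crit U V y" and 2: "crit U' V' y'"
  shows "\<eta>\<^sup>2 * (norm (y' - y))\<^sup>2 \<le>
    2 * (p + s * M)\<^sup>2 * (norm (U' - U))\<^sup>2 + 2 * q\<^sup>2 * (norm (V' - V))\<^sup>2"
proof -
  have y: "norm y \<le> M" by (rule crit_multiplier_bound[OF 1])
  have e: "C U y = - G U V" "C U' y' = - G U' V'"
    using 1 2 by (simp_all add: crit_def eq_neg_iff_add_eq_0)
  have "C U' (y' - y) = - (G U' V' - G U V) - C (U' - U) y"
    using e by (simp add: C.diff_left C.diff_right)
  then have "norm (C U' (y' - y)) = norm ((G U' V' - G U V) + C (U' - U) y)"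
    by (metis add_uminus_conv_diff minus_add_distrib norm_minus_cancel)
  also have "\<dots> \<le> norm (G U' V' - G U V) + norm (C (U' - U) y)"
    by (rule norm_triangle_ineq)
  also have "norm (G U' V' - G U V) \<le> p * norm (U' - U) + q * norm (V' - V)"
    using 1 2 by (intro G_lip) (auto simp: crit_def)
  also have "norm (C (U' - U) y) \<le> s * norm (U' - U) * M"
    using C_norm[of "U' - U" y] y s_nonneg
    by (meson mult_left_mono norm_ge_zero mult_nonneg_nonneg order_trans)
  finally have *: "norm (C U' (y' - y)) \<le> (p + s * M) * norm (U' - U) + q * norm (V' - V)"
    by (simp add: algebra_simps)
  have "\<eta> * norm (y' - y) \<le> (p + s * M) * norm (U' - U) + q * norm (V' - V)"
    using 2 * unfolding crit_def by (meson order_trans)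
  then have "(\<eta> * norm (y' - y))\<^sup>2 \<le> ((p + s * M) * norm (U' - U) + q * norm (V' - V))\<^sup>2"
    using eta_pos by (intro power_mono) auto
  also have "\<dots> \<le> 2 * ((p + s * M) * norm (U' - U))\<^sup>2 + 2 * (q * norm (V' - V))\<^sup>2"
    using sum_squares_bound[of "(p + s * M) * norm (U' - U)" "q * norm (V' - V)"]
    by (simp add: power2_sum)
  finally show ?thesis by (simp add: power_mult_distrib)
qed

lemma crit_multiplier_change:
  assumes "crit U V y" and "crit U' V' y'"
  shows "(norm (y' - y))\<^sup>2 \<le> \<gamma> * \<rho> / 2 * ((norm (U' - U))\<^sup>2 + (norm (V' - V))\<^sup>2)"
proof -
  have "\<eta>\<^sup>2 * (norm (y' - y))\<^sup>2 \<le>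
    2 * (p + s * M)\<^sup>2 * (norm (U' - U))\<^sup>2 + 2 * q\<^sup>2 * (norm (V' - V))\<^sup>2"
    by (rule crit_multiplier_lipschitz[OF assms])
  also have "\<dots> \<le> (\<gamma> * \<rho> * \<eta>\<^sup>2 / 2) * (norm (U' - U))\<^sup>2 + (\<gamma> * \<rho> * \<eta>\<^sup>2 / 2) * (norm (V' - V))\<^sup>2"
    using rho_U rho_V by (intro add_mono mult_right_mono) auto
  also have "\<dots> = \<eta>\<^sup>2 * (\<gamma> * \<rho> / 2 * ((norm (U' - U))\<^sup>2 + (norm (V' - V))\<^sup>2))"
    by (simp add: algebra_simps)
  finally show ?thesis using eta_pos by simp
qed

lemma Lag_strong:
  "Lag W Y y \<ge> Lag W X y + (G W X + C W (y + \<rho> *\<^sub>R (B W X - b))) \<bullet> (Y - X)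
     + \<gamma> / 2 * (norm (Y - X))\<^sup>2 + \<rho> / 2 * (norm (B W Y - B W X))\<^sup>2"
proof -
  define h k where "h = B W X - b" and "k = B W Y - b"
  have d: "B W (Y - X) = k - h" by (simp add: h_def k_def B.diff_right)
  have "(norm k)\<^sup>2 = (norm h)\<^sup>2 + 2 * (h \<bullet> (k - h)) + (norm (k - h))\<^sup>2"
    by (simp add: power2_norm_eq_inner algebra_simps inner_commute)
  moreover have "C W (y + \<rho> *\<^sub>R h) \<bullet> (Y - X) = y \<bullet> (k - h) + \<rho> * (h \<bullet> (k - h))"
    by (simp add: adjoint d inner_add_left)
  moreover have "B W Y - B W X = k - h" by (simp add: h_def k_def)
  ultimately show ?thesis
    unfolding Lag_def h_def[symmetric] k_def[symmetric] inner_add_left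
    using F_strong[of W X Y]
    by (simp add: inner_diff_right[of y k h] distrib_left add_divide_distrib)
qed

lemma Lag_minimizer:
  assumes "\<And>Y. Lag W X y \<le> Lag W Y y"
  shows "G W X + C W (y + \<rho> *\<^sub>R (B W X - b)) = 0"
proof -
  define D where "D = G W X + C W (y + \<rho> *\<^sub>R (B W X - b))"
  have Bd: "((\<lambda>Y. B W Y - b) has_derivative (\<lambda>H. B W H)) (at X)"
    by (auto intro!: derivative_eq_intros bounded_linear_imp_has_derivative B.bounded_linear_right)
  have Fd: "((\<lambda>Y. F W Y) has_derivative (\<lambda>H. G W X \<bullet> H)) (at X)"
    using F_deriv[of W X] by simp
  have n: "(\<lambda>Y. Lag W Y y) = (\<lambda>Y. F W Y + y \<bullet> (B W Y - b) + \<rho> / 2 * ((B W Y - b) \<bullet> (B W Y - b)))"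
    by (simp add: Lag_def power2_norm_eq_inner)
  have "((\<lambda>Y. Lag W Y y) has_derivative (\<lambda>H. G W X \<bullet> H + y \<bullet> B W H
        + \<rho> / 2 * ((B W X - b) \<bullet> B W H + B W H \<bullet> (B W X - b)))) (at X)"
    unfolding n
    by (intro has_derivative_add Fd has_derivative_inner_right[OF Bd] has_derivative_mult_right
          has_derivative_inner[OF Bd Bd])
  also have "(\<lambda>H. G W X \<bullet> H + y \<bullet> B W H + \<rho> / 2 * ((B W X - b) \<bullet> B W H + B W H \<bullet> (B W X - b)))
      = (\<lambda>H. D \<bullet> H)"
  proof
    fix H
    show "G W X \<bullet> H + y \<bullet> B W H + \<rho> / 2 * ((B W X - b) \<bullet> B W H + B W H \<bullet> (B W X - b)) = D \<bullet> H"
      unfolding D_def inner_add_left adjoint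
      by (simp add: inner_commute[of "B W H" "B W X - b"])
  qed
  finally have "((\<lambda>Y. Lag W Y y) has_derivative (\<lambda>H. D \<bullet> H)) (at X)" .
  then have "(\<lambda>H. D \<bullet> H) = (\<lambda>H. 0)"
    using differential_zero_maxmin[of X UNIV "\<lambda>Y. Lag W Y y" "\<lambda>H. D \<bullet> H"] assms by simp
  then have "D \<bullet> D = 0" by meson
  then show ?thesis by (simp add: D_def)
qed

lemma Lag_descent:
  assumes "\<And>Y. Lag W X y \<le> Lag W Y y"
  shows "Lag W X y + \<gamma> / 2 * (norm (Y - X))\<^sup>2 \<le> Lag W Y y"
proof -
  have "\<gamma> / 2 * (norm (Y - X))\<^sup>2 + \<rho> / 2 * (norm (B W Y - B W X))\<^sup>2 + Lag W X y \<le> Lag W Y y"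
    using Lag_strong[of W X y Y] Lag_minimizer[OF assms] by simp
  moreover have "\<rho> / 2 * (norm (B W Y - B W X))\<^sup>2 \<ge> 0" using rho_pos by simp
  ultimately show ?thesis by linarith
qed

text \<open>
  The continuity argument below follows the segment from the old to the new point, so the descent is needed at
  every point of it. The directional derivative towards the minimizer is nonpositive along the
  whole segment.
\<close>

lemma Lag_descent_segment:
  assumes min: "\<And>Y. Lag W X y \<le> Lag W Y y" and t: "0 \<le> t" "t \<le> 1"
    and Z: "Z = Y + t *\<^sub>R (X - Y)"
  shows "Lag W Z y + \<gamma> / 2 * (norm (Z - Y))\<^sup>2 \<le> Lag W Y y"
proof -
  define D where "D = G W Z + C W (y + \<rho> *\<^sub>R (B W Z - b))"
  have nn: "\<rho> / 2 * (norm (B W A' - B W B'))\<^sup>2 \<ge> 0" "\<gamma> / 2 * (norm (A' - B'))\<^sup>2 \<ge> 0" for A' B'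
    using rho_pos gamma_pos by simp_all
  have 1: "D \<bullet> (X - Z) \<le> 0"
    using Lag_strong[of W Z y X] min[of Z] nn[of X Z] unfolding D_def by linarith
  have XZ: "X - Z = (1 - t) *\<^sub>R (X - Y)" by (simp add: Z algebra_simps)
  have "D \<bullet> (X - Y) \<le> 0"
  proof (cases "t = 1")
    case True
    then have "Z = X" by (simp add: Z)
    then have "D = 0" using Lag_minimizer[OF min] by (simp add: D_def)
    then show ?thesis by simp
  next
    case False
    then have "(1 - t) * (D \<bullet> (X - Y)) \<le> 0" using 1 XZ by simp
    with False t show ?thesis by (simp add: mult_le_0_iff)
  qed
  then have "D \<bullet> (Y - Z) \<ge> 0"
    using t by (simp add: Z inner_diff_right mult_le_0_iff[symmetric] mult_nonneg_nonpos)
  then show ?thesis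
    using Lag_strong[of W Z y Y] nn[of Y Z] unfolding D_def by (simp add: norm_minus_commute)
qed

lemma level_nonzero:
  assumes "F U V + \<rho> / 4 * (norm (B U V - b))\<^sup>2 \<le> \<beta>"
  shows "U \<noteq> 0"
proof
  assume "U = 0"
  obtain x :: 'b where "x \<in> Basis" using nonempty_Basis by blast
  then have "\<eta> * 1 \<le> norm (C U x)" using level[OF assms] by (metis norm_Basis)
  then show False using \<open>U = 0\<close> eta_pos by (simp add: C.zero_left)
qed

lemma level_swap:
  "F U V + \<rho> / 4 * (norm (B U V - b))\<^sup>2 \<le> \<beta> \<Longrightarrow> F V U + \<rho> / 4 * (norm (B V U - b))\<^sup>2 \<le> \<beta>"
  using F_sym[of U V] B_sym[of U V] by simp

text \<open>
  If the level set has room for an increase of \<open>\<gamma> / 2 * e\<^sup>2\<close>, then \<open>|U| + |Y|\<close> stays below \<open>2 \<delta>\<close> by \<open>e\<close>.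
  Otherwise \<open>Y\<close> could be scaled up to a norm \<open>d > \<delta>\<close> and \<open>U\<close> scaled down by the same factor: the product and
  the constraint do not change, and the increase of \<open>|U - Y|\<^sup>2\<close> is
  \<open>(d\<^sup>2 - |Y|\<^sup>2) (d\<^sup>2 - |U|\<^sup>2) / d\<^sup>2 \<le> (2 d - |U| - |Y|)\<^sup>2 \<le> e\<^sup>2\<close>, so the scaled pair would still lie in the
  level set.
\<close>

lemma norm_sum_room:
  assumes feas: "B U Y = b" and e: "e \<ge> 0" and room: "F U Y + \<gamma> / 2 * e\<^sup>2 \<le> \<beta>"
  shows "norm U + norm Y + e \<le> 2 * \<delta>"
proof (rule ccontr)
  assume "\<not> ?thesis"
  then have gt: "norm U + norm Y + e > 2 * \<delta>" by simp
  define u v where "u = norm U" and "v = norm Y"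
  have lev: "F U Y + \<rho> / 4 * (norm (B U Y - b))\<^sup>2 \<le> \<beta>"
  proof -
    have "\<gamma> / 2 * e\<^sup>2 \<ge> 0" using gamma_pos by simp
    then show ?thesis using room feas by simp
  qed
  have uv: "u \<le> \<delta>" "v \<le> \<delta>" using level[OF lev] by (auto simp: u_def v_def)
  have v0: "v > 0" using level_nonzero[OF level_swap[OF lev]] by (simp add: v_def)
  have u0: "u \<ge> 0" by (simp add: u_def)
  \<comment> \<open>The new norm of \<open>Y\<close> lies halfway between \<open>\<delta>\<close> and \<open>(u + v + e) / 2 > \<delta>\<close>.\<close>
  define d where "d = (\<delta> + (u + v + e) / 2) / 2"
  have d: "d > \<delta>" "2 * d - u - v \<le> e" using gt by (auto simp: d_def u_def v_def field_simps)
  have d0: "d > 0" using d delta_pos by simp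
  define c where "c = v / d"
  have c: "c > 0" using v0 d0 by (simp add: c_def)
  have ip: "(norm (c *\<^sub>R U - inverse c *\<^sub>R Y))\<^sup>2 = c\<^sup>2 * u\<^sup>2 - 2 * (U \<bullet> Y) + v\<^sup>2 / c\<^sup>2"
  proof -
    have "(norm (c *\<^sub>R U - inverse c *\<^sub>R Y))\<^sup>2
        = (norm (c *\<^sub>R U))\<^sup>2 - 2 * ((c *\<^sub>R U) \<bullet> (inverse c *\<^sub>R Y)) + (norm (inverse c *\<^sub>R Y))\<^sup>2"
      by (simp only: power2_norm_eq_inner inner_diff_left inner_diff_right inner_commute[of Y U]
            inner_commute[of "inverse c *\<^sub>R Y" "c *\<^sub>R U"])
    also have "(c *\<^sub>R U) \<bullet> (inverse c *\<^sub>R Y) = U \<bullet> Y" using c by simp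
    also have "(norm (c *\<^sub>R U))\<^sup>2 = c\<^sup>2 * u\<^sup>2" by (simp add: u_def power_mult_distrib)
    also have "(norm (inverse c *\<^sub>R Y))\<^sup>2 = v\<^sup>2 / c\<^sup>2"
      using c by (simp add: v_def power_mult_distrib power_inverse divide_inverse)
    finally show ?thesis .
  qed
  have ip1: "(norm (U - Y))\<^sup>2 = u\<^sup>2 - 2 * (U \<bullet> Y) + v\<^sup>2"
    unfolding u_def v_def by (simp add: power2_norm_eq_inner algebra_simps inner_commute)
  have vc: "v\<^sup>2 / c\<^sup>2 = d\<^sup>2" using v0 d0 by (simp add: c_def power_divide)
  have "(norm (c *\<^sub>R U - inverse c *\<^sub>R Y))\<^sup>2 - (norm (U - Y))\<^sup>2 = (d\<^sup>2 - v\<^sup>2) * (d\<^sup>2 - u\<^sup>2) / d\<^sup>2"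
    unfolding ip ip1 vc using d0 by (simp add: c_def power_divide field_simps power2_eq_square)
  also have "(d\<^sup>2 - v\<^sup>2) * (d\<^sup>2 - u\<^sup>2) \<le> d\<^sup>2 * e\<^sup>2"
  proof -
    have "(d\<^sup>2 - v\<^sup>2) * (d\<^sup>2 - u\<^sup>2) = ((d - v) * (d - u)) * ((d + v) * (d + u))"
      by (simp add: algebra_simps power2_eq_square)
    also have "\<dots> \<le> ((d - v) * (d - u)) * ((2 * d) * (2 * d))"
      using uv d u0 v0 by (intro mult_left_mono mult_mono) auto
    also have "\<dots> = d\<^sup>2 * (4 * ((d - v) * (d - u)))" by (simp add: power2_eq_square)
    also have "4 * ((d - v) * (d - u)) \<le> (2 * d - u - v)\<^sup>2"
      using zero_le_power2[of "u - v"] by (simp add: algebra_simps power2_eq_square)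
    also have "(2 * d - u - v)\<^sup>2 \<le> e\<^sup>2" using uv d by (intro power_mono) auto
    finally show ?thesis by (simp add: mult_left_mono)
  qed
  then have "(d\<^sup>2 - v\<^sup>2) * (d\<^sup>2 - u\<^sup>2) / d\<^sup>2 \<le> e\<^sup>2" using d0 by (simp add: divide_le_eq mult.commute)
  finally have inc: "(norm (c *\<^sub>R U - inverse c *\<^sub>R Y))\<^sup>2 - (norm (U - Y))\<^sup>2 \<le> e\<^sup>2" .
  have "F (c *\<^sub>R U) (inverse c *\<^sub>R Y) \<le> F U Y + \<gamma> / 2 * e\<^sup>2"
    using F_scale[of c U Y] c inc gamma_pos by simp
  moreover have "B (c *\<^sub>R U) (inverse c *\<^sub>R Y) = b"
    using c feas by (simp add: B.scaleR_left B.scaleR_right)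
  ultimately have "norm (inverse c *\<^sub>R Y) \<le> \<delta>"
    using level[of "c *\<^sub>R U" "inverse c *\<^sub>R Y"] room by simp
  moreover have "norm (inverse c *\<^sub>R Y) = d" using c v0 d0 by (simp add: c_def v_def[symmetric])
  ultimately show False using d by simp
qed

text \<open>
  Weak duality: on the slice \<open>B U V = B U Y\<close> the point \<open>Y\<close> minimizes \<open>F U\<close>, and off the slice the multiplier
  \<open>\<nu>\<close> prices the change of the constraint value.
\<close>

lemma multiplier_lower_bound:
  assumes "C U \<nu> + G U Y = 0"
  shows "F U Y + \<gamma> / 2 * (norm (V - Y))\<^sup>2 \<le> F U V + \<nu> \<bullet> (B U V - B U Y)"
proof -
  have "G U Y = - C U \<nu>" using assms by (simp add: eq_neg_iff_add_eq_0 add.commute)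
  then show ?thesis using F_strong[of U Y V] by (simp add: adjoint B.diff_right)
qed

text \<open>
  Complete the square in \<open>\<langle>y - \<nu>, h\<rangle> + \<rho>/2 |h|\<^sup>2\<close>: replacing the multiplier \<open>\<nu>\<close> by \<open>y\<close> costs at most
  \<open>|y - \<nu>|\<^sup>2 / (2 \<rho>)\<close>.
\<close>

lemma feasible_value_le_Lag:
  assumes "C U \<nu> + G U Y = 0" and "B U Y = b"
  shows "F U Y + \<gamma> / 2 * (norm (V - Y))\<^sup>2 \<le> Lag U V y + (norm (y - \<nu>))\<^sup>2 / (2 * \<rho>)"
proof -
  define h where "h = B U V - b"
  have "0 \<le> (norm (\<rho> *\<^sub>R h + (y - \<nu>)))\<^sup>2 / (2 * \<rho>)" using rho_pos by simp
  also have "\<dots> = y \<bullet> h - \<nu> \<bullet> h + \<rho> / 2 * (norm h)\<^sup>2 + (norm (y - \<nu>))\<^sup>2 / (2 * \<rho>)"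
    using rho_pos unfolding power2_norm_eq_inner
    by (simp add: inner_add_left inner_add_right inner_diff_left inner_diff_right inner_commute field_simps)
  finally show ?thesis
    using multiplier_lower_bound[OF assms(1), of V] assms(2) by (simp add: Lag_def h_def)
qed

text \<open>
  The strong convexity inequalities at \<open>V\<close> and at \<open>Y\<close> add up to
  \<open>\<gamma> |V - Y|\<^sup>2 \<le> - \<langle>y' - \<nu>, y' - y\<rangle> / \<rho>\<close>, and the right-hand side is largest when \<open>y'\<close> is the midpoint of
  \<open>y\<close> and \<open>\<nu>\<close>. The lemma thus applies before
  \<open>V\<close> is known to satisfy the bounds in \<open>crit\<close>.
\<close>

lemma prox_displacement:
  assumes V: "C U y' + G U V = 0" and y': "y' = y + \<rho> *\<^sub>R (B U V - b)"
    and Y: "C U \<nu> + G U Y = 0" "B U Y = b"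
  shows "\<gamma> * (norm (V - Y))\<^sup>2 \<le> (norm (y - \<nu>))\<^sup>2 / (4 * \<rho>)"
proof -
  have "F U Y + \<gamma> / 2 * (norm (V - Y))\<^sup>2 \<le> F U V + \<nu> \<bullet> (B U V - b)"
    using multiplier_lower_bound[OF Y(1), of V] Y(2) by simp
  moreover have "F U V + \<gamma> / 2 * (norm (V - Y))\<^sup>2 \<le> F U Y + y' \<bullet> (b - B U V)"
    using multiplier_lower_bound[OF V, of Y] Y(2) by (simp add: norm_minus_commute)
  ultimately have "\<gamma> * (norm (V - Y))\<^sup>2 \<le> - ((y' - \<nu>) \<bullet> (B U V - b))"
    by (simp add: inner_diff_left inner_diff_right algebra_simps)
  also have "B U V - b = inverse \<rho> *\<^sub>R (y' - y)" using rho_pos by (simp add: y')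
  also have "- ((y' - \<nu>) \<bullet> (inverse \<rho> *\<^sub>R (y' - y))) = - ((y' - \<nu>) \<bullet> (y' - y)) / \<rho>"
    by (simp add: divide_inverse mult.commute)
  also have "\<dots> \<le> ((norm (y - \<nu>))\<^sup>2 / 4) / \<rho>"
  proof (rule divide_right_mono)
    have "0 \<le> (norm (2 *\<^sub>R (y' - \<nu>) - (y - \<nu>)))\<^sup>2" by simp
    then show "- ((y' - \<nu>) \<bullet> (y' - y)) \<le> (norm (y - \<nu>))\<^sup>2 / 4"
      unfolding power2_norm_eq_inner
      by (simp add: inner_diff_left inner_diff_right inner_commute algebra_simps)
  qed (use rho_pos in simp)
  finally show ?thesis by simp
qed

lemma B_norm: "norm (B U V) \<le> s * norm U * norm V"
proof -
  have "(norm (B U V))\<^sup>2 = C U (B U V) \<bullet> V" by (simp add: adjoint power2_norm_eq_inner)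
  also have "\<dots> \<le> norm (C U (B U V)) * norm V" by (rule norm_cauchy_schwarz)
  also have "\<dots> \<le> (s * norm U * norm (B U V)) * norm V" by (intro mult_right_mono C_norm) simp
  finally have "norm (B U V) * norm (B U V) \<le> norm (B U V) * (s * norm U * norm V)"
    by (simp add: power2_eq_square algebra_simps)
  then show ?thesis using s_nonneg by (cases "B U V = 0") auto
qed

text \<open>
  Solve \<open>B U (C U x) = w\<close>: the operator on the left is positive definite because \<open>C U\<close> is bounded below.
\<close>

lemma B_right_inverse:
  assumes e: "e > 0" and inj: "\<And>x. e * norm x \<le> norm (C U x)"
  shows "\<exists>D. B U D = w \<and> norm D \<le> norm w / e"
proof -
  \<comment> \<open>the Gram operator of the constraint\<close>
  define T where "T = (\<lambda>x. B U (C U x))"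
  have lin: "linear T"
    unfolding T_def using bounded_linear.linear[OF bounded_linear_compose[OF B.bounded_linear_right C.bounded_linear_right]]
    by simp
  have "inj T"
  proof (rule linear_injective_0[OF lin, THEN iffD2], intro allI impI)
    fix x assume "T x = 0"
    then have "C U x \<bullet> C U x = 0" by (simp add: adjoint T_def)
    then have "e * norm x \<le> 0" using inj[of x] by simp
    then show "x = 0" using e by (simp add: mult_le_0_iff)
  qed
  then have "surj T" using lin linear_injective_imp_surjective by blast
  then obtain x where x: "w = T x" by blast
  define D where "D = C U x"
  have "(norm D)\<^sup>2 = x \<bullet> w" by (simp add: D_def x T_def adjoint power2_norm_eq_inner)
  also have "\<dots> \<le> norm x * norm w" by (rule norm_cauchy_schwarz)
  also have "\<dots> \<le> (norm D / e) * norm w"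
    using inj[of x] e by (intro mult_right_mono) (auto simp: D_def field_simps)
  finally have "norm D * norm D \<le> norm D * (norm w / e)" by (simp add: power2_eq_square)
  then have "norm D \<le> norm w / e" using e by (cases "D = 0") (auto simp: mult_le_cancel_left simp del: times_divide_eq_right)
  moreover have "B U D = w" by (simp add: D_def x T_def)
  ultimately show ?thesis by blast
qed

text \<open>
  The range of the adjoint \<open>C U\<close> is the orthogonal complement of the kernel of \<open>B U\<close>; this provides Lagrange
  multipliers for affine constraints.
\<close>

lemma orthogonal_kernel_imp_range:
  assumes "\<And>Z. B U Z = 0 \<Longrightarrow> g \<bullet> Z = 0"
  shows "\<exists>x. g = C U x"
proof -
  have sub: "subspace (range (C U))"
    by (rule linear_subspace_image[OF bounded_linear.linear[OF C.bounded_linear_right] subspace_UNIV])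
  obtain y z where y: "y \<in> span (range (C U))" and z: "\<And>w. w \<in> span (range (C U)) \<Longrightarrow> orthogonal z w"
    and g: "g = y + z"
    using orthogonal_subspace_decomp_exists[of "range (C U)" g] by blast
  have "z \<bullet> C U x = 0" for x
    using z[of "C U x"] by (simp add: orthogonal_def span_base)
  then have "x \<bullet> B U z = 0" for x by (metis adjoint inner_commute)
  then have "B U z = 0" by (metis inner_eq_zero_iff)
  then have "g \<bullet> z = 0" by (rule assms)
  moreover have "y \<bullet> z = 0" using z[OF y] by (simp add: orthogonal_def inner_commute)
  ultimately have "z = 0" by (simp add: g inner_add_left)
  then show ?thesis using y sub g by (auto simp: span_eq_iff[THEN iffD2])
qed

lemma F_continuous_on: "continuous_on S f \<Longrightarrow> continuous_on S g \<Longrightarrow> continuous_on S (\<lambda>x. F (f x) (g x))"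
  using continuous_on_compose2[OF F_cont, of S "\<lambda>x. (f x, g x)"] by (simp add: continuous_on_Pair)

lemma constrained_minimizer:
  assumes min: "\<And>Z. B U Z = B U Y \<Longrightarrow> F U Y \<le> F U Z"
  shows "\<exists>\<nu>. C U \<nu> + G U Y = 0"
proof -
  have "- G U Y \<bullet> Z = 0" if Z: "B U Z = 0" for Z
  proof -
    have d: "((\<lambda>t. F U (Y + t *\<^sub>R Z)) has_derivative (\<lambda>t. G U Y \<bullet> (t *\<^sub>R Z))) (at 0)"
    proof -
      have "((\<lambda>t. Y + t *\<^sub>R Z) has_derivative (\<lambda>t. t *\<^sub>R Z)) (at 0)"
        by (auto intro!: derivative_eq_intros)
      from has_derivative_compose[OF this, of "F U" "\<lambda>H. G U Y \<bullet> H"] F_deriv[of U Y]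
      show ?thesis by simp
    qed
    have "F U (Y + 0 *\<^sub>R Z) \<le> F U (Y + t *\<^sub>R Z)" for t :: real
      using min[of "Y + t *\<^sub>R Z"] Z by (simp add: B.add_right B.scaleR_right)
    then have "(\<lambda>t. G U Y \<bullet> (t *\<^sub>R Z)) = (\<lambda>t. 0)"
      using differential_zero_maxmin[of 0 UNIV, OF _ _ d] by simp
    then have "G U Y \<bullet> (1 *\<^sub>R Z) = 0" by meson
    then show ?thesis by simp
  qed
  then obtain \<nu> where "- G U Y = C U \<nu>" using orthogonal_kernel_imp_range[of U "- G U Y"] by blast
  then have "C U \<nu> + G U Y = 0" by (metis add.commute add.right_inverse)
  then show ?thesis ..
qed

lemma slice_minimizer:
  assumes Y0: "B U Y0 = b + w" "F U Y0 + \<rho> / 4 * (norm w)\<^sup>2 \<le> \<beta>"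
  shows "\<exists>Y \<nu>. B U Y = b + w \<and> C U \<nu> + G U Y = 0 \<and> F U Y \<le> F U Y0"
proof -
  define S where "S = {Y. B U Y = b + w \<and> F U Y \<le> F U Y0}"
  have "norm Y \<le> \<delta>" if "Y \<in> S" for Y using that Y0 level[of U Y] by (simp add: S_def)
  then have "bounded S" by (auto simp: bounded_iff)
  moreover have "closed S"
    unfolding S_def
    by (intro closed_Collect_conj closed_Collect_eq closed_Collect_le F_continuous_on continuous_intros
         bounded_linear.continuous_on[OF B.bounded_linear_right])
  ultimately have "compact S" by (simp add: compact_eq_bounded_closed)
  moreover have "Y0 \<in> S" using Y0 by (simp add: S_def)
  moreover have "continuous_on S (F U)" by (intro F_continuous_on continuous_intros)
  ultimately obtain Y where Y: "Y \<in> S" and min: "\<And>Z. Z \<in> S \<Longrightarrow> F U Y \<le> F U Z"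
    using continuous_attains_inf[of S "F U"] by blast
  have "F U Y \<le> F U Z" if "B U Z = B U Y" for Z
    using min[of Z] that Y by (cases "F U Z \<le> F U Y0") (auto simp: S_def)
  then obtain \<nu> where "C U \<nu> + G U Y = 0" using constrained_minimizer by blast
  then show ?thesis using Y by (auto simp: S_def)
qed

text \<open>
  Continuity method. The parameters \<open>t\<close> for which the slice \<open>B (U t) Y = b + w t\<close> meets the level set form a
  closed set by compactness. They form an open set if the minimal value is never exactly \<open>\<beta>\<close>: since
  \<open>C (U t)\<close> is bounded below, a point of the slice can be corrected to a point of any nearby slice. The
  hypothesis \<open>step\<close> may use that the minimizer of the slice is in the level set; this is what makes the
  a priori bounds available.
\<close>

lemma level_continuation:
  fixes U :: "real \<Rightarrow> 'a" and w :: "real \<Rightarrow> 'b"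
  assumes U: "continuous_on UNIV U" and w: "continuous_on UNIV w"
    and start: "B (U 0) Z = b + w 0" "F (U 0) Z + \<rho> / 4 * (norm (w 0))\<^sup>2 \<le> \<beta>"
    and step: "\<And>t Y \<nu>. 0 \<le> t \<Longrightarrow> t \<le> 1 \<Longrightarrow> B (U t) Y = b + w t \<Longrightarrow> C (U t) \<nu> + G (U t) Y = 0 \<Longrightarrow>
          F (U t) Y + \<rho> / 4 * (norm (w t))\<^sup>2 \<le> \<beta> \<Longrightarrow> F (U t) Y + \<rho> / 4 * (norm (w t))\<^sup>2 < \<beta>"
  shows "\<exists>Y \<nu>. B (U 1) Y = b + w 1 \<and> C (U 1) \<nu> + G (U 1) Y = 0 \<and>
           F (U 1) Y + \<rho> / 4 * (norm (w 1))\<^sup>2 \<le> \<beta>"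
proof -
  define P where "P = {z::real \<times> 'a. B (U (fst z)) (snd z) = b + w (fst z) \<and>
     F (U (fst z)) (snd z) + \<rho> / 4 * (norm (w (fst z)))\<^sup>2 \<le> \<beta>}"
  have Uc: "continuous_on UNIV (\<lambda>z::real \<times> 'a. U (fst z))"
    by (rule continuous_on_compose2[OF U]) (auto intro: continuous_intros)
  have wc: "continuous_on UNIV (\<lambda>z::real \<times> 'a. w (fst z))"
    by (rule continuous_on_compose2[OF w]) (auto intro: continuous_intros)
  have "closed P" unfolding P_def
    by (intro closed_Collect_conj closed_Collect_eq closed_Collect_le F_continuous_on continuous_intros
         B.continuous_on Uc wc)
  then have cl: "closed (P \<inter> {0..1} \<times> UNIV)" by (intro closed_Int closed_Times) auto
  have nb: "norm (snd z) \<le> \<delta>" if "z \<in> P" for z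
    using that level[of "U (fst z)" "snd z"] by (auto simp: P_def)
  have "P \<inter> {0..1} \<times> UNIV \<subseteq> {0..1} \<times> cball 0 \<delta>" using nb by auto
  then have "bounded (P \<inter> {0..1} \<times> UNIV)"
    by (rule bounded_subset[rotated]) (auto intro: bounded_Times)
  with cl have "compact (P \<inter> {0..1} \<times> UNIV)" by (simp add: compact_eq_bounded_closed)
  then have "compact (fst ` (P \<inter> {0..1} \<times> UNIV))"
    by (intro compact_continuous_image continuous_intros)
  then have closedT: "closed (fst ` (P \<inter> {0..1} \<times> UNIV))" by (rule compact_imp_closed)
  define T where "T = fst ` (P \<inter> {0..1} \<times> UNIV)"
  have T: "t \<in> T \<longleftrightarrow> 0 \<le> t \<and> t \<le> 1 \<and> (\<exists>Y. (t, Y) \<in> P)" for t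
    by (force simp: T_def)
  have cT: "closedin (top_of_set {0..1}) T"
    using closedT by (auto simp: T_def[symmetric] closedin_closed T intro!: exI[of _ T])
  have oT: "openin (top_of_set {0..1}) T"
  proof (subst openin_subopen, intro ballI)
    fix t assume "t \<in> T"
    then obtain Y1 where t: "0 \<le> t" "t \<le> 1" and Y1: "B (U t) Y1 = b + w t"
      "F (U t) Y1 + \<rho> / 4 * (norm (w t))\<^sup>2 \<le> \<beta>" by (auto simp: T P_def)
    obtain Y \<nu> where Y: "B (U t) Y = b + w t" "C (U t) \<nu> + G (U t) Y = 0" "F (U t) Y \<le> F (U t) Y1"
      using slice_minimizer[OF Y1] by blast
    have lev: "F (U t) Y + \<rho> / 4 * (norm (w t))\<^sup>2 \<le> \<beta>" using Y Y1 by simp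
    have strict: "F (U t) Y + \<rho> / 4 * (norm (w t))\<^sup>2 < \<beta>" using step[OF t Y(1,2) lev] .
    have inj: "\<eta> * norm y \<le> norm (C (U t) y)" for y using level[of "U t" Y] lev Y(1) by simp
    have Ut: "(U \<longlongrightarrow> U t) (at t)" using U by (simp add: continuous_on_def)
    have wt: "(w \<longlongrightarrow> w t) (at t)" using w by (simp add: continuous_on_def)
    define r where "r = (\<lambda>u. b + w u - B (U u) Y)"
    have r0: "(r \<longlongrightarrow> 0) (at t)"
    proof -
      have "(r \<longlongrightarrow> b + w t - B (U t) Y) (at t)" unfolding r_def
        by (intro tendsto_intros wt B.tendsto Ut)
      then show ?thesis using Y(1) by simp
    qed
    have "((\<lambda>u. s * norm (U u - U t)) \<longlongrightarrow> s * norm (U t - U t)) (at t)" by (intro tendsto_intros Ut)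
    then have "\<forall>\<^sub>F u in at t. s * norm (U u - U t) < \<eta> / 2"
      using order_tendstoD(2)[of _ "s * norm (U t - U t)" "at t" "\<eta> / 2"] eta_pos by simp
    then have ev: "\<forall>\<^sub>F u in at t. \<exists>D. B (U u) D = r u \<and> norm D \<le> norm (r u) / (\<eta> / 2)"
    proof eventually_elim
      case (elim u)
      have "\<eta> / 2 * norm x \<le> norm (C (U u) x)" for x
      proof -
        have "\<eta> * norm x \<le> norm (C (U t) x)" by (rule inj)
        also have "C (U t) x = C (U u) x - C (U u - U t) x" by (simp add: C.diff_left)
        also have "norm \<dots> \<le> norm (C (U u) x) + norm (C (U u - U t) x)" by (rule norm_triangle_ineq4)
        also have "norm (C (U u - U t) x) \<le> s * norm (U u - U t) * norm x" by (rule C_norm)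
        also have "\<dots> \<le> \<eta> / 2 * norm x" using elim by (intro mult_right_mono) auto
        finally show ?thesis by simp
      qed
      then show ?case using B_right_inverse[of "\<eta> / 2" "U u" "r u"] eta_pos by simp
    qed
    \<comment> \<open>correction that moves \<open>Y\<close> to the slice at the parameter \<open>u\<close>\<close>
    define D where "D = (\<lambda>u. SOME D. B (U u) D = r u \<and> norm D \<le> norm (r u) / (\<eta> / 2))"
    have evD: "\<forall>\<^sub>F u in at t. B (U u) (D u) = r u \<and> norm (D u) \<le> norm (r u) / (\<eta> / 2)"
      using ev unfolding D_def by (rule eventually_mono) (rule someI_ex)
    have "((\<lambda>u. norm (r u) / (\<eta> / 2)) \<longlongrightarrow> norm (0::'b) / (\<eta> / 2)) (at t)"
      using eta_pos by (intro tendsto_intros r0) simp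
    then have D0: "(D \<longlongrightarrow> 0) (at t)"
      by (intro Lim_null_comparison[of D "\<lambda>u. norm (r u) / (\<eta> / 2)"]) (use evD in \<open>auto elim: eventually_mono\<close>)
    have Ft: "((\<lambda>u. F (U u) (Y + D u) + \<rho> / 4 * (norm (w u))\<^sup>2) \<longlongrightarrow>
        F (U t) (Y + 0) + \<rho> / 4 * (norm (w t))\<^sup>2) (at t)"
    proof (intro tendsto_intros wt)
      have "((\<lambda>u. (U u, Y + D u)) \<longlongrightarrow> (U t, Y + 0)) (at t)" by (intro tendsto_intros Ut D0)
      moreover have "isCont (\<lambda>z. F (fst z) (snd z)) (U t, Y + 0)"
        using F_cont by (simp add: continuous_on_eq_continuous_at)
      ultimately show "((\<lambda>u. F (U u) (Y + D u)) \<longlongrightarrow> F (U t) (Y + 0)) (at t)"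
        using isCont_tendsto_compose[of "(U t, Y + 0)" "\<lambda>z. F (fst z) (snd z)"] by fastforce
    qed
    have "\<forall>\<^sub>F u in at t. F (U u) (Y + D u) + \<rho> / 4 * (norm (w u))\<^sup>2 < \<beta>"
      using order_tendstoD(2)[OF Ft] strict by simp
    with evD have "\<forall>\<^sub>F u in at t. \<exists>Y. (u, Y) \<in> P"
    proof eventually_elim
      case (elim u)
      then have "(u, Y + D u) \<in> P" by (simp add: P_def B.add_right r_def)
      then show ?case ..
    qed
    then obtain N where N: "open N" "t \<in> N" "\<And>u. u \<in> N \<Longrightarrow> u \<noteq> t \<Longrightarrow> \<exists>Y. (u, Y) \<in> P"
      unfolding eventually_at_topological by auto
    then have "{0..1} \<inter> N \<subseteq> T" using \<open>t \<in> T\<close> by (metis (lifting) IntE T atLeastAtMost_iff subsetI)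
    then show "\<exists>N'. openin (top_of_set {0..1}) N' \<and> t \<in> N' \<and> N' \<subseteq> T"
      using N t by (intro exI[of _ "{0..1} \<inter> N"]) (auto simp: openin_open)
  qed
  have "0 \<in> T" using start by (auto simp: T P_def)
  moreover have "connected {0..1::real}" by simp
  ultimately have "T = {0..1}" using cT oT by (auto simp: connected_clopen)
  then have "1 \<in> T" by simp
  then obtain Y1 where "B (U 1) Y1 = b + w 1" "F (U 1) Y1 + \<rho> / 4 * (norm (w 1))\<^sup>2 \<le> \<beta>"
    by (auto simp: T P_def)
  then show ?thesis using slice_minimizer[of "U 1" Y1 "w 1"] by fastforce
qed

lemma crit_of_level:
  assumes "F U V + \<rho> / 4 * (norm (B U V - b))\<^sup>2 \<le> \<beta>" and "C U y + G U V = 0"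
  shows "crit U V y"
  using level[OF assms(1)] assms(2) by (auto simp: crit_def)

text \<open>
  In this form only the norms of the old and the new multiplier enter. The analysis of the first
  steps needs this, since there the old multiplier is arbitrary.
\<close>

lemma Lag_completed:
  assumes "y' = y + \<rho> *\<^sub>R (B U V - b)"
  shows "Lag U V y = F U V + ((norm y')\<^sup>2 - (norm y)\<^sup>2) / (2 * \<rho>)"
proof -
  define h where "h = B U V - b"
  show ?thesis
    unfolding Lag_def assms h_def[symmetric] power2_norm_eq_inner using rho_pos
    by (simp add: inner_add_left inner_add_right inner_commute[of h y] add_divide_distrib diff_divide_distrib
        distrib_left power2_eq_square)
qed

lemma Lag_dual_ascent:
  assumes "y' = y + \<rho> *\<^sub>R (B U V - b)"
  shows "Lag U V y' = Lag U V y + (norm (y' - y))\<^sup>2 / \<rho>"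
proof -
  define h where "h = B U V - b"
  show ?thesis
    unfolding Lag_def assms h_def[symmetric] power2_norm_eq_inner using rho_pos
    by (simp add: inner_add_left inner_add_right inner_commute[of h y] add_divide_distrib diff_divide_distrib
        distrib_left power2_eq_square)
qed

text \<open>
  Both \<open>(U, V, y)\<close> and \<open>(U', Y, \<nu>)\<close> are critical, so \<open>|y - \<nu>|\<^sup>2 / (2 \<rho>)\<close> is at most half of
  \<open>\<gamma>/2 (|U' - U|\<^sup>2 + |V - Y|\<^sup>2)\<close>. One half pays for the change of multiplier in \<open>feasible_value_le_Lag\<close>, the
  other half remains as room below \<open>l\<close>.
\<close>

lemma feasible_value_bound:
  assumes c: "crit U V y" and Y: "B U' Y = b" "C U' \<nu> + G U' Y = 0" "F U' Y \<le> \<beta>"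
    and l: "Lag U' V y + \<gamma> / 2 * (norm (U' - U))\<^sup>2 \<le> l"
  shows "F U' Y + (norm (y - \<nu>))\<^sup>2 / (2 * \<rho>) \<le> l"
proof -
  have c': "crit U' Y \<nu>" by (rule crit_of_level) (use Y in simp_all)
  have "(norm (y - \<nu>))\<^sup>2 \<le> \<gamma> * \<rho> / 2 * ((norm (U' - U))\<^sup>2 + (norm (Y - V))\<^sup>2)"
    using crit_multiplier_change[OF c c'] by (simp add: norm_minus_commute)
  then have "(norm (y - \<nu>))\<^sup>2 / \<rho> \<le> (\<gamma> * \<rho> / 2 * ((norm (U' - U))\<^sup>2 + (norm (Y - V))\<^sup>2)) / \<rho>"
    using rho_pos by (intro divide_right_mono) auto
  also have "\<dots> = \<gamma> / 2 * (norm (U' - U))\<^sup>2 + \<gamma> / 2 * (norm (Y - V))\<^sup>2"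
    using rho_pos by (simp add: field_simps)
  finally show ?thesis
    using feasible_value_le_Lag[OF Y(2,1), of V y] l by (simp add: norm_minus_commute field_simps)
qed

text \<open>
  The room found in \<open>feasible_value_bound\<close> exceeds \<open>\<gamma>/2 |V' - Y|\<^sup>2\<close> by \<open>prox_displacement\<close>, so \<open>norm_sum_room\<close> bounds
  \<open>|U'| + |Y| + |V' - Y|\<close> and hence \<open>|U'| + |V'|\<close>.
\<close>

lemma crit_step:
  assumes c: "crit U V y" and Y: "B U' Y = b" "C U' \<nu> + G U' Y = 0" "F U' Y \<le> \<beta>"
    and l: "Lag U' V y + \<gamma> / 2 * (norm (U' - U))\<^sup>2 \<le> l" "l \<le> \<beta>"
    and V': "C U' y' + G U' V' = 0" "y' = y + \<rho> *\<^sub>R (B U' V' - b)"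
  shows "crit U' V' y'"
proof -
  have c': "crit U' Y \<nu>" by (rule crit_of_level) (use Y in simp_all)
  have "\<gamma> * (norm (V' - Y))\<^sup>2 \<le> (norm (y - \<nu>))\<^sup>2 / (4 * \<rho>)"
    by (rule prox_displacement[OF V' Y(2,1)])
  also have "\<dots> \<le> (norm (y - \<nu>))\<^sup>2 / \<rho>"
    using rho_pos by (intro divide_left_mono) auto
  finally have "F U' Y + \<gamma> / 2 * (norm (V' - Y))\<^sup>2 \<le> \<beta>"
    using feasible_value_bound[OF c Y l(1)] l(2) by (simp add: field_simps)
  then have "norm U' + norm Y + norm (V' - Y) \<le> 2 * \<delta>"
    by (intro norm_sum_room[OF Y(1)]) auto
  moreover have "norm V' \<le> norm Y + norm (V' - Y)" by (metis add.commute diff_add_cancel norm_triangle_ineq)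
  ultimately show ?thesis using c' V' by (simp add: crit_def)
qed

text \<open>
  The part of the descent constant \<open>\<gamma> / 2\<close> that is left after paying for the multiplier update.
\<close>

definition decay :: real where
  "decay = \<gamma> / 2 - 2 * (max (p + s * M) q)\<^sup>2 / (\<rho> * \<eta>\<^sup>2)"

lemma decay_pos: "decay > 0"
proof -
  have "4 * (max (p + s * M) q)\<^sup>2 < \<gamma> * \<rho> * \<eta>\<^sup>2"
    using rho_U rho_V by (simp add: max_def)
  then show ?thesis using rho_pos eta_pos by (simp add: decay_def field_simps)
qed

lemma Lag_step_descent:
  assumes c: "crit U V y" and c': "crit U' V' y'" and y': "y' = y + \<rho> *\<^sub>R (B U' V' - b)"
    and U': "Lag U' V y + \<gamma> / 2 * (norm (U' - U))\<^sup>2 \<le> l"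
    and V': "Lag U' V' y + \<gamma> / 2 * (norm (V' - V))\<^sup>2 \<le> Lag U' V y"
  shows "Lag U' V' y' + decay * ((norm (U' - U))\<^sup>2 + (norm (V' - V))\<^sup>2) \<le> l"
proof -
  define m where "m = max (p + s * M) q"
  have "\<eta>\<^sup>2 * (norm (y' - y))\<^sup>2 \<le> 2 * (p + s * M)\<^sup>2 * (norm (U' - U))\<^sup>2 + 2 * q\<^sup>2 * (norm (V' - V))\<^sup>2"
    by (rule crit_multiplier_lipschitz[OF c c'])
  also have "\<dots> \<le> 2 * m\<^sup>2 * (norm (U' - U))\<^sup>2 + 2 * m\<^sup>2 * (norm (V' - V))\<^sup>2"
    using p_nonneg s_nonneg M_nonneg q_nonneg
    by (intro add_mono mult_right_mono mult_left_mono power_mono) (auto simp: m_def)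
  finally have "(norm (y' - y))\<^sup>2 / \<rho> \<le> 2 * m\<^sup>2 / (\<rho> * \<eta>\<^sup>2) * ((norm (U' - U))\<^sup>2 + (norm (V' - V))\<^sup>2)"
    using rho_pos eta_pos by (simp add: field_simps)
  then show ?thesis
    using Lag_dual_ascent[OF y'] U' V' unfolding decay_def m_def[symmetric] by (simp add: algebra_simps)
qed

end

section \<open>Confinement of the alternating iterates\<close>

text \<open>
  The inequality behind the second half step, with \<open>a = |\<mu>|\<^sup>2\<close>, \<open>l = |\<Lambda> 1|\<^sup>2\<close>, \<open>e = |\<mu> - \<Lambda> 1|\<^sup>2\<close>, \<open>z = |\<nu> - \<Lambda> 1|\<^sup>2\<close>,
  \<open>x = \<langle>\<nu> - \<Lambda> 1, \<mu> - \<Lambda> 1\<rangle>\<close> and \<open>m = M\<^sup>2\<close>: after the terms in \<open>e\<close> and \<open>z\<close> have absorbed \<open>x\<close>, a convex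
  combination of \<open>a\<close> and \<open>l\<close> is left.
\<close>

lemma interpolated_level_bound:
  fixes a l e z x t m :: real
  assumes t: "0 \<le> t" "t \<le> 1" and al: "a \<le> m" "l \<le> m" and ez: "0 \<le> e" "0 \<le> z" and x: "2 * x \<le> z + e"
  shows "(a + l - e) / 2 - e / 2 + t * ((a - l - e) / 2 + x) + (1 - t)\<^sup>2 * e / 4 - z \<le> m"
proof -
  have "t * a \<le> t * m" "(1 - t) * l \<le> (1 - t) * m" "t * (2 * x) \<le> t * (z + e)"
    using t al ez x by (auto intro!: mult_left_mono)
  moreover have "t * z \<le> z" "0 \<le> t * e" using t ez by (simp_all add: mult_left_le_one_le)
  moreover have "(1 - t)\<^sup>2 * e \<le> (1 - t) * e"
    using t ez by (intro mult_right_mono) (auto simp: power2_eq_square mult_left_le)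
  moreover have "t * ((a - l - e) / 2 + x) = (t * a - t * l - t * e) / 2 + t * x" by (simp add: field_simps)
  ultimately show ?thesis using al ez 
    by (simp only: distrib_left left_diff_distrib mult_1 add_divide_distrib diff_divide_distrib)
qed

text \<open>
  The alternating iteration started at an arbitrary multiplier. The step in \<open>U\<close> is stated with the roles of \<open>U\<close> and
  \<open>V\<close> exchanged, which is the same by \<open>Lag_sym\<close>. The assumption \<open>margin\<close> is the lower bound
  \<open>\<rho> > M\<^sup>2 / (\<beta> - \<beta>\<^sub>0)\<close> for the penalty parameter.
\<close>

locale bilinear_admm = bilinear_lagrangian +
  fixes U V :: "nat \<Rightarrow> 'a" and \<Lambda> :: "nat \<Rightarrow> 'b" and \<beta>\<^sub>0 :: real
  assumes U_min: "Lag (V k) (U (Suc k)) (\<Lambda> k) \<le> Lag (V k) X (\<Lambda> k)"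
    and V_min: "Lag (U (Suc k)) (V (Suc k)) (\<Lambda> k) \<le> Lag (U (Suc k)) X (\<Lambda> k)"
    and dual: "\<Lambda> (Suc k) = \<Lambda> k + \<rho> *\<^sub>R (B (U (Suc k)) (V (Suc k)) - b)"
    and init: "Lag (U 0) (V 0) (\<Lambda> 0) + (norm (\<Lambda> 0))\<^sup>2 / \<rho> \<le> \<beta>\<^sub>0"
    and margin: "\<beta>\<^sub>0 + M\<^sup>2 / \<rho> < \<beta>"
    and G_cont: "continuous_on UNIV (\<lambda>z. G (fst z) (snd z))"
    and G_local_lip: "\<exists>K\<ge>0. \<forall>U V U' V'. norm U \<le> r \<longrightarrow> norm V \<le> r \<longrightarrow> norm U' \<le> r \<longrightarrow> norm V' \<le> r \<longrightarrow>
         norm (G U' V' - G U V) \<le> K * (norm (U' - U) + norm (V' - V))"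
begin

lemma V_stationary: "C (U (Suc k)) (\<Lambda> (Suc k)) + G (U (Suc k)) (V (Suc k)) = 0"
  using Lag_minimizer[OF V_min[of k]] by (simp add: dual add.commute)

lemma U_descent: "Lag (U (Suc k)) (V k) (\<Lambda> k) + \<gamma> / 2 * (norm (U (Suc k) - U k))\<^sup>2 \<le> Lag (U k) (V k) (\<Lambda> k)"
  using Lag_descent[OF U_min, of k "U k"] by (simp add: Lag_sym norm_minus_commute)

lemma V_descent: "Lag (U (Suc k)) (V (Suc k)) (\<Lambda> k) + \<gamma> / 2 * (norm (V (Suc k) - V k))\<^sup>2
    \<le> Lag (U (Suc k)) (V k) (\<Lambda> k)"
  using Lag_descent[OF V_min, of k "V k"] by (simp add: norm_minus_commute)

text \<open>
  The initial bound is \<open>Lag + |y|\<^sup>2 / \<rho> \<le> \<beta>\<^sub>0\<close>; half of the second term survives when the square is completed.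
\<close>

lemma first_value: "F (U 1) (V 1) + ((norm (\<Lambda> 1))\<^sup>2 + (norm (\<Lambda> 0))\<^sup>2) / (2 * \<rho>) \<le> \<beta>\<^sub>0"
proof -
  have "Lag (U 1) (V 1) (\<Lambda> 0) \<le> Lag (U 0) (V 0) (\<Lambda> 0)"
    using U_min[of 0 "U 0"] V_min[of 0 "V 0"] by (simp add: Lag_sym)
  then have "F (U 1) (V 1) + ((norm (\<Lambda> 1))\<^sup>2 - (norm (\<Lambda> 0))\<^sup>2) / (2 * \<rho>) + (norm (\<Lambda> 0))\<^sup>2 / \<rho> \<le> \<beta>\<^sub>0"
    using Lag_completed[of "\<Lambda> 1" "\<Lambda> 0" "U 1" "V 1"] dual[of 0] init by simp
  then show ?thesis using rho_pos by (simp add: field_simps)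
qed

lemma residual: "B (U (Suc k)) (V (Suc k)) - b = (1 / \<rho>) *\<^sub>R (\<Lambda> (Suc k) - \<Lambda> k)"
  using rho_pos by (simp add: dual)

lemma first_iterate_level: "F (U 1) (V 1) + \<rho> / 4 * (norm (B (U 1) (V 1) - b))\<^sup>2 \<le> \<beta>\<^sub>0"
proof -
  have "\<rho> / 4 * (norm (B (U 1) (V 1) - b))\<^sup>2 = (norm (\<Lambda> 1 - \<Lambda> 0))\<^sup>2 / (4 * \<rho>)"
  proof -
    have "norm (B (U 1) (V 1) - b) = norm (\<Lambda> 1 - \<Lambda> 0) / \<rho>"
      using arg_cong[OF residual[of 0], of norm] rho_pos by simp
    then show ?thesis using rho_pos by (simp add: power_divide power2_eq_square)
  qed
  also have "\<dots> \<le> (2 * (norm (\<Lambda> 1))\<^sup>2 + 2 * (norm (\<Lambda> 0))\<^sup>2) / (4 * \<rho>)"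
    using zero_le_power2[of "norm (\<Lambda> 1 + \<Lambda> 0)"] rho_pos
    by (intro divide_right_mono)
      (auto simp: power2_norm_eq_inner inner_add_left inner_add_right inner_diff_left inner_diff_right inner_commute)
  also have "\<dots> = ((norm (\<Lambda> 1))\<^sup>2 + (norm (\<Lambda> 0))\<^sup>2) / (2 * \<rho>)"
    using rho_pos by (simp add: divide_simps algebra_simps)
  finally show ?thesis using first_value by linarith
qed

lemma beta0_le: "\<beta>\<^sub>0 < \<beta>"
proof -
  have "M\<^sup>2 / \<rho> \<ge> 0" using rho_pos by simp
  then show ?thesis using margin by linarith
qed

lemma crit_first: "crit (U 1) (V 1) (\<Lambda> 1)"
  by (rule crit_of_level) (use first_iterate_level beta0_le V_stationary[of 0] in simp_all)

text \<open>
  The pair \<open>(V 1, U 1)\<close> lies in the level set. Moving the constraint value from that of \<open>(V 1, U 1)\<close> to zero,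
  the minimal value of \<open>F (V 1)\<close> on the slice stays below \<open>\<beta>\<^sub>0 + M\<^sup>2 / \<rho>\<close>, because
  \<open>\<langle>\<nu>, \<Lambda> 1 - \<Lambda> 0\<rangle> - |\<Lambda> 1|\<^sup>2 / 2 - |\<Lambda> 0|\<^sup>2 / 2 = |\<nu>|\<^sup>2 - |\<nu> - \<Lambda> 1|\<^sup>2 / 2 - |\<nu> + \<Lambda> 0|\<^sup>2 / 2\<close>. The term
  \<open>|\<nu> - \<Lambda> 1|\<^sup>2\<close> is the room that puts the next iterate \<open>U 2\<close> within the bounds.
\<close>

lemma second_multiplier_bound:
  defines "\<mu> \<equiv> \<Lambda> 1 + \<rho> *\<^sub>R (B (U 2) (V 1) - b)"
  shows "norm \<mu> \<le> M" and "C (V 1) \<mu> + G (V 1) (U 2) = 0"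
proof -
  let ?d = "\<Lambda> 1 - \<Lambda> 0"
  define w where "w = (\<lambda>t::real. ((1 - t) / \<rho>) *\<^sub>R ?d)"
  have h1: "B (V 1) (U 1) - b = (1 / \<rho>) *\<^sub>R ?d" using residual[of 0] B_sym[of "U 1" "V 1"] by simp
  \<comment> \<open>The residual runs from its value at \<open>(V 1, U 1)\<close>, for \<open>t = 0\<close>, to zero, for \<open>t = 1\<close>.\<close>
  have key: "F (V 1) Y + \<rho> / 4 * (norm (w t))\<^sup>2 + t * (norm (\<nu> - \<Lambda> 1))\<^sup>2 / (2 * \<rho>) \<le> \<beta>\<^sub>0 + M\<^sup>2 / \<rho>"
    if t: "0 \<le> t" "t \<le> 1" and Y: "B (V 1) Y = b + w t" "C (V 1) \<nu> + G (V 1) Y = 0"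
      "F (V 1) Y + \<rho> / 4 * (norm (w t))\<^sup>2 \<le> \<beta>" for t Y \<nu>
  proof -
    have nu: "norm \<nu> \<le> M" by (rule crit_multiplier_bound, rule crit_of_level) (use Y in simp_all)
    have "F (V 1) Y \<le> F (V 1) (U 1) + \<nu> \<bullet> (B (V 1) (U 1) - B (V 1) Y)"
      using multiplier_lower_bound[OF Y(2), of "U 1"] gamma_pos by (smt (verit) mult_nonneg_nonneg zero_le_power2 divide_nonneg_nonneg)
    also have "B (V 1) (U 1) - B (V 1) Y = (B (V 1) (U 1) - b) - w t" using Y(1) by simp
    also have "\<dots> = (1 / \<rho>) *\<^sub>R ?d - ((1 - t) / \<rho>) *\<^sub>R ?d" by (simp only: h1 w_def)
    also have "\<dots> = (t / \<rho>) *\<^sub>R ?d" by (simp add: scaleR_left_diff_distrib[symmetric] diff_divide_distrib)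
    finally have 1: "F (V 1) Y \<le> F (U 1) (V 1) + t / \<rho> * (\<nu> \<bullet> \<Lambda> 1 - \<nu> \<bullet> \<Lambda> 0)"
      using F_sym[of "U 1" "V 1"] by (simp add: inner_diff_right)
    have "\<rho> / 4 * (norm (w t))\<^sup>2 = (1 - t)\<^sup>2 * (norm ?d)\<^sup>2 / (4 * \<rho>)"
    proof -
      have "norm (w t) = (1 - t) * norm ?d / \<rho>" using rho_pos t by (simp add: w_def)
      then show ?thesis using rho_pos by (simp add: power_mult_distrib power_divide power2_eq_square)
    qed
    also have "\<dots> \<le> (1 - t) * (2 * (norm (\<Lambda> 1))\<^sup>2 + 2 * (norm (\<Lambda> 0))\<^sup>2) / (4 * \<rho>)"
    proof (intro divide_right_mono mult_mono)
      show "(1 - t)\<^sup>2 \<le> 1 - t" using t by (simp add: power2_eq_square mult_left_le)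
      show "(norm ?d)\<^sup>2 \<le> 2 * (norm (\<Lambda> 1))\<^sup>2 + 2 * (norm (\<Lambda> 0))\<^sup>2"
        using zero_le_power2[of "norm (\<Lambda> 1 + \<Lambda> 0)"] unfolding power2_norm_eq_inner
        by (simp add: inner_add_left inner_add_right inner_diff_left inner_diff_right inner_commute)
    qed (use t rho_pos in auto)
    finally have 2: "\<rho> / 4 * (norm (w t))\<^sup>2 \<le> (1 - t) * (2 * (norm (\<Lambda> 1))\<^sup>2 + 2 * (norm (\<Lambda> 0))\<^sup>2) / (4 * \<rho>)" .
    have 3: "\<nu> \<bullet> \<Lambda> 1 - \<nu> \<bullet> \<Lambda> 0 - (norm (\<Lambda> 1))\<^sup>2 / 2 - (norm (\<Lambda> 0))\<^sup>2 / 2 + (norm (\<nu> - \<Lambda> 1))\<^sup>2 / 2 \<le> (norm \<nu>)\<^sup>2"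
    proof -
      have "0 \<le> (norm (\<nu> + \<Lambda> 0))\<^sup>2" by simp
      also have "\<dots> = (norm \<nu>)\<^sup>2 + (norm (\<Lambda> 0))\<^sup>2 + 2 * (\<nu> \<bullet> \<Lambda> 0)"
        unfolding power2_norm_eq_inner by (simp add: inner_add_left inner_add_right inner_commute)
      finally have "0 \<le> (norm \<nu>)\<^sup>2 + (norm (\<Lambda> 0))\<^sup>2 + 2 * (\<nu> \<bullet> \<Lambda> 0)" .
      moreover have "(norm (\<nu> - \<Lambda> 1))\<^sup>2 = (norm \<nu>)\<^sup>2 + (norm (\<Lambda> 1))\<^sup>2 - 2 * (\<nu> \<bullet> \<Lambda> 1)"
        unfolding power2_norm_eq_inner by (simp add: inner_diff_left inner_diff_right inner_commute)
      ultimately show ?thesis by linarith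
    qed
    have "(norm \<nu>)\<^sup>2 \<le> M\<^sup>2" using nu by (simp add: power_mono)
    with 3 have "t * (\<nu> \<bullet> \<Lambda> 1 - \<nu> \<bullet> \<Lambda> 0 - (norm (\<Lambda> 1))\<^sup>2 / 2 - (norm (\<Lambda> 0))\<^sup>2 / 2 + (norm (\<nu> - \<Lambda> 1))\<^sup>2 / 2) \<le> t * M\<^sup>2"
      using t by (intro mult_left_mono) auto
    also have "\<dots> \<le> M\<^sup>2" using t by (simp add: mult_left_le_one_le)
    finally have "t * (\<nu> \<bullet> \<Lambda> 1 - \<nu> \<bullet> \<Lambda> 0 - (norm (\<Lambda> 1))\<^sup>2 / 2 - (norm (\<Lambda> 0))\<^sup>2 / 2 + (norm (\<nu> - \<Lambda> 1))\<^sup>2 / 2) / \<rho> \<le> M\<^sup>2 / \<rho>"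
      using rho_pos by (intro divide_right_mono) auto
    moreover have 4: "t * (\<nu> \<bullet> \<Lambda> 1 - \<nu> \<bullet> \<Lambda> 0 - (norm (\<Lambda> 1))\<^sup>2 / 2 - (norm (\<Lambda> 0))\<^sup>2 / 2 + (norm (\<nu> - \<Lambda> 1))\<^sup>2 / 2) / \<rho>
        = t / \<rho> * (\<nu> \<bullet> \<Lambda> 1 - \<nu> \<bullet> \<Lambda> 0) - t * ((norm (\<Lambda> 1))\<^sup>2 + (norm (\<Lambda> 0))\<^sup>2) / (2 * \<rho>)
          + t * (norm (\<nu> - \<Lambda> 1))\<^sup>2 / (2 * \<rho>)"
      using rho_pos by (simp add: field_simps)
    ultimately have 6: "t / \<rho> * (\<nu> \<bullet> \<Lambda> 1 - \<nu> \<bullet> \<Lambda> 0) - t * ((norm (\<Lambda> 1))\<^sup>2 + (norm (\<Lambda> 0))\<^sup>2) / (2 * \<rho>)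
          + t * (norm (\<nu> - \<Lambda> 1))\<^sup>2 / (2 * \<rho>) \<le> M\<^sup>2 / \<rho>" by (simp only:)
    have 5: "(1 - t) * (2 * (norm (\<Lambda> 1))\<^sup>2 + 2 * (norm (\<Lambda> 0))\<^sup>2) / (4 * \<rho>)
        = ((norm (\<Lambda> 1))\<^sup>2 + (norm (\<Lambda> 0))\<^sup>2) / (2 * \<rho>) - t * ((norm (\<Lambda> 1))\<^sup>2 + (norm (\<Lambda> 0))\<^sup>2) / (2 * \<rho>)"
      using rho_pos by (simp add: field_simps)
    have aux: "x + w + z \<le> c + m" if "x \<le> f + k" "w \<le> u" "u = n - tn" "k - tn + z \<le> m" "f + n \<le> c"
      for x f k w u n tn z m c :: real using that by linarith
    show ?thesis by (rule aux[OF 1 2 5 6 first_value])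
  qed
  have "\<exists>Y \<nu>. B (V 1) Y = b + w 1 \<and> C (V 1) \<nu> + G (V 1) Y = 0 \<and> F (V 1) Y + \<rho> / 4 * (norm (w 1))\<^sup>2 \<le> \<beta>"
  proof (rule level_continuation[where U = "\<lambda>t. V 1" and w = w and Z = "U 1"])
    show "continuous_on UNIV w" unfolding w_def using rho_pos by (intro continuous_intros) auto
    have w0: "B (V 1) (U 1) = b + w 0" using h1 by (simp add: w_def algebra_simps)
    show "B (V 1) (U 1) = b + w 0" by (fact w0)
    from w0 have "w 0 = B (V 1) (U 1) - b" by simp
    then show "F (V 1) (U 1) + \<rho> / 4 * (norm (w 0))\<^sup>2 \<le> \<beta>"
      using first_iterate_level beta0_le F_sym[of "U 1" "V 1"] B_sym[of "U 1" "V 1"] by simp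
    fix t Y \<nu>
    assume *: "0 \<le> t" "t \<le> 1" "B (V 1) Y = b + w t" "C (V 1) \<nu> + G (V 1) Y = 0"
      "F (V 1) Y + \<rho> / 4 * (norm (w t))\<^sup>2 \<le> \<beta>"
    have "t * (norm (\<nu> - \<Lambda> 1))\<^sup>2 / (2 * \<rho>) \<ge> 0" using * rho_pos by simp
    then show "F (V 1) Y + \<rho> / 4 * (norm (w t))\<^sup>2 < \<beta>" using key[OF *] margin by linarith
  qed auto
  then obtain Y \<nu> where Y: "B (V 1) Y = b" "C (V 1) \<nu> + G (V 1) Y = 0" "F (V 1) Y \<le> \<beta>"
    by (auto simp: w_def)
  show stat: "C (V 1) \<mu> + G (V 1) (U 2) = 0"
    using Lag_minimizer[OF U_min[of 1]] B_sym[of "U 2" "V 1"]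
    by (simp add: \<mu>_def add.commute numeral_2_eq_2)
  have "\<gamma> * (norm (U 2 - Y))\<^sup>2 \<le> (norm (\<Lambda> 1 - \<nu>))\<^sup>2 / (4 * \<rho>)"
    using prox_displacement[OF stat _ Y(2,1), of "\<Lambda> 1"] B_sym[of "U 2" "V 1"] by (simp add: \<mu>_def)
  also have "\<dots> \<le> (norm (\<Lambda> 1 - \<nu>))\<^sup>2 / \<rho>" using rho_pos by (intro divide_left_mono) auto
  finally have "\<gamma> / 2 * (norm (U 2 - Y))\<^sup>2 \<le> (norm (\<nu> - \<Lambda> 1))\<^sup>2 / (2 * \<rho>)"
    by (simp add: norm_minus_commute)
  moreover have "F (V 1) Y + (norm (\<nu> - \<Lambda> 1))\<^sup>2 / (2 * \<rho>) \<le> \<beta>\<^sub>0 + M\<^sup>2 / \<rho>"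
    using key[of 1 Y \<nu>] Y by (simp add: w_def)
  ultimately have "F (V 1) Y + \<gamma> / 2 * (norm (U 2 - Y))\<^sup>2 \<le> \<beta>" using margin by linarith
  then have "norm (V 1) + norm Y + norm (U 2 - Y) \<le> 2 * \<delta>"
    by (intro norm_sum_room[OF Y(1)]) auto
  moreover have "norm (U 2) \<le> norm Y + norm (U 2 - Y)" by (metis add.commute diff_add_cancel norm_triangle_ineq)
  moreover have "norm (V 1) \<le> \<delta> \<and> (\<forall>x. \<eta> * norm x \<le> norm (C (V 1) x))"
    using level[of "V 1" Y] Y by simp
  ultimately have "crit (V 1) (U 2) \<mu>" using stat by (simp add: crit_def)
  then show "norm \<mu> \<le> M" by (rule crit_multiplier_bound)
qed

text \<open>
  The first claim replaces the bound on the Lagrangian that later steps inherit from their predecessor. For the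
  second, \<open>(U 2, V 1)\<close> is in the level set, and again the constraint value is moved to zero.
\<close>

lemma second_half_step:
  shows "Lag (U 2) (V 1) (\<Lambda> 1) + \<gamma> / 2 * (norm (U 2 - U 1))\<^sup>2 \<le> \<beta>\<^sub>0 + M\<^sup>2 / \<rho>" (is ?Lag)
    and "\<exists>Y \<nu>. B (U 2) Y = b \<and> C (U 2) \<nu> + G (U 2) Y = 0 \<and> F (U 2) Y \<le> \<beta>" (is ?feas)
proof -
  define \<mu> where "\<mu> = \<Lambda> 1 + \<rho> *\<^sub>R (B (U 2) (V 1) - b)"
  have mu: "norm \<mu> \<le> M" and stat: "C (V 1) \<mu> + G (V 1) (U 2) = 0"
    using second_multiplier_bound by (simp_all add: \<mu>_def)
  have lam: "norm (\<Lambda> 1) \<le> M" by (rule crit_multiplier_bound[OF crit_first])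
  define e where "e = \<mu> - \<Lambda> 1"
  have h1: "B (U 1) (V 1) - b = (1 / \<rho>) *\<^sub>R (\<Lambda> 1 - \<Lambda> 0)" using residual[of 0] by simp
  have h2: "B (U 2) (V 1) - b = (1 / \<rho>) *\<^sub>R e" using rho_pos by (simp add: \<mu>_def e_def)
  have F2: "F (U 2) (V 1) + \<gamma> / 2 * (norm (U 2 - U 1))\<^sup>2
      \<le> \<beta>\<^sub>0 + (\<mu> \<bullet> \<Lambda> 1 - (norm e)\<^sup>2 / 2) / \<rho>"
  proof -
    have "B (V 1) (U 1) - B (V 1) (U 2) = (1 / \<rho>) *\<^sub>R (\<Lambda> 1 - \<Lambda> 0 - e)"
      using h1 h2 B_sym[of "V 1"] by (simp add: scaleR_diff_right algebra_simps)
    then have "F (U 2) (V 1) + \<gamma> / 2 * (norm (U 2 - U 1))\<^sup>2 \<le> F (U 1) (V 1) + \<mu> \<bullet> (\<Lambda> 1 - \<Lambda> 0 - e) / \<rho>"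
      using multiplier_lower_bound[OF stat, of "U 1"] F_sym[of "V 1"] by (simp add: norm_minus_commute)
    moreover have "\<mu> \<bullet> (\<Lambda> 1 - \<Lambda> 0 - e) - ((norm (\<Lambda> 1))\<^sup>2 + (norm (\<Lambda> 0))\<^sup>2) / 2 \<le> \<mu> \<bullet> \<Lambda> 1 - (norm e)\<^sup>2 / 2"
      using zero_le_power2[of "norm (\<mu> + \<Lambda> 0)"] unfolding power2_norm_eq_inner e_def
      by (simp add: inner_add_left inner_add_right inner_diff_left inner_diff_right inner_commute field_simps)
    then have "(\<mu> \<bullet> (\<Lambda> 1 - \<Lambda> 0 - e) - ((norm (\<Lambda> 1))\<^sup>2 + (norm (\<Lambda> 0))\<^sup>2) / 2) / \<rho> \<le> (\<mu> \<bullet> \<Lambda> 1 - (norm e)\<^sup>2 / 2) / \<rho>"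
      using rho_pos by (intro divide_right_mono) auto
    ultimately show ?thesis using first_value by (simp add: diff_divide_distrib)
  qed
  have sq: "(norm \<mu>)\<^sup>2 \<le> M\<^sup>2" "(norm (\<Lambda> 1))\<^sup>2 \<le> M\<^sup>2" using mu lam by (simp_all add: power_mono)
  have ip: "\<mu> \<bullet> \<Lambda> 1 = ((norm \<mu>)\<^sup>2 + (norm (\<Lambda> 1))\<^sup>2 - (norm e)\<^sup>2) / 2"
    unfolding power2_norm_eq_inner e_def by (simp add: inner_diff_left inner_diff_right inner_commute)
  show ?Lag
  proof -
    have "Lag (U 2) (V 1) (\<Lambda> 1) = F (U 2) (V 1) + ((norm \<mu>)\<^sup>2 - (norm (\<Lambda> 1))\<^sup>2) / (2 * \<rho>)"
      by (rule Lag_completed) (simp add: \<mu>_def)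
    with F2 have "Lag (U 2) (V 1) (\<Lambda> 1) + \<gamma> / 2 * (norm (U 2 - U 1))\<^sup>2 \<le> \<beta>\<^sub>0 + ((norm \<mu>)\<^sup>2 - (norm e)\<^sup>2) / \<rho>"
      using rho_pos unfolding ip by (simp add: field_simps)
    also have "((norm \<mu>)\<^sup>2 - (norm e)\<^sup>2) / \<rho> \<le> M\<^sup>2 / \<rho>"
      using sq rho_pos zero_le_power2[of "norm e"] by (intro divide_right_mono) linarith+
    finally show ?thesis by simp
  qed
  have lev2: "F (U 2) (V 1) + \<rho> / 4 * (norm (B (U 2) (V 1) - b))\<^sup>2 \<le> \<beta>"
  proof -
    have "\<rho> / 4 * (norm (B (U 2) (V 1) - b))\<^sup>2 = (norm e)\<^sup>2 / 4 / \<rho>"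
    proof -
      have "norm (B (U 2) (V 1) - b) = norm e / \<rho>" using arg_cong[OF h2, of norm] rho_pos by simp
      then show ?thesis using rho_pos by (simp add: power_divide power2_eq_square)
    qed
    moreover have "\<mu> \<bullet> \<Lambda> 1 - (norm e)\<^sup>2 / 2 + (norm e)\<^sup>2 / 4 \<le> M\<^sup>2"
      unfolding ip using sq zero_le_power2[of "norm e"] by argo
    then have "(\<mu> \<bullet> \<Lambda> 1 - (norm e)\<^sup>2 / 2 + (norm e)\<^sup>2 / 4) / \<rho> \<le> M\<^sup>2 / \<rho>"
      using rho_pos by (intro divide_right_mono) auto
    moreover have "\<gamma> / 2 * (norm (U 2 - U 1))\<^sup>2 \<ge> 0" using gamma_pos by simp
    ultimately show ?thesis using F2 margin by (simp add: add_divide_distrib diff_divide_distrib)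
  qed
  define w where "w = (\<lambda>t::real. ((1 - t) / \<rho>) *\<^sub>R e)"
  have key: "F (U 2) Y + \<rho> / 4 * (norm (w t))\<^sup>2 \<le> \<beta>\<^sub>0 + M\<^sup>2 / \<rho>"
    if t: "0 \<le> t" "t \<le> 1" and Y: "B (U 2) Y = b + w t" "C (U 2) \<nu> + G (U 2) Y = 0"
      "F (U 2) Y + \<rho> / 4 * (norm (w t))\<^sup>2 \<le> \<beta>" for t Y \<nu>
  proof -
    define z where "z = \<nu> - \<Lambda> 1"
    have c: "crit (U 2) Y \<nu>" by (rule crit_of_level) (use Y in simp_all)
    have "(norm z)\<^sup>2 / \<rho> \<le> (\<gamma> * \<rho> / 2 * ((norm (U 2 - U 1))\<^sup>2 + (norm (Y - V 1))\<^sup>2)) / \<rho>"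
      using crit_multiplier_change[OF crit_first c] rho_pos unfolding z_def by (intro divide_right_mono) auto
    then have zc: "(norm z)\<^sup>2 / \<rho> \<le> \<gamma> / 2 * (norm (U 2 - U 1))\<^sup>2 + \<gamma> / 2 * (norm (V 1 - Y))\<^sup>2"
      using rho_pos by (simp add: field_simps norm_minus_commute)
    have "B (U 2) (V 1) - B (U 2) Y = (1 / \<rho>) *\<^sub>R e - ((1 - t) / \<rho>) *\<^sub>R e"
      using h2 Y(1) by (simp add: w_def algebra_simps)
    also have "\<dots> = (t / \<rho>) *\<^sub>R e" by (simp add: scaleR_left_diff_distrib[symmetric] diff_divide_distrib)
    finally have "F (U 2) Y + \<gamma> / 2 * (norm (V 1 - Y))\<^sup>2 \<le> F (U 2) (V 1) + t / \<rho> * (\<nu> \<bullet> e)"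
      using multiplier_lower_bound[OF Y(2), of "V 1"] by simp
    moreover have "\<rho> / 4 * (norm (w t))\<^sup>2 = (1 - t)\<^sup>2 * (norm e)\<^sup>2 / 4 / \<rho>"
    proof -
      have "norm (w t) = (1 - t) * norm e / \<rho>" using rho_pos t by (simp add: w_def)
      then show ?thesis using rho_pos by (simp add: power_mult_distrib power_divide power2_eq_square)
    qed
    ultimately have 1: "F (U 2) Y + \<rho> / 4 * (norm (w t))\<^sup>2 \<le> \<beta>\<^sub>0 +
        (\<mu> \<bullet> \<Lambda> 1 - (norm e)\<^sup>2 / 2 + t * (\<nu> \<bullet> e) + (1 - t)\<^sup>2 * (norm e)\<^sup>2 / 4 - (norm z)\<^sup>2) / \<rho>"
      using F2 zc by (simp add: add_divide_distrib diff_divide_distrib)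
    have le: "\<Lambda> 1 \<bullet> e = ((norm \<mu>)\<^sup>2 - (norm (\<Lambda> 1))\<^sup>2 - (norm e)\<^sup>2) / 2"
      unfolding power2_norm_eq_inner e_def by (simp add: inner_diff_left inner_diff_right inner_commute)
    have ne: "\<nu> \<bullet> e = \<Lambda> 1 \<bullet> e + z \<bullet> e" by (simp add: z_def inner_diff_left)
    have ze: "2 * (z \<bullet> e) \<le> (norm z)\<^sup>2 + (norm e)\<^sup>2"
      using zero_le_power2[of "norm (z - e)"] unfolding power2_norm_eq_inner
      by (simp add: inner_diff_left inner_diff_right inner_commute)
    have "\<mu> \<bullet> \<Lambda> 1 - (norm e)\<^sup>2 / 2 + t * (\<nu> \<bullet> e) + (1 - t)\<^sup>2 * (norm e)\<^sup>2 / 4 - (norm z)\<^sup>2 \<le> M\<^sup>2"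
      unfolding ne ip le by (rule interpolated_level_bound[OF t sq _ _ ze]) auto
    then have "(\<mu> \<bullet> \<Lambda> 1 - (norm e)\<^sup>2 / 2 + t * (\<nu> \<bullet> e) + (1 - t)\<^sup>2 * (norm e)\<^sup>2 / 4 - (norm z)\<^sup>2) / \<rho> \<le> M\<^sup>2 / \<rho>"
      using rho_pos by (intro divide_right_mono) auto
    with 1 show ?thesis by linarith
  qed
  have "\<exists>Y \<nu>. B (U 2) Y = b + w 1 \<and> C (U 2) \<nu> + G (U 2) Y = 0 \<and> F (U 2) Y + \<rho> / 4 * (norm (w 1))\<^sup>2 \<le> \<beta>"
  proof (rule level_continuation[where U = "\<lambda>t. U 2" and w = w and Z = "V 1"])
    show "continuous_on UNIV w" unfolding w_def using rho_pos by (intro continuous_intros) auto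
    have w0: "B (U 2) (V 1) = b + w 0" using h2 by (simp add: w_def algebra_simps)
    show "B (U 2) (V 1) = b + w 0" by (fact w0)
    from w0 have "w 0 = B (U 2) (V 1) - b" by simp
    then show "F (U 2) (V 1) + \<rho> / 4 * (norm (w 0))\<^sup>2 \<le> \<beta>" using lev2 by simp
    fix t Y \<nu>
    assume *: "0 \<le> t" "t \<le> 1" "B (U 2) Y = b + w t" "C (U 2) \<nu> + G (U 2) Y = 0"
      "F (U 2) Y + \<rho> / 4 * (norm (w t))\<^sup>2 \<le> \<beta>"
    then show "F (U 2) Y + \<rho> / 4 * (norm (w t))\<^sup>2 < \<beta>" using key[OF *] margin by linarith
  qed auto
  then show ?feas by (auto simp: w_def)
qed

text \<open>
  The third conjunct, that \<open>U\<close> has a feasible partner in the level set, is the starting point of the continuation in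
  the next step.
\<close>

lemma confined:
  "crit (U (k + 2)) (V (k + 2)) (\<Lambda> (k + 2)) \<and> Lag (U (k + 2)) (V (k + 2)) (\<Lambda> (k + 2)) < \<beta> \<and>
   (\<exists>Y. B (U (k + 2)) Y = b \<and> F (U (k + 2)) Y \<le> \<beta>)"
proof (induction k)
  case 0
  obtain Y \<nu> where Y: "B (U 2) Y = b" "C (U 2) \<nu> + G (U 2) Y = 0" "F (U 2) Y \<le> \<beta>"
    using second_half_step(2) by blast
  have two: "Suc 1 = 2" by simp
  have c: "crit (U 2) (V 2) (\<Lambda> 2)"
    using crit_step[OF crit_first Y second_half_step(1) _ V_stationary[of 1, unfolded two] dual[of 1, unfolded two]]
      margin by simp
  have "Lag (U 2) (V 2) (\<Lambda> 2) + decay * ((norm (U 2 - U 1))\<^sup>2 + (norm (V 2 - V 1))\<^sup>2) \<le> \<beta>\<^sub>0 + M\<^sup>2 / \<rho>"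
    by (rule Lag_step_descent[OF crit_first c dual[of 1, unfolded two] second_half_step(1)
          V_descent[of 1, unfolded two]])
  moreover have "decay * ((norm (U 2 - U 1))\<^sup>2 + (norm (V 2 - V 1))\<^sup>2) \<ge> 0" using decay_pos by simp
  ultimately have "Lag (U 2) (V 2) (\<Lambda> 2) < \<beta>" using margin by linarith
  then show ?case unfolding add_0 using c Y by blast
next
  case (Suc k)
  let ?U = "U (k + 2)" and ?V = "V (k + 2)" and ?y = "\<Lambda> (k + 2)"
  let ?U' = "U (Suc (k + 2))" and ?V' = "V (Suc (k + 2))" and ?y' = "\<Lambda> (Suc (k + 2))"
  from Suc.IH obtain Y0 where c: "crit ?U ?V ?y" and L: "Lag ?U ?V ?y < \<beta>"
    and Y0: "B ?U Y0 = b" "F ?U Y0 \<le> \<beta>" by blast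
  define W where "W = (\<lambda>t::real. ?U + t *\<^sub>R (?U' - ?U))"
  have "\<exists>Y \<nu>. B (W 1) Y = b + 0 \<and> C (W 1) \<nu> + G (W 1) Y = 0 \<and> F (W 1) Y + \<rho> / 4 * (norm (0::'b))\<^sup>2 \<le> \<beta>"
  proof (rule level_continuation[where U = W and w = "\<lambda>t. 0" and Z = Y0])
    show "continuous_on UNIV W" unfolding W_def by (intro continuous_intros)
    fix t Y \<nu>
    assume t: "0 \<le> t" "t \<le> 1" and Y: "B (W t) Y = b + 0" "C (W t) \<nu> + G (W t) Y = 0"
      "F (W t) Y + \<rho> / 4 * (norm (0::'b))\<^sup>2 \<le> \<beta>"
    have "Lag (W t) ?V ?y + \<gamma> / 2 * (norm (W t - ?U))\<^sup>2 \<le> Lag ?U ?V ?y"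
      using Lag_descent_segment[OF U_min t, of "W t" ?U "k + 2"] by (simp add: W_def Lag_sym)
    then have "F (W t) Y + (norm (?y - \<nu>))\<^sup>2 / (2 * \<rho>) \<le> Lag ?U ?V ?y"
      using feasible_value_bound[OF c _ Y(2)] Y by simp
    moreover have "(norm (?y - \<nu>))\<^sup>2 / (2 * \<rho>) \<ge> 0" using rho_pos by simp
    ultimately show "F (W t) Y + \<rho> / 4 * (norm (0::'b))\<^sup>2 < \<beta>" using L by simp
  qed (use Y0 in \<open>simp_all add: W_def\<close>)
  then obtain Y \<nu> where Y: "B ?U' Y = b" "C ?U' \<nu> + G ?U' Y = 0" "F ?U' Y \<le> \<beta>"
    by (auto simp: W_def)
  have c': "crit ?U' ?V' ?y'"
    by (rule crit_step[OF c Y U_descent less_imp_le[OF L] V_stationary dual])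
  have "Lag ?U' ?V' ?y' + decay * ((norm (?U' - ?U))\<^sup>2 + (norm (?V' - ?V))\<^sup>2) \<le> Lag ?U ?V ?y"
    by (rule Lag_step_descent[OF c c' dual U_descent V_descent])
  moreover have "decay * ((norm (?U' - ?U))\<^sup>2 + (norm (?V' - ?V))\<^sup>2) \<ge> 0" using decay_pos by simp
  ultimately have "Lag ?U' ?V' ?y' < \<beta>" using L by linarith
  then show ?case unfolding add_Suc using c' Y by blast
qed

lemma crit_iterates: "k \<ge> 2 \<Longrightarrow> crit (U k) (V k) (\<Lambda> k)"
  by (metis confined le_add_diff_inverse2)

lemma Lag_decrease:
  assumes "k \<ge> 2"
  shows "Lag (U (Suc k)) (V (Suc k)) (\<Lambda> (Suc k))
     + decay * ((norm (U (Suc k) - U k))\<^sup>2 + (norm (V (Suc k) - V k))\<^sup>2) \<le> Lag (U k) (V k) (\<Lambda> k)"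
  using assms by (intro Lag_step_descent[OF crit_iterates crit_iterates dual U_descent V_descent]) auto

text \<open>
  The gradient of the Lagrangian in all three variables; its zeros are the KKT points.
\<close>

definition grad_Lag :: "'a \<times> 'a \<times> 'b \<Rightarrow> 'a \<times> 'a \<times> 'b" where
  "grad_Lag = (\<lambda>(U, V, y). (G V U + C V (y + \<rho> *\<^sub>R (B U V - b)),
      G U V + C U (y + \<rho> *\<^sub>R (B U V - b)), B U V - b))"

section \<open>Convergence rates of the alternating iterates\<close>

lemma iterate_bounds:
  assumes "k \<ge> 2" shows "norm (U k) \<le> \<delta>" "norm (V k) \<le> 2 * \<delta>" "norm (\<Lambda> k) \<le> M"
proof -
  have "norm (U k) \<le> \<delta>" "norm (U k) + norm (V k) \<le> 2 * \<delta>"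
    using crit_iterates[OF assms] by (simp_all add: crit_def)
  then show "norm (U k) \<le> \<delta>" "norm (V k) \<le> 2 * \<delta>" using norm_ge_zero[of "U k"] by linarith+
  show "norm (\<Lambda> k) \<le> M" by (rule crit_multiplier_bound[OF crit_iterates[OF assms]])
qed

text \<open>
  The components in \<open>V\<close> and in the multiplier are \<open>C (U (Suc k)) (\<Lambda> (Suc k) - \<Lambda> k)\<close> and
  \<open>(\<Lambda> (Suc k) - \<Lambda> k) / \<rho>\<close>. The component in \<open>U\<close> differs from the stationarity relation of the step in \<open>U\<close>
  only by the later changes of \<open>V\<close> and of the multiplier.
\<close>

lemma grad_Lag_bound:
  "\<exists>K. \<forall>k\<ge>2. norm (grad_Lag (U (Suc k), V (Suc k), \<Lambda> (Suc k)))
     \<le> K * norm ((U (Suc k), V (Suc k), \<Lambda> (Suc k)) - (U k, V k, \<Lambda> k))"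
proof -
  obtain K where K: "K \<ge> 0" and KG: "\<And>U V U' V'. norm U \<le> 2 * \<delta> \<Longrightarrow> norm V \<le> 2 * \<delta> \<Longrightarrow>
      norm U' \<le> 2 * \<delta> \<Longrightarrow> norm V' \<le> 2 * \<delta> \<Longrightarrow>
      norm (G U' V' - G U V) \<le> K * (norm (U' - U) + norm (V' - V))"
    using G_local_lip[of "2 * \<delta>"] by blast
  define K' where "K' = (K + s * (3 * M) + s * (2 * \<delta>) * (1 + \<rho> * (s * \<delta>))) + s * \<delta> + 1 / \<rho>"
  have "norm (grad_Lag (U (Suc k), V (Suc k), \<Lambda> (Suc k)))
     \<le> K' * norm ((U (Suc k), V (Suc k), \<Lambda> (Suc k)) - (U k, V k, \<Lambda> k))" if k: "k \<ge> 2" for k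
  proof -
    define U' V' y' V0 y d where "U' = U (Suc k)" and "V' = V (Suc k)" and "y' = \<Lambda> (Suc k)"
      and "V0 = V k" and "y = \<Lambda> k" and "d = y' - y"
    define N where "N = norm ((U (Suc k), V (Suc k), \<Lambda> (Suc k)) - (U k, V k, \<Lambda> k))"
    have bd: "norm U' \<le> \<delta>" "norm V' \<le> 2 * \<delta>" "norm y' \<le> M" "norm V0 \<le> 2 * \<delta>" "norm y \<le> M"
      using iterate_bounds[of k] iterate_bounds[of "Suc k"] k
      by (simp_all add: U'_def V'_def y'_def V0_def y_def)
    have "(U (Suc k), V (Suc k), \<Lambda> (Suc k)) - (U k, V k, \<Lambda> k) = (U' - U k, V' - V0, d)"
      by (simp add: U'_def V'_def y'_def V0_def y_def d_def)
    then have N: "norm (V' - V0) \<le> N" "norm d \<le> N" "N \<ge> 0"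
      using norm_snd_le[of "(V' - V0, d)" "U' - U k"] norm_fst_le[of "V' - V0" d] norm_snd_le[of d "V' - V0"]
      unfolding N_def by simp_all
    have h: "B U' V' - b = (1 / \<rho>) *\<^sub>R d" using residual[of k] by (simp add: U'_def V'_def y'_def y_def d_def)
    have rh: "\<rho> *\<^sub>R (B U' V' - b) = d" using rho_pos by (simp add: h)
    have G1: "C U' y' + G U' V' = 0" using V_stationary[of k] by (simp add: U'_def V'_def y'_def)
    have c2: "G U' V' + C U' (y' + d) = C U' d" using G1 by (simp add: C.add_right algebra_simps)
    have G2: "G V0 U' + C V0 (y + \<rho> *\<^sub>R (B V0 U' - b)) = 0"
      using Lag_minimizer[OF U_min[of k]] by (simp add: U'_def V0_def y_def)
    have "\<rho> *\<^sub>R (B V0 U' - b) = \<rho> *\<^sub>R (B U' V' - b) - \<rho> *\<^sub>R B U' (V' - V0)"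
      using B_sym[of V0 U'] by (simp add: B.diff_right algebra_simps)
    then have e: "y + \<rho> *\<^sub>R (B V0 U' - b) = y' + d - (d + \<rho> *\<^sub>R B U' (V' - V0))"
      unfolding rh by (simp add: d_def)
    have c1: "G V' U' + C V' (y' + d) = (G V' U' - G V0 U') + C (V' - V0) (y' + d) + C V0 (d + \<rho> *\<^sub>R B U' (V' - V0))"
    proof -
      have "C V0 (y' + d - (d + \<rho> *\<^sub>R B U' (V' - V0))) = - G V0 U'"
        using G2 unfolding e by (simp add: eq_neg_iff_add_eq_0 add.commute)
      then have "C V0 (y' + d) - C V0 (d + \<rho> *\<^sub>R B U' (V' - V0)) = - G V0 U'" by (simp only: C.diff_right)
      then show ?thesis by (simp add: C.diff_left algebra_simps)
    qed
    have nd: "norm (y' + d) \<le> 3 * M"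
      using norm_triangle_ineq[of y' d] norm_triangle_ineq4[of y' y] bd by (simp add: d_def)
    have "norm (G V' U' - G V0 U') \<le> K * norm (V' - V0)"
      using KG[of V0 U' V' U'] bd delta_pos by simp
    also have "\<dots> \<le> K * N" using K N by (intro mult_left_mono) auto
    finally have t1: "norm (G V' U' - G V0 U') \<le> K * N" .
    have "norm (C (V' - V0) (y' + d)) \<le> s * norm (V' - V0) * norm (y' + d)" by (rule C_norm)
    also have "\<dots> \<le> s * N * (3 * M)" using s_nonneg N nd by (intro mult_mono) auto
    finally have t2: "norm (C (V' - V0) (y' + d)) \<le> s * N * (3 * M)" .
    have BV: "norm (\<rho> *\<^sub>R B U' (V' - V0)) \<le> \<rho> * (s * \<delta> * N)"
    proof -
      have "norm (B U' (V' - V0)) \<le> s * norm U' * norm (V' - V0)" by (rule B_norm)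
      also have "\<dots> \<le> s * \<delta> * N" using s_nonneg N bd delta_pos by (intro mult_mono) auto
      finally show ?thesis using rho_pos by simp
    qed
    have "norm (C V0 (d + \<rho> *\<^sub>R B U' (V' - V0))) \<le> s * norm V0 * norm (d + \<rho> *\<^sub>R B U' (V' - V0))" by (rule C_norm)
    also have "\<dots> \<le> s * (2 * \<delta>) * (N + \<rho> * (s * \<delta> * N))"
      using s_nonneg bd N BV norm_triangle_ineq[of d "\<rho> *\<^sub>R B U' (V' - V0)"] delta_pos
      by (intro mult_mono) auto
    finally have t3: "norm (C V0 (d + \<rho> *\<^sub>R B U' (V' - V0))) \<le> s * (2 * \<delta>) * (N + \<rho> * (s * \<delta> * N))" .
    have n1: "norm (G V' U' + C V' (y' + d)) \<le> K * N + s * N * (3 * M) + s * (2 * \<delta>) * (N + \<rho> * (s * \<delta> * N))"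
      unfolding c1 by (intro norm_triangle_mono t1 t2 t3)
    have n2: "norm (G U' V' + C U' (y' + d)) \<le> s * \<delta> * N"
    proof -
      have "norm (C U' d) \<le> s * norm U' * norm d" by (rule C_norm)
      also have "\<dots> \<le> s * \<delta> * N" using s_nonneg N bd delta_pos by (intro mult_mono) auto
      finally show ?thesis unfolding c2 .
    qed
    have n3: "norm (B U' V' - b) \<le> N / \<rho>" unfolding h using rho_pos N by (simp add: divide_right_mono)
    have "grad_Lag (U (Suc k), V (Suc k), \<Lambda> (Suc k)) =
        (G V' U' + C V' (y' + d), G U' V' + C U' (y' + d), B U' V' - b)"
      using rh by (simp add: grad_Lag_def U'_def V'_def y'_def)
    then have "norm (grad_Lag (U (Suc k), V (Suc k), \<Lambda> (Suc k)))
        \<le> norm (G V' U' + C V' (y' + d)) + (norm (G U' V' + C U' (y' + d)) + norm (B U' V' - b))"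
      by (metis (no_types, lifting) norm_Pair_le add_left_mono order_trans)
    also have "\<dots> \<le> K' * N" using n1 n2 n3 by (simp add: K'_def algebra_simps)
    finally show ?thesis by (simp add: N_def)
  qed
  then show ?thesis by blast
qed

lemma Lag_decrease_norm:
  assumes k: "k \<ge> 2"
  shows "Lag (U (Suc k)) (V (Suc k)) (\<Lambda> (Suc k))
     + decay / (1 + \<gamma> * \<rho> / 2) * (norm ((U (Suc k), V (Suc k), \<Lambda> (Suc k)) - (U k, V k, \<Lambda> k)))\<^sup>2
     \<le> Lag (U k) (V k) (\<Lambda> k)"
proof -
  define D where "D = (norm (U (Suc k) - U k))\<^sup>2 + (norm (V (Suc k) - V k))\<^sup>2"
  have gr: "\<gamma> * \<rho> / 2 \<ge> 0" using gamma_pos rho_pos by simp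
  have "(norm (\<Lambda> (Suc k) - \<Lambda> k))\<^sup>2 \<le> \<gamma> * \<rho> / 2 * D"
    unfolding D_def by (rule crit_multiplier_change) (use crit_iterates k in auto)
  then have "(norm ((U (Suc k), V (Suc k), \<Lambda> (Suc k)) - (U k, V k, \<Lambda> k)))\<^sup>2 \<le> (1 + \<gamma> * \<rho> / 2) * D"
    by (simp add: norm_Pair D_def algebra_simps)
  then have "decay / (1 + \<gamma> * \<rho> / 2) * (norm ((U (Suc k), V (Suc k), \<Lambda> (Suc k)) - (U k, V k, \<Lambda> k)))\<^sup>2
      \<le> decay / (1 + \<gamma> * \<rho> / 2) * ((1 + \<gamma> * \<rho> / 2) * D)"
    using decay_pos gr by (intro mult_left_mono) auto
  also have "\<dots> = decay * D" using gr by simp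
  finally show ?thesis using Lag_decrease[OF k] by (simp add: D_def)
qed

lemma Lag_has_gradient:
  "((\<lambda>z. Lag (fst z) (fst (snd z)) (snd (snd z))) has_derivative (\<lambda>h. grad_Lag z \<bullet> h)) (at z)"
proof -
  obtain U V y where z: "z = (U, V, y)" by (cases z) auto
  have BF: "((\<lambda>z. B (fst z) (fst (snd z)) - b) has_derivative
      (\<lambda>h. B U (fst (snd h)) + B (fst h) V)) (at z)"
    by (rule derivative_eq_intros B.FDERIV bounded_linear.has_derivative bounded_linear_fst
        bounded_linear_snd has_derivative_ident refl | simp add: z)+
  have "((\<lambda>z. (fst z, fst (snd z))) has_derivative (\<lambda>h. (fst h, fst (snd h)))) (at z)"
    by (rule derivative_eq_intros bounded_linear.has_derivative bounded_linear_fst bounded_linear_snd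
        has_derivative_ident has_derivative_Pair refl | simp)+
  moreover have "((\<lambda>w. F (fst w) (snd w)) has_derivative (\<lambda>h. G V U \<bullet> fst h + G U V \<bullet> snd h)) (at (fst z, fst (snd z)))"
    using F_total[of "(U, V)"] by (simp add: z)
  ultimately have "((\<lambda>z. F (fst (fst z, fst (snd z))) (snd (fst z, fst (snd z)))) has_derivative
      (\<lambda>h. G V U \<bullet> fst (fst h, fst (snd h)) + G U V \<bullet> snd (fst h, fst (snd h)))) (at z)"
    by (rule has_derivative_compose)
  then have FF: "((\<lambda>z. F (fst z) (fst (snd z))) has_derivative (\<lambda>h. G V U \<bullet> fst h + G U V \<bullet> fst (snd h))) (at z)"
    by simp
  have yy: "((\<lambda>z. snd (snd z)) has_derivative (\<lambda>h. snd (snd h))) (at z)"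
    by (rule bounded_linear.has_derivative bounded_linear_snd has_derivative_ident)+
  define r where "r = B U V - b"
  have "((\<lambda>z. F (fst z) (fst (snd z)) + snd (snd z) \<bullet> (B (fst z) (fst (snd z)) - b) +
       \<rho> / 2 * ((B (fst z) (fst (snd z)) - b) \<bullet> (B (fst z) (fst (snd z)) - b))) has_derivative
      (\<lambda>h. (G V U \<bullet> fst h + G U V \<bullet> fst (snd h))
        + (y \<bullet> (B U (fst (snd h)) + B (fst h) V) + snd (snd h) \<bullet> r)
        + \<rho> / 2 * (r \<bullet> (B U (fst (snd h)) + B (fst h) V) + (B U (fst (snd h)) + B (fst h) V) \<bullet> r))) (at z)"
    using has_derivative_add[OF has_derivative_add[OF FF has_derivative_inner[OF yy BF]]
        has_derivative_mult_right[OF has_derivative_inner[OF BF BF], of "\<rho> / 2"]]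
    by (simp add: z r_def)
  moreover have "(\<lambda>h. (G V U \<bullet> fst h + G U V \<bullet> fst (snd h))
        + (y \<bullet> (B U (fst (snd h)) + B (fst h) V) + snd (snd h) \<bullet> r)
        + \<rho> / 2 * (r \<bullet> (B U (fst (snd h)) + B (fst h) V) + (B U (fst (snd h)) + B (fst h) V) \<bullet> r))
      = (\<lambda>h. grad_Lag z \<bullet> h)"
  proof
    fix h :: "'a \<times> 'a \<times> 'b"
    obtain h1 h2 h3 where h: "h = (h1, h2, h3)" by (cases h) auto
    show "(G V U \<bullet> fst h + G U V \<bullet> fst (snd h))
        + (y \<bullet> (B U (fst (snd h)) + B (fst h) V) + snd (snd h) \<bullet> r)
        + \<rho> / 2 * (r \<bullet> (B U (fst (snd h)) + B (fst h) V) + (B U (fst (snd h)) + B (fst h) V) \<bullet> r)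
      = grad_Lag z \<bullet> h"
    proof -
      have "grad_Lag z = (G V U + C V (y + \<rho> *\<^sub>R r), G U V + C U (y + \<rho> *\<^sub>R r), r)"
        by (simp add: z grad_Lag_def r_def)
      then show ?thesis unfolding h
      by (simp add: inner_add_left inner_add_right adjoint B_sym[of h1 V] inner_commute[of _ r] algebra_simps)
    qed
  qed
  ultimately show ?thesis by (simp add: Lag_def[abs_def] power2_norm_eq_inner)
qed

theorem convergence_rates:
  assumes loj: "\<And>x w. grad_Lag w = 0 \<Longrightarrow> dist x w \<le> d \<Longrightarrow>
      \<bar>Lag (fst x) (fst (snd x)) (snd (snd x)) - Lag (fst w) (fst (snd w)) (snd (snd w))\<bar> powr \<alpha>
        \<le> c * norm (grad_Lag x)"
    and c: "c > 0" and d: "d > 0"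
  defines "W \<equiv> {w. grad_Lag w = 0}"
  shows "\<alpha> = 0 \<Longrightarrow> \<exists>k0. \<forall>k\<ge>k0. (U k, V k, \<Lambda> k) = (U k0, V k0, \<Lambda> k0)"
    and "0 < \<alpha> \<Longrightarrow> \<alpha> \<le> 1 / 2 \<Longrightarrow> \<exists>(k0::nat) \<xi> \<mu>. \<xi> > 0 \<and> 0 \<le> \<mu> \<and> \<mu> < 1 \<and>
           (\<forall>k>k0. infdist (U k, V k, \<Lambda> k) W \<le> \<xi> * \<mu> ^ (k - k0))"
    and "1 / 2 < \<alpha> \<Longrightarrow> \<alpha> < 1 \<Longrightarrow> \<exists>(k0::nat) \<xi>. \<xi> > 0 \<and>
           (\<forall>k>k0. infdist (U k, V k, \<Lambda> k) W \<le> \<xi> * real (k - k0) powr (- ((1 - \<alpha>) / (2 * \<alpha> - 1))))"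
proof -
  \<comment> \<open>Confinement, and with it the descent, starts at the second iterate.\<close>
  define z where "z k = (U (k + 2), V (k + 2), \<Lambda> (k + 2))" for k
  define \<Phi> where "\<Phi> = (\<lambda>x. Lag (fst x) (fst (snd x)) (snd (snd x)))"
  obtain K where K: "\<And>k. k \<ge> 2 \<Longrightarrow> norm (grad_Lag (U (Suc k), V (Suc k), \<Lambda> (Suc k)))
     \<le> K * norm ((U (Suc k), V (Suc k), \<Lambda> (Suc k)) - (U k, V k, \<Lambda> k))" using grad_Lag_bound by blast
  have bdd: "bounded (range z)"
  proof (rule boundedI)
    fix x assume "x \<in> range z"
    then obtain k where "x = (U (k + 2), V (k + 2), \<Lambda> (k + 2))" by (auto simp: z_def)
    then show "norm x \<le> \<delta> + (2 * \<delta> + M)"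
      using iterate_bounds[of "k + 2"] norm_Pair_le[of "U (k + 2)" "(V (k + 2), \<Lambda> (k + 2))"]
        norm_Pair_le[of "V (k + 2)" "\<Lambda> (k + 2)"] by simp
  qed
  have \<Phi>c: "continuous_on UNIV \<Phi>"
    unfolding \<Phi>_def using Lag_has_gradient by (meson continuous_at_imp_continuous_on has_derivative_continuous)
  have gc: "continuous_on UNIV grad_Lag"
  proof -
    have *: "continuous_on UNIV (\<lambda>z::'a \<times> 'a \<times> 'b. G (f z) (g z))"
      if "continuous_on UNIV f" "continuous_on UNIV g" for f g
      using continuous_on_compose2[OF G_cont, of UNIV "\<lambda>z. (f z, g z)"] that by (simp add: continuous_on_Pair)
    have "grad_Lag = (\<lambda>z. (G (fst (snd z)) (fst z) + C (fst (snd z)) (snd (snd z) + \<rho> *\<^sub>R (B (fst z) (fst (snd z)) - b)),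
      G (fst z) (fst (snd z)) + C (fst z) (snd (snd z) + \<rho> *\<^sub>R (B (fst z) (fst (snd z)) - b)), B (fst z) (fst (snd z)) - b))"
      by (auto simp: grad_Lag_def)
    then show ?thesis
      by (simp only:) (intro continuous_on_Pair continuous_on_add * C.continuous_on B.continuous_on continuous_intros)
  qed
  have desc: "\<Phi> (z (Suc k)) + decay / (1 + \<gamma> * \<rho> / 2) * (norm (z (Suc k) - z k))\<^sup>2 \<le> \<Phi> (z k)" for k
    using Lag_decrease_norm[of "k + 2"] by (simp add: z_def \<Phi>_def)
  have tau: "decay / (1 + \<gamma> * \<rho> / 2) > 0"
    using decay_pos gamma_pos rho_pos by (intro divide_pos_pos add_pos_pos) auto
  have gr: "norm (grad_Lag (z (Suc k))) \<le> K * norm (z (Suc k) - z k)" for k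
    using K[of "k + 2"] by (simp add: z_def)
  have WI: "x \<in> W" if "grad_Lag x = 0" for x using that by (simp add: W_def)
  have lj: "\<bar>\<Phi> x - \<Phi> w\<bar> powr \<alpha> \<le> c * norm (grad_Lag x)" if "w \<in> W" "dist x w \<le> d" for x w
    using loj[of w x] that by (simp add: W_def \<Phi>_def)
  note rates = lojasiewicz_descent_rates[OF bdd \<Phi>c gc desc tau gr WI lj c d]
  have shift: "(U k, V k, \<Lambda> k) = z (k - 2)" if "k \<ge> 2" for k by (simp only: z_def le_add_diff_inverse2[OF that])
  show "\<exists>k0. \<forall>k\<ge>k0. (U k, V k, \<Lambda> k) = (U k0, V k0, \<Lambda> k0)" if a: "\<alpha> = 0"
  proof -
    obtain k0 where "\<And>k. k \<ge> k0 \<Longrightarrow> z k = z k0" using rates(1) a by blast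
    then have "\<forall>k\<ge>k0 + 2. (U k, V k, \<Lambda> k) = (U (k0 + 2), V (k0 + 2), \<Lambda> (k0 + 2))"
      using shift by (metis add_le_imp_le_diff le_add2 order_trans z_def)
    then show ?thesis by blast
  qed
  show "\<exists>(k0::nat) \<xi> \<mu>. \<xi> > 0 \<and> 0 \<le> \<mu> \<and> \<mu> < 1 \<and>
           (\<forall>k>k0. infdist (U k, V k, \<Lambda> k) W \<le> \<xi> * \<mu> ^ (k - k0))" if a: "0 < \<alpha>" "\<alpha> \<le> 1 / 2"
  proof -
    obtain k0 \<xi> \<mu> where *: "\<xi> > 0" "0 \<le> \<mu>" "\<mu> < 1" "\<And>k. k > k0 \<Longrightarrow> infdist (z k) W \<le> \<xi> * \<mu> ^ (k - k0)"
      using rates(2) a by blast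
    have "infdist (U k, V k, \<Lambda> k) W \<le> \<xi> * \<mu> ^ (k - (k0 + 2))" if "k > k0 + 2" for k
      using *(4)[of "k - 2"] that shift[of k] by (simp add: diff_diff_left add.commute)
    then show ?thesis using *(1-3) by blast
  qed
  show "\<exists>(k0::nat) \<xi>. \<xi> > 0 \<and>
           (\<forall>k>k0. infdist (U k, V k, \<Lambda> k) W \<le> \<xi> * real (k - k0) powr (- ((1 - \<alpha>) / (2 * \<alpha> - 1))))"
    if a: "1 / 2 < \<alpha>" "\<alpha> < 1"
  proof -
    obtain k0 \<xi> where *: "\<xi> > 0" "\<And>k. k > k0 \<Longrightarrow>
        infdist (z k) W \<le> \<xi> * real (k - k0) powr (- ((1 - \<alpha>) / (2 * \<alpha> - 1)))"
      using rates(3) a by blast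
    have "infdist (U k, V k, \<Lambda> k) W \<le> \<xi> * real (k - (k0 + 2)) powr (- ((1 - \<alpha>) / (2 * \<alpha> - 1)))"
      if "k > k0 + 2" for k
    proof -
      have "k - 2 - k0 = k - (k0 + 2)" by simp
      then show ?thesis using *(2)[of "k - 2"] that shift[of k] by simp
    qed
    then show ?thesis using *(1) by blast
  qed
qed

end

section \<open>Frobenius geometry and gradients of matrix functions\<close>

lemma norm_matrix_mult_le:
  fixes X :: "real^'k^'m" and Y :: "real^'r^'k"
  shows "norm (X ** Y) \<le> norm X * norm Y"
proof -
  have sq: "(norm Z)\<^sup>2 = (\<Sum>i\<in>UNIV. \<Sum>j\<in>UNIV. (Z $ i $ j)\<^sup>2)" for Z :: "real^'b^'a"
    unfolding norm_matrix_eq_frobenius by (intro real_sqrt_pow2 sum_nonneg) auto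
  have "(norm (X ** Y))\<^sup>2 = (\<Sum>i\<in>UNIV. \<Sum>j\<in>UNIV. (\<Sum>l\<in>UNIV. X $ i $ l * Y $ l $ j)\<^sup>2)"
    unfolding sq by (simp add: matrix_matrix_mult_def)
  also have "\<dots> \<le> (\<Sum>i\<in>UNIV. \<Sum>j\<in>UNIV. (\<Sum>l\<in>UNIV. (X $ i $ l)\<^sup>2) * (\<Sum>l\<in>UNIV. (Y $ l $ j)\<^sup>2))"
    by (intro sum_mono Cauchy_Schwarz_ineq_sum)
  also have "\<dots> = (\<Sum>i\<in>UNIV. \<Sum>l\<in>UNIV. (X $ i $ l)\<^sup>2) * (\<Sum>j\<in>UNIV. \<Sum>l\<in>UNIV. (Y $ l $ j)\<^sup>2)"
    by (simp add: sum_product)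
  also have "(\<Sum>j\<in>UNIV. \<Sum>l\<in>UNIV. (Y $ l $ j)\<^sup>2) = (norm Y)\<^sup>2" unfolding sq by (rule sum.swap)
  also have "(\<Sum>i\<in>UNIV. \<Sum>l\<in>UNIV. (X $ i $ l)\<^sup>2) = (norm X)\<^sup>2" by (rule sq[symmetric])
  finally have "(norm (X ** Y))\<^sup>2 \<le> (norm X * norm Y)\<^sup>2" by (simp add: power_mult_distrib)
  then show ?thesis by (rule power2_le_imp_le) simp
qed

lemma bounded_bilinear_matrix_mult:
  "bounded_bilinear ((**) :: real^'k^'m \<Rightarrow> real^'r^'k \<Rightarrow> real^'r^'m)"
proof
  show "\<exists>K. \<forall>(X :: real^'k^'m) (Y :: real^'r^'k). norm (X ** Y) \<le> norm X * norm Y * K"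
    using norm_matrix_mult_le by (intro exI[of _ 1]) auto
qed (auto simp: matrix_matrix_mult_def vec_eq_iff sum.distrib[symmetric] algebra_simps sum_distrib_left)

lemma norm_transpose: "norm (transpose X) = norm (X :: real^'n^'m)"
  unfolding norm_matrix_eq_frobenius transpose_def by (subst sum.swap) simp

lemma bounded_linear_transpose: "bounded_linear (transpose :: real^'n^'m \<Rightarrow> real^'m^'n)"
proof -
  have "linear (transpose :: real^'n^'m \<Rightarrow> real^'m^'n)"
    by (rule linearI) (simp_all add: transpose_def vec_eq_iff)
  then show ?thesis by (rule linear_conv_bounded_linear[THEN iffD1])
qed

lemma inner_transpose: "transpose X \<bullet> transpose Y = X \<bullet> (Y :: real^'n^'m)"
  unfolding inner_vec_def transpose_def by (subst sum.swap) simp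

lemma inner_matrix_mult_transpose:
  fixes D :: "real^'n^'m" and H :: "real^'r^'m" and U :: "real^'r^'n"
  shows "D \<bullet> (H ** transpose U) = (D ** U) \<bullet> H"
proof -
  have "D \<bullet> (H ** transpose U) = (\<Sum>i\<in>UNIV. \<Sum>j\<in>UNIV. \<Sum>k\<in>UNIV. D $ i $ j * (H $ i $ k * U $ j $ k))"
    by (simp add: inner_vec_def matrix_matrix_mult_def transpose_def sum_distrib_left)
  also have "\<dots> = (\<Sum>i\<in>UNIV. \<Sum>k\<in>UNIV. \<Sum>j\<in>UNIV. D $ i $ j * (H $ i $ k * U $ j $ k))"
    by (intro sum.cong refl sum.swap)
  also have "\<dots> = (D ** U) \<bullet> H"
    by (simp add: inner_vec_def matrix_matrix_mult_def sum_distrib_left sum_distrib_right mult_ac)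
  finally show ?thesis .
qed

lemma bounded_bilinear_outer:
  "bounded_bilinear (\<lambda>(U :: real^'r^'n) (V :: real^'r^'n). U ** transpose V)"
  using bounded_bilinear.comp[OF bounded_bilinear_matrix_mult bounded_linear_ident bounded_linear_transpose] by simp

lemma norm_outer_le: "norm (U ** transpose V) \<le> norm U * norm (V :: real^'r^'n)" for U :: "real^'r^'n"
  using norm_matrix_mult_le[of U "transpose V"] by (simp add: norm_transpose)

lemma transpose_outer: "transpose (U ** transpose V) = V ** transpose (U :: real^'r^'n)" for V :: "real^'r^'n"
  by (simp add: matrix_transpose_mul)

lemma differentiable_has_grad:
  fixes f :: "'a::euclidean_space \<Rightarrow> real"
  assumes "f differentiable (at x)"
  shows "(f has_derivative (\<lambda>h. grad f x \<bullet> h)) (at x)"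
proof -
  obtain f' where f': "(f has_derivative f') (at x)" using assms by (auto simp: differentiable_def)
  then have lin: "linear f'" by (simp add: has_derivative_bounded_linear bounded_linear.linear)
  define D where "D = (\<Sum>i\<in>Basis. f' i *\<^sub>R i)"
  have "f' h = h \<bullet> D" for h
  proof -
    have "f' h = f' (\<Sum>i\<in>Basis. (h \<bullet> i) *\<^sub>R i)" by (simp only: euclidean_representation)
    also have "\<dots> = (\<Sum>i\<in>Basis. (h \<bullet> i) * f' i)" using lin by (simp add: linear_sum linear_scale)
    finally show ?thesis by (simp add: D_def inner_sum_right mult.commute)
  qed
  then have "GDERIV f x :> D" using f' unfolding gderiv_def by presburger
  then have "GDERIV f x :> grad f x" using grad_eqI by metis
  then show ?thesis by (simp add: gderiv_def inner_commute)
qed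

lemma convex_above_tangent:
  fixes f :: "'a::euclidean_space \<Rightarrow> real"
  assumes conv: "convex_on UNIV f" and diff: "f differentiable (at x)"
  shows "f y \<ge> f x + grad f x \<bullet> (y - x)"
proof -
  define \<phi> where "\<phi> t = f (x + t *\<^sub>R (y - x))" for t :: real
  have "convex_on UNIV \<phi>"
  proof (rule convex_onI)
    fix t a b :: real assume t: "0 < t" "t < 1"
    have "x + ((1 - t) *\<^sub>R a + t *\<^sub>R b) *\<^sub>R (y - x) = (1 - t) *\<^sub>R (x + a *\<^sub>R (y - x)) + t *\<^sub>R (x + b *\<^sub>R (y - x))"
      by (simp add: algebra_simps)
    then show "\<phi> ((1 - t) *\<^sub>R a + t *\<^sub>R b) \<le> (1 - t) * \<phi> a + t * \<phi> b"
      using convex_onD[OF conv, of t "x + a *\<^sub>R (y - x)" "x + b *\<^sub>R (y - x)"] t by (simp add: \<phi>_def)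
  qed simp
  moreover have "(\<phi> has_real_derivative grad f x \<bullet> (y - x)) (at 0)"
  proof -
    have "((\<lambda>t. x + t *\<^sub>R (y - x)) has_derivative (\<lambda>t. t *\<^sub>R (y - x))) (at 0)"
      by (auto intro!: derivative_eq_intros)
    moreover have "(f has_derivative (\<lambda>h. grad f x \<bullet> h)) (at (x + 0 *\<^sub>R (y - x)))"
      using differentiable_has_grad[OF diff] by simp
    ultimately have "(\<phi> has_derivative (\<lambda>t. grad f x \<bullet> (t *\<^sub>R (y - x)))) (at 0)"
      unfolding \<phi>_def by (rule has_derivative_compose)
    then show ?thesis by (simp add: has_field_derivative_def mult_commute_abs)
  qed
  ultimately have "\<phi> 1 - \<phi> 0 \<ge> (grad f x \<bullet> (y - x)) * (1 - 0)"
    by (intro convex_on_imp_above_tangent[where A = UNIV]) auto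
  then show ?thesis by (simp add: \<phi>_def)
qed

text \<open>
  This makes the partial gradients in \<open>U\<close> and in \<open>V\<close> the same function with exchanged arguments.
\<close>

lemma grad_transpose:
  fixes f :: "real^'n^'n \<Rightarrow> real"
  assumes diff: "\<And>X. f differentiable (at X)" and sym: "\<And>X. f X = f (transpose X)"
  shows "grad f (transpose X) = transpose (grad f X)"
proof -
  have "(transpose has_derivative transpose) (at X)" for X :: "real^'n^'n"
    by (rule bounded_linear_imp_has_derivative[OF bounded_linear_transpose])
  from has_derivative_compose[OF this[of "transpose X"] differentiable_has_grad[OF diff]]
  have "((\<lambda>Y. f (transpose Y)) has_derivative (\<lambda>H. grad f X \<bullet> transpose H)) (at (transpose X))"
    by (simp only: transpose_transpose)
  moreover have "grad f X \<bullet> transpose H = H \<bullet> transpose (grad f X)" for H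
    using inner_transpose[of "grad f X" "transpose H"] by (simp add: inner_commute)
  ultimately have "GDERIV f (transpose X) :> transpose (grad f X)"
    unfolding gderiv_def by (simp add: sym[symmetric])
  then show ?thesis by (rule grad_eqI)
qed

text \<open>
  For symmetric \<open>A i\<close> this is the adjoint of \<open>V \<mapsto> meas_map A (U ** transpose V)\<close>.
\<close>

definition adj_map :: "('m::finite \<Rightarrow> real^'n^'n) \<Rightarrow> real^'r^'n \<Rightarrow> real^'m \<Rightarrow> real^'r^'n" where
  "adj_map A U y = (\<Sum>i\<in>UNIV. (y $ i) *\<^sub>R (A i ** U))"

lemma adj_map_norm:
  "norm (adj_map A U y) \<le> sqrt (\<Sum>i\<in>UNIV. (norm (A i))\<^sup>2) * norm U * norm y"
proof -
  have "norm (adj_map A U y) \<le> (\<Sum>i\<in>UNIV. \<bar>y $ i\<bar> * (norm (A i) * norm U))"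
    unfolding adj_map_def
    by (rule sum_norm_le) (auto intro!: mult_left_mono norm_matrix_mult_le)
  also have "\<dots> = (\<Sum>i\<in>UNIV. \<bar>norm (A i)\<bar> * \<bar>y $ i\<bar>) * norm U"
    by (simp add: sum_distrib_left mult_ac)
  also have "\<dots> \<le> (L2_set (\<lambda>i. norm (A i)) UNIV * L2_set (\<lambda>i. y $ i) UNIV) * norm U"
    by (intro mult_right_mono L2_set_mult_ineq) auto
  also have "\<dots> = sqrt (\<Sum>i\<in>UNIV. (norm (A i))\<^sup>2) * norm U * norm y"
    by (simp add: norm_vec_def[of y] L2_set_def mult_ac)
  finally show ?thesis .
qed

lemma bounded_bilinear_adj_map: "bounded_bilinear (adj_map A)"
proof
  note mult = bounded_bilinear_matrix_mult
  show "adj_map A (U + V) y = adj_map A U y + adj_map A V y" for U V y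
    by (simp add: adj_map_def bounded_bilinear.add_right[OF mult] scaleR_right_distrib sum.distrib)
  show "adj_map A U (y + y') = adj_map A U y + adj_map A U y'" for U y y'
    by (simp add: adj_map_def scaleR_left_distrib sum.distrib)
  show "adj_map A (r *\<^sub>R U) y = r *\<^sub>R adj_map A U y" for r U y
    by (simp add: adj_map_def bounded_bilinear.scaleR_right[OF mult] scaleR_sum_right mult.commute)
  show "adj_map A U (r *\<^sub>R y) = r *\<^sub>R adj_map A U y" for r U y
    by (simp add: adj_map_def scaleR_sum_right)
  show "\<exists>K. \<forall>U y. norm (adj_map A U y) \<le> norm U * norm y * K"
    by (intro exI[of _ "sqrt (\<Sum>i\<in>UNIV. (norm (A i))\<^sup>2)"] allI order_trans[OF adj_map_norm]) (simp add: mult_ac)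
qed

lemma bounded_linear_meas_map: "bounded_linear (meas_map A :: real^'n^'n \<Rightarrow> real^'m::finite)"
proof -
  have "linear (meas_map A)"
    by (rule linearI) (simp_all add: meas_map_def vec_eq_iff inner_add_right)
  then show ?thesis by (rule linear_conv_bounded_linear[THEN iffD1])
qed

lemma bounded_bilinear_meas_outer:
  "bounded_bilinear (\<lambda>(U :: real^'r^'n) V. meas_map A (U ** transpose V))"
proof -
  note outer = bounded_bilinear_outer
  have "bilinear (\<lambda>(U :: real^'r^'n) V. meas_map A (U ** transpose V))"
    unfolding bilinear_def
    by (intro conjI allI bounded_linear.linear bounded_linear_compose[OF bounded_linear_meas_map]
        bounded_bilinear.bounded_linear_left[OF outer] bounded_bilinear.bounded_linear_right[OF outer])
  then show ?thesis by (simp add: bilinear_conv_bounded_bilinear)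
qed

lemma adj_map_adjoint:
  assumes "\<And>i. transpose (A i) = A i"
  shows "adj_map A U y \<bullet> V = y \<bullet> meas_map A (U ** transpose V)"
proof -
  have "A i \<bullet> (U ** transpose V) = (A i ** U) \<bullet> V" for i
  proof -
    have "A i \<bullet> (U ** transpose V) = A i \<bullet> (V ** transpose U)"
      using inner_transpose[of "A i" "U ** transpose V"] assms by (simp add: transpose_outer)
    then show ?thesis by (simp add: inner_matrix_mult_transpose)
  qed
  then show ?thesis
    by (simp add: adj_map_def inner_sum_left meas_map_def inner_vec_def[of y])
qed

lemma norm_constr_jac: "norm (constr_jac A U *v y) = norm (adj_map A U y)"
proof -
  have "(constr_jac A U *v y) $ (i, j) = adj_map A U y $ i $ j" for i j
    by (simp add: constr_jac_def matrix_vector_mult_def adj_map_def mult.commute)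
  then have "(\<Sum>p\<in>UNIV. ((constr_jac A U *v y) $ p)\<^sup>2) = (\<Sum>i\<in>UNIV. \<Sum>j\<in>UNIV. (adj_map A U y $ i $ j)\<^sup>2)"
    unfolding sum.cartesian_product by (intro sum.cong) auto
  then show ?thesis
    by (simp add: norm_matrix_eq_frobenius norm_vec_def[of "constr_jac A U *v y"] L2_set_def)
qed

lemma sigma_min_le: "sigma_min M * norm x \<le> norm (M *v x)"
proof (cases "x = 0")
  case False
  have "sigma_min M \<le> norm (M *v (x /\<^sub>R norm x))"
    unfolding sigma_min_def by (rule cINF_lower) (use False in \<open>auto intro!: bdd_belowI2[of _ 0]\<close>)
  also have "M *v (x /\<^sub>R norm x) = (M *v x) /\<^sub>R norm x" by (simp add: matrix_vector_mult_scaleR)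
  finally show ?thesis using False by (simp add: field_simps)
qed simp

section \<open>The penalized low-rank problem\<close>

definition pen_obj :: "(real^'n^'n \<Rightarrow> real) \<Rightarrow> real \<Rightarrow> real^'r^'n \<Rightarrow> real^'r^'n \<Rightarrow> real" where
  "pen_obj f \<gamma> U V = f (U ** transpose V) + \<gamma> / 2 * (norm (U - V))\<^sup>2"

text \<open>
  The gradient of \<open>pen_obj f \<gamma> U\<close>; the product is \<open>V ** transpose U\<close> because \<open>f\<close> is invariant under transposition.
\<close>

definition pen_grad :: "(real^'n^'n \<Rightarrow> real) \<Rightarrow> real \<Rightarrow> real^'r^'n \<Rightarrow> real^'r^'n \<Rightarrow> real^'r^'n" where
  "pen_grad f \<gamma> U V = grad f (V ** transpose U) ** U + \<gamma> *\<^sub>R (V - U)"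

lemma pen_obj_sym:
  assumes "\<And>X. f X = f (transpose X)"
  shows "pen_obj f \<gamma> U V = pen_obj f \<gamma> V U"
  unfolding pen_obj_def using assms[of "U ** transpose V"] by (simp add: transpose_outer norm_minus_commute)

lemma pen_obj_has_derivative:
  fixes f :: "real^'n^'n \<Rightarrow> real" and z :: "(real^'r^'n) \<times> (real^'r^'n)"
  assumes diff: "\<And>X. f differentiable (at X)" and sym: "\<And>X. f X = f (transpose X)"
  shows "((\<lambda>z. pen_obj f \<gamma> (fst z) (snd z)) has_derivative
    (\<lambda>h. pen_grad f \<gamma> (snd z) (fst z) \<bullet> fst h + pen_grad f \<gamma> (fst z) (snd z) \<bullet> snd h)) (at z)"
proof -
  obtain U V :: "real^'r^'n" where z: "z = (U, V)" by (cases z) auto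
  define X where "X = U ** transpose V"
  have o: "((\<lambda>z. fst z ** transpose (snd z)) has_derivative
      (\<lambda>h. U ** transpose (snd h) + fst h ** transpose V)) (at z)"
    using bounded_bilinear.FDERIV[OF bounded_bilinear_outer, of fst fst z UNIV snd snd]
    by (simp add: z bounded_linear_imp_has_derivative bounded_linear_fst bounded_linear_snd)
  have d: "((\<lambda>z. fst z - snd z) has_derivative (\<lambda>h. fst h - snd h)) (at z)"
    by (intro has_derivative_diff bounded_linear_imp_has_derivative bounded_linear_fst bounded_linear_snd)
  have fX: "(f has_derivative (\<lambda>h. grad f X \<bullet> h)) (at (fst z ** transpose (snd z)))"
    using differentiable_has_grad[OF diff] by (simp add: z X_def)
  have "((\<lambda>z. f (fst z ** transpose (snd z)) + \<gamma> / 2 * ((fst z - snd z) \<bullet> (fst z - snd z))) has_derivative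
     (\<lambda>h. grad f X \<bullet> (U ** transpose (snd h) + fst h ** transpose V)
        + \<gamma> / 2 * ((U - V) \<bullet> (fst h - snd h) + (fst h - snd h) \<bullet> (U - V)))) (at z)"
    using has_derivative_add[OF has_derivative_compose[OF o fX]
        has_derivative_mult_right[OF has_derivative_inner[OF d d], of "\<gamma> / 2"]] by (simp add: z)
  moreover have "grad f X \<bullet> (U ** transpose (snd h) + fst h ** transpose V)
        + \<gamma> / 2 * ((U - V) \<bullet> (fst h - snd h) + (fst h - snd h) \<bullet> (U - V))
      = pen_grad f \<gamma> V U \<bullet> fst h + pen_grad f \<gamma> U V \<bullet> snd h" for h :: "(real^'r^'n) \<times> (real^'r^'n)"
  proof -
    have "grad f X \<bullet> (U ** transpose (snd h)) = transpose (grad f X) \<bullet> (snd h ** transpose U)"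
      using inner_transpose[of "grad f X" "U ** transpose (snd h)"] by (simp add: transpose_outer)
    also have "transpose (grad f X) = grad f (V ** transpose U)"
      using grad_transpose[OF diff sym, of X] by (simp add: X_def transpose_outer)
    finally have "grad f X \<bullet> (U ** transpose (snd h)) = (grad f (V ** transpose U) ** U) \<bullet> snd h"
      by (simp add: inner_matrix_mult_transpose)
    moreover have "(U - V) \<bullet> (fst h - snd h) + (fst h - snd h) \<bullet> (U - V) = 2 * ((U - V) \<bullet> fst h + (V - U) \<bullet> snd h)"
      by (simp add: inner_diff_left inner_diff_right inner_commute)
    ultimately show ?thesis
      by (simp add: pen_grad_def inner_add_right inner_add_left inner_matrix_mult_transpose X_def distrib_left)
  qed
  ultimately show ?thesis by (simp add: pen_obj_def[abs_def] power2_norm_eq_inner z)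
qed

lemma pen_obj_strong:
  fixes f :: "real^'n^'n \<Rightarrow> real" and U V Y :: "real^'r^'n"
  assumes conv: "convex_on UNIV f" and diff: "\<And>X. f differentiable (at X)" and sym: "\<And>X. f X = f (transpose X)"
  shows "pen_obj f \<gamma> U Y \<ge> pen_obj f \<gamma> U V + pen_grad f \<gamma> U V \<bullet> (Y - V) + \<gamma> / 2 * (norm (Y - V))\<^sup>2"
proof -
  have "Y ** transpose U - V ** transpose U = (Y - V) ** transpose U"
    by (simp add: bounded_bilinear.diff_left[OF bounded_bilinear_outer])
  then have "f (Y ** transpose U) \<ge> f (V ** transpose U) + (grad f (V ** transpose U) ** U) \<bullet> (Y - V)"
    using convex_above_tangent[OF conv diff, of "V ** transpose U" "Y ** transpose U"]
    by (simp add: inner_matrix_mult_transpose)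
  moreover have "(norm (Y - U))\<^sup>2 = (norm (V - U))\<^sup>2 + 2 * ((V - U) \<bullet> (Y - V)) + (norm (Y - V))\<^sup>2"
    unfolding power2_norm_eq_inner
    by (simp add: inner_diff_left inner_diff_right inner_commute algebra_simps)
  then have "\<gamma> / 2 * (norm (Y - U))\<^sup>2 = \<gamma> / 2 * (norm (V - U))\<^sup>2 + \<gamma> * ((V - U) \<bullet> (Y - V)) + \<gamma> / 2 * (norm (Y - V))\<^sup>2"
    by (simp add: distrib_left)
  ultimately have "pen_obj f \<gamma> Y U \<ge> pen_obj f \<gamma> V U + pen_grad f \<gamma> U V \<bullet> (Y - V) + \<gamma> / 2 * (norm (Y - V))\<^sup>2"
    by (simp add: pen_obj_def pen_grad_def inner_add_left add_divide_distrib)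
  moreover have "pen_obj f \<gamma> W U = pen_obj f \<gamma> U W" for W by (rule pen_obj_sym) (rule sym)
  ultimately show ?thesis by simp
qed

lemma pen_obj_scale:
  assumes "c \<noteq> 0"
  shows "pen_obj f \<gamma> (c *\<^sub>R U) (inverse c *\<^sub>R V) = pen_obj f \<gamma> U V
    + \<gamma> / 2 * ((norm (c *\<^sub>R U - inverse c *\<^sub>R V))\<^sup>2 - (norm (U - V))\<^sup>2)"
proof -
  have "(c *\<^sub>R U) ** transpose (inverse c *\<^sub>R V) = U ** transpose V"
    using assms by (simp add: bounded_bilinear.scaleR_left[OF bounded_bilinear_outer]
        bounded_bilinear.scaleR_right[OF bounded_bilinear_outer])
  then show ?thesis by (simp add: pen_obj_def algebra_simps)
qed

text \<open>
  The factors \<open>|U'| |V'|\<close> and \<open>|U'| |U|\<close> are kept as products: for critical pairs each of them is at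
  most \<open>\<delta>\<^sup>2\<close>, while \<open>|V'|\<close> alone can exceed \<open>\<delta>\<close>.
\<close>

lemma pen_grad_diff:
  fixes U V U' V' :: "real^'r^'n"
  assumes lip: "L-lipschitz_on S (grad f)" and S: "V ** transpose U \<in> S" "V' ** transpose U' \<in> S"
    and l: "norm (grad f (V ** transpose U)) \<le> l" and g: "\<gamma> \<ge> 0"
  shows "norm (pen_grad f \<gamma> U' V' - pen_grad f \<gamma> U V) \<le>
    (L * (norm U' * norm V') + l + \<gamma>) * norm (U' - U) + (L * (norm U' * norm U) + \<gamma>) * norm (V' - V)"
proof -
  note mult = bounded_bilinear_matrix_mult
  define X X' where "X = V ** transpose U" and "X' = V' ** transpose U'"
  have L0: "L \<ge> 0" using lip by (rule lipschitz_on_nonneg)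
  have "X' - X = V' ** transpose (U' - U) + (V' - V) ** transpose U"
    by (simp add: X_def X'_def bounded_bilinear.diff_left[OF bounded_bilinear_outer]
        bounded_bilinear.diff_right[OF bounded_bilinear_outer])
  then have dX: "norm (X' - X) \<le> norm V' * norm (U' - U) + norm (V' - V) * norm U"
    by (simp only:) (intro norm_triangle_mono norm_outer_le)
  have "norm (grad f X' - grad f X) \<le> L * norm (X' - X)"
    using lipschitz_onD[OF lip S(2,1)] by (simp add: X_def X'_def dist_norm)
  also have "\<dots> \<le> L * (norm V' * norm (U' - U) + norm (V' - V) * norm U)"
    using dX L0 by (intro mult_left_mono) auto
  finally have 1: "norm ((grad f X' - grad f X) ** U') \<le> L * (norm V' * norm (U' - U) + norm (V' - V) * norm U) * norm U'"
    using norm_matrix_mult_le[of "grad f X' - grad f X" U'] by (meson mult_right_mono norm_ge_zero order_trans)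
  have 2: "norm (grad f X ** (U' - U)) \<le> l * norm (U' - U)"
    using norm_matrix_mult_le[of "grad f X" "U' - U"] l[folded X_def]
    by (meson mult_right_mono norm_ge_zero order_trans)
  have 3: "norm (\<gamma> *\<^sub>R ((V' - V) - (U' - U))) \<le> \<gamma> * (norm (V' - V) + norm (U' - U))"
    using g by (simp add: mult_left_mono norm_triangle_ineq4)
  have "pen_grad f \<gamma> U' V' - pen_grad f \<gamma> U V =
      (grad f X' - grad f X) ** U' + grad f X ** (U' - U) + \<gamma> *\<^sub>R ((V' - V) - (U' - U))"
    by (simp add: pen_grad_def X_def X'_def bounded_bilinear.diff_left[OF mult] bounded_bilinear.diff_right[OF mult]
        algebra_simps)
  then have "norm (pen_grad f \<gamma> U' V' - pen_grad f \<gamma> U V) \<le>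
      L * (norm V' * norm (U' - U) + norm (V' - V) * norm U) * norm U' + l * norm (U' - U)
      + \<gamma> * (norm (V' - V) + norm (U' - U))"
    by (simp only:) (intro norm_triangle_mono 1 2 3)
  then show ?thesis by (simp add: algebra_simps)
qed

lemma pen_grad_continuous:
  fixes f :: "real^'n^'n \<Rightarrow> real"
  assumes "continuous_on UNIV (grad f)"
  shows "continuous_on UNIV (\<lambda>z::(real^'r^'n) \<times> (real^'r^'n). pen_grad f \<gamma> (fst z) (snd z))"
proof -
  have "continuous_on UNIV (\<lambda>z::(real^'r^'n) \<times> (real^'r^'n). grad f (snd z ** transpose (fst z)))"
    by (rule continuous_on_compose2[OF assms])
      (auto intro!: bounded_bilinear.continuous_on[OF bounded_bilinear_outer] continuous_intros)
  then show ?thesis unfolding pen_grad_def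
    by (intro continuous_on_add bounded_bilinear.continuous_on[OF bounded_bilinear_matrix_mult] continuous_intros)
qed

lemma mult_le_square_of_sum_le:
  fixes u v d :: real
  assumes "0 \<le> u" "0 \<le> v" "u + v \<le> 2 * d" shows "v * u \<le> d\<^sup>2"
proof -
  have "4 * (v * u) \<le> (u + v)\<^sup>2" using zero_le_power2[of "u - v"] by (simp add: power2_sum power2_diff algebra_simps)
  also have "\<dots> \<le> (2 * d)\<^sup>2" using assms by (intro power_mono) auto
  finally show ?thesis by (simp add: power_mult_distrib)
qed

theorem theorem3:
  fixes f :: "real^'n^'n \<Rightarrow> real"
    and A :: "'m::finite \<Rightarrow> real^'n^'n"
    and b :: "real^'m"
    and U V :: "nat \<Rightarrow> real^'r^'n"
    and \<Lambda> :: "nat \<Rightarrow> real^'m"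
    and \<gamma> \<rho> \<rho>\<^sub>0 \<delta> \<eta> \<alpha> \<beta>0 \<beta>hat Lf L sA c1 c2 :: real
  assumes A_sym: "\<And>i. transpose (A i) = A i"
    and gam_pos: "\<gamma> > 0" and rho_pos: "\<rho> > 0"
    and f_convex: "convex_on UNIV f"
    and f_diff: "\<And>X. f differentiable (at X)"
    and f_C1: "continuous_on UNIV (grad f)"
    and A1_kkt: "(kkt_set f A b \<gamma> :: ((real^'r^'n) \<times> (real^'r^'n) \<times> (real^'m)) set) \<noteq> {}"
    and A1_sym: "\<And>X. f X = f (transpose X)"
    and A1_diff2: "\<And>X. grad f differentiable (at X)"
    and A1_lip_grad: "\<And>K. convex K \<Longrightarrow> compact K \<Longrightarrow> \<exists>C. C-lipschitz_on K (grad f)"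
    and A1_lip_hess: "\<And>K. convex K \<Longrightarrow> compact K \<Longrightarrow> \<exists>C. C-lipschitz_on K (hess f)"
    and A2_pos: "\<rho>\<^sub>0 > 0"
    and A2: "\<And>\<beta>. compact (level_set f A b \<rho>\<^sub>0 \<beta> :: ((real^'r^'n) \<times> (real^'r^'n)) set)
                  \<or> (level_set f A b \<rho>\<^sub>0 \<beta> :: ((real^'r^'n) \<times> (real^'r^'n)) set) = {}"
    and delta_pos: "\<delta> > 0"
    and delta_bound: "\<And>(X :: real^'r^'n) (Y :: real^'r^'n).
          (X, Y) \<in> level_set f A b \<rho>\<^sub>0 \<beta>hat \<Longrightarrow> norm X \<le> \<delta> \<and> norm Y \<le> \<delta>"
    and A3_pos: "\<eta> > 0"
    and A3: "\<And>(X :: real^'r^'n) (Y :: real^'r^'n).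
          (X, Y) \<in> level_set f A b \<rho>\<^sub>0 \<beta>hat \<Longrightarrow> sigma_min (constr_jac A X) \<ge> \<eta>"
    and A4_alpha: "0 \<le> \<alpha>" "\<alpha> < 1"
    and A4: "lojasiewicz_on
          (aug_lag f A b \<gamma> \<rho> :: (real^'r^'n) \<times> (real^'r^'n) \<times> (real^'m) \<Rightarrow> real) (kkt_set f A b \<gamma>) \<alpha>"
    and Lf_bound: "\<And>X. norm X \<le> \<delta>\<^sup>2 \<Longrightarrow> norm (grad f X) \<le> Lf"
    and L_lip: "L-lipschitz_on (cball 0 (\<delta>\<^sup>2)) (grad f)"
    and sA_def: "sA = (\<Sum>i\<in>UNIV. (norm (A i))\<^sup>2)"
    and c1_def: "c1 = 2 / \<eta>\<^sup>2 *
          (L * \<delta>\<^sup>2 + Lf + \<gamma> + 1 / \<eta> * Lf * \<delta> * sqrt sA + 2 / \<eta> * \<gamma> * \<delta> * sqrt sA)\<^sup>2"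
    and c2_def: "c2 = 2 / \<eta>\<^sup>2 * (L * \<delta>\<^sup>2 + \<gamma>)\<^sup>2"
    and init: "aug_lag f A b \<gamma> \<rho> (U 0, V 0, \<Lambda> 0) + 1 / \<rho> * (norm (\<Lambda> 0))\<^sup>2 \<le> \<beta>0"
    and beta_less: "\<beta>0 < \<beta>hat"
    and rho_large: "\<rho> > Max {2 * \<rho>\<^sub>0, 2 * c1 / \<gamma>, 2 * c2 / \<gamma>,
          1 / (\<beta>hat - \<beta>0) * ((Lf * \<delta> + 2 * \<gamma> * \<delta>) / \<eta>)\<^sup>2}"
    and gam_large: "\<gamma> > \<rho>\<^sub>0"
    and admm: "low_rank_admm f A b \<gamma> \<rho> U V \<Lambda>"
  shows "(\<alpha> = 0 \<longrightarrow>
            (\<exists>k0. \<forall>k\<ge>k0. (U k, V k, \<Lambda> k) = (U k0, V k0, \<Lambda> k0)))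
       \<and> (0 < \<alpha> \<and> \<alpha> \<le> 1 / 2 \<longrightarrow>
            (\<exists>(k0::nat) \<xi> \<mu>. \<xi> > 0 \<and> 0 \<le> \<mu> \<and> \<mu> < 1 \<and>
               (\<forall>k>k0. infdist (U k, V k, \<Lambda> k) (kkt_set f A b \<gamma>) \<le> \<xi> * \<mu> ^ (k - k0))))
       \<and> (1 / 2 < \<alpha> \<and> \<alpha> < 1 \<longrightarrow>
            (\<exists>(k0::nat) \<xi>. \<xi> > 0 \<and>
               (\<forall>k>k0. infdist (U k, V k, \<Lambda> k) (kkt_set f A b \<gamma>)
                  \<le> \<xi> * real (k - k0) powr (- ((1 - \<alpha>) / (2 * \<alpha> - 1))))))"
proof -
  let ?F = "pen_obj f \<gamma> :: real^'r^'n \<Rightarrow> real^'r^'n \<Rightarrow> real"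
  let ?G = "pen_grad f \<gamma> :: real^'r^'n \<Rightarrow> real^'r^'n \<Rightarrow> real^'r^'n"
  let ?B = "\<lambda>(X :: real^'r^'n) Y. meas_map A (X ** transpose Y)"
  let ?C = "adj_map A :: real^'r^'n \<Rightarrow> real^'m \<Rightarrow> real^'r^'n"
  define M where "M = (Lf * \<delta> + 2 * \<gamma> * \<delta>) / \<eta>"
  define s where "s = sqrt sA"
  define p where "p = L * \<delta>\<^sup>2 + Lf + \<gamma>"
  define q where "q = L * \<delta>\<^sup>2 + \<gamma>"
  have rho: "2 * \<rho>\<^sub>0 < \<rho>" "2 * c1 / \<gamma> < \<rho>" "2 * c2 / \<gamma> < \<rho>" "1 / (\<beta>hat - \<beta>0) * M\<^sup>2 < \<rho>"
    using rho_large by (simp_all add: M_def)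
  have L0: "L \<ge> 0" using L_lip by (rule lipschitz_on_nonneg)
  have Lf0: "Lf \<ge> 0" using order_trans[OF norm_ge_zero Lf_bound[of 0]] by simp
  have sA0: "sA \<ge> 0" by (simp add: sA_def sum_nonneg)
  have M0: "M \<ge> 0" using Lf0 delta_pos gam_pos A3_pos by (simp add: M_def)
  have psM: "p + s * M = L * \<delta>\<^sup>2 + Lf + \<gamma> + 1 / \<eta> * Lf * \<delta> * sqrt sA + 2 / \<eta> * \<gamma> * \<delta> * sqrt sA"
    using A3_pos by (simp add: p_def s_def M_def field_simps)
  have small: "norm (Y ** transpose X) \<le> \<delta>\<^sup>2" if "norm X + norm Y \<le> 2 * \<delta>" for X Y :: "real^'r^'n"
    using norm_outer_le[of Y X] mult_le_square_of_sum_le[of "norm X" "norm Y" \<delta>] that by simp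
  interpret bilinear_lagrangian ?F ?G ?B ?C b \<gamma> \<rho> \<delta> \<eta> \<beta>hat M s p q
  proof (rule bilinear_lagrangian.intro)
    show "\<gamma> > 0" "\<rho> > 0" "\<eta> > 0" "\<delta> > 0" "M \<ge> 0" by (fact gam_pos rho_pos A3_pos delta_pos M0)+
    show "s \<ge> 0" "p \<ge> 0" "q \<ge> 0" using sA0 L0 Lf0 gam_pos by (simp_all add: s_def p_def q_def)
    show "bounded_bilinear ?B" "bounded_bilinear ?C"
      by (fact bounded_bilinear_meas_outer bounded_bilinear_adj_map)+
    show "?C X y \<bullet> Y = y \<bullet> ?B X Y" for X Y y by (rule adj_map_adjoint) (rule A_sym)
    show "?B X Y = ?B Y X" for X Y :: "real^'r^'n"
    proof -
      have "A i \<bullet> (X ** transpose Y) = A i \<bullet> (Y ** transpose X)" for i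
        using inner_transpose[of "A i" "X ** transpose Y"] A_sym by (simp add: transpose_outer)
      then show ?thesis by (simp add: meas_map_def)
    qed
    show "?F X Y = ?F Y X" for X Y by (rule pen_obj_sym) (rule A1_sym)
    show "((\<lambda>z. ?F (fst z) (snd z)) has_derivative
         (\<lambda>h. ?G (snd z) (fst z) \<bullet> fst h + ?G (fst z) (snd z) \<bullet> snd h)) (at z)" for z
      by (rule pen_obj_has_derivative[OF f_diff A1_sym])
    show "?F X Y + ?G X Y \<bullet> (Z - Y) + \<gamma> / 2 * (norm (Z - Y))\<^sup>2 \<le> ?F X Z" for X Y Z
      by (rule pen_obj_strong[OF f_convex f_diff A1_sym])
    show "?F (c *\<^sub>R X) (inverse c *\<^sub>R Y) =
         ?F X Y + \<gamma> / 2 * ((norm (c *\<^sub>R X - inverse c *\<^sub>R Y))\<^sup>2 - (norm (X - Y))\<^sup>2)" if "c \<noteq> 0" for c X Y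
      by (rule pen_obj_scale[OF that])
    show "norm X \<le> \<delta> \<and> norm Y \<le> \<delta> \<and> (\<forall>y. \<eta> * norm y \<le> norm (?C X y))"
      if lev: "?F X Y + \<rho> / 4 * (norm (?B X Y - b))\<^sup>2 \<le> \<beta>hat" for X Y
    proof -
      have "\<rho>\<^sub>0 / 2 * (norm (X - Y))\<^sup>2 \<le> \<gamma> / 2 * (norm (X - Y))\<^sup>2"
        using gam_large by (intro mult_right_mono) auto
      moreover have "\<rho>\<^sub>0 / 2 * (norm (?B X Y - b))\<^sup>2 \<le> \<rho> / 4 * (norm (?B X Y - b))\<^sup>2"
        using rho(1) by (intro mult_right_mono) auto
      ultimately have mem: "(X, Y) \<in> level_set f A b \<rho>\<^sub>0 \<beta>hat"
        using lev by (simp add: level_set_def pen_obj_def)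
      have "\<eta> * norm y \<le> norm (?C X y)" for y
      proof -
        have "\<eta> * norm y \<le> sigma_min (constr_jac A X) * norm y" using A3[OF mem] by (intro mult_right_mono) auto
        also have "\<dots> \<le> norm (?C X y)" using sigma_min_le[of "constr_jac A X" y] by (simp add: norm_constr_jac)
        finally show ?thesis .
      qed
      then show ?thesis using delta_bound[OF mem] by blast
    qed
    show "norm (?G X Y) \<le> \<eta> * M" if X: "norm X \<le> \<delta>" and XY: "norm X + norm Y \<le> 2 * \<delta>" for X Y
    proof -
      have "norm (grad f (Y ** transpose X) ** X) \<le> norm (grad f (Y ** transpose X)) * norm X"
        by (rule norm_matrix_mult_le)
      also have "\<dots> \<le> Lf * \<delta>" using Lf_bound[OF small[OF XY]] X Lf0 by (intro mult_mono) auto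
      finally have 1: "norm (grad f (Y ** transpose X) ** X) \<le> Lf * \<delta>" .
      have "norm (Y - X) \<le> 2 * \<delta>" using norm_triangle_ineq4[of Y X] XY by simp
      then have 2: "norm (\<gamma> *\<^sub>R (Y - X)) \<le> \<gamma> * (2 * \<delta>)" using gam_pos by simp
      have "norm (?G X Y) \<le> Lf * \<delta> + \<gamma> * (2 * \<delta>)"
        unfolding pen_grad_def by (intro norm_triangle_mono 1 2)
      then show ?thesis using A3_pos by (simp add: M_def)
    qed
    show "norm (?G X' Y' - ?G X Y) \<le> p * norm (X' - X) + q * norm (Y' - Y)"
      if X: "norm X \<le> \<delta>" and XY: "norm X + norm Y \<le> 2 * \<delta>"
        and X': "norm X' \<le> \<delta>" and XY': "norm X' + norm Y' \<le> 2 * \<delta>" for X Y X' Y'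
    proof -
      have "norm (?G X' Y' - ?G X Y) \<le>
        (L * (norm X' * norm Y') + Lf + \<gamma>) * norm (X' - X) + (L * (norm X' * norm X) + \<gamma>) * norm (Y' - Y)"
        by (rule pen_grad_diff[OF L_lip]) (use small[OF XY] small[OF XY'] Lf_bound gam_pos in auto)
      also have "norm X' * norm Y' \<le> \<delta>\<^sup>2"
        using mult_le_square_of_sum_le[of "norm Y'" "norm X'" \<delta>] XY' by (simp add: add.commute)
      also have "norm X' * norm X \<le> \<delta>\<^sup>2"
        using mult_mono[OF X' X] delta_pos by (simp add: power2_eq_square)
      finally show ?thesis
        using L0 by (simp add: p_def q_def mult_left_mono mult_right_mono)
    qed
    show "norm (?C X y) \<le> s * norm X * norm y" for X y
      using adj_map_norm[of A X y] by (simp add: s_def sA_def)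
    show "4 * (p + s * M)\<^sup>2 < \<gamma> * \<rho> * \<eta>\<^sup>2"
      using rho(2) gam_pos A3_pos unfolding c1_def psM[symmetric] by (simp add: field_simps)
    show "4 * q\<^sup>2 < \<gamma> * \<rho> * \<eta>\<^sup>2"
      using rho(3) gam_pos A3_pos unfolding c2_def q_def[symmetric] by (simp add: field_simps)
  qed
  have Lag_eq: "aug_lag f A b \<gamma> \<rho> z = Lag (fst z) (fst (snd z)) (snd (snd z))" for z
    by (cases z) (simp add: aug_lag_def Lag_def pen_obj_def)
  interpret bilinear_admm ?F ?G ?B ?C b \<gamma> \<rho> \<delta> \<eta> \<beta>hat M s p q U V \<Lambda> \<beta>0
  proof (intro bilinear_admm.intro bilinear_admm_axioms.intro bilinear_lagrangian_axioms)
    show "Lag (V k) (U (Suc k)) (\<Lambda> k) \<le> Lag (V k) X (\<Lambda> k)" for k X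
      using admm unfolding low_rank_admm_def is_arg_min_linorder
      by (simp add: Lag_eq Lag_sym[of "V k"])
    show "Lag (U (Suc k)) (V (Suc k)) (\<Lambda> k) \<le> Lag (U (Suc k)) X (\<Lambda> k)" for k X
      using admm unfolding low_rank_admm_def is_arg_min_linorder by (simp add: Lag_eq)
    show "\<Lambda> (Suc k) = \<Lambda> k + \<rho> *\<^sub>R (?B (U (Suc k)) (V (Suc k)) - b)" for k
      using admm unfolding low_rank_admm_def by blast
    show "Lag (U 0) (V 0) (\<Lambda> 0) + (norm (\<Lambda> 0))\<^sup>2 / \<rho> \<le> \<beta>0" using init by (simp add: Lag_eq)
    show "\<beta>0 + M\<^sup>2 / \<rho> < \<beta>hat" using rho(4) rho_pos beta_less by (simp add: field_simps)
    show "continuous_on UNIV (\<lambda>z. ?G (fst z) (snd z))" by (rule pen_grad_continuous[OF f_C1])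
    show "\<exists>K\<ge>0. \<forall>U V U' V'. norm U \<le> r \<longrightarrow> norm V \<le> r \<longrightarrow> norm U' \<le> r \<longrightarrow> norm V' \<le> r \<longrightarrow>
         norm (?G U' V' - ?G U V) \<le> K * (norm (U' - U) + norm (V' - V))" for r
    proof -
      let ?S = "cball 0 (r\<^sup>2) :: (real^'n^'n) set"
      obtain D where D: "D-lipschitz_on ?S (grad f)" using A1_lip_grad[of ?S] by auto
      have D0: "D \<ge> 0" using D by (rule lipschitz_on_nonneg)
      have "bounded (grad f ` ?S)"
        by (intro compact_imp_bounded compact_continuous_image continuous_on_subset[OF f_C1]) auto
      then obtain l where l: "l > 0" "\<And>X. X \<in> ?S \<Longrightarrow> norm (grad f X) \<le> l"
        by (auto simp: bounded_pos)
      define K where "K = D * r\<^sup>2 + l + \<gamma>"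
      have "norm (?G X' Y' - ?G X Y) \<le> K * (norm (X' - X) + norm (Y' - Y))"
        if n: "norm X \<le> r" "norm Y \<le> r" "norm X' \<le> r" "norm Y' \<le> r" for X Y X' Y'
      proof -
        have r: "r \<ge> 0" using n(1) norm_ge_zero[of X] by linarith
        have pr: "norm Z * norm Z' \<le> r\<^sup>2" if "norm Z \<le> r" "norm Z' \<le> r" for Z Z' :: "real^'r^'n"
          using mult_mono[OF that r] by (simp add: power2_eq_square)
        have mem: "Y ** transpose X \<in> ?S" "Y' ** transpose X' \<in> ?S"
          using norm_outer_le[of Y X] norm_outer_le[of Y' X'] pr[of Y X] pr[of Y' X'] n by auto
        have "norm (?G X' Y' - ?G X Y) \<le>
          (D * (norm X' * norm Y') + l + \<gamma>) * norm (X' - X) + (D * (norm X' * norm X) + \<gamma>) * norm (Y' - Y)"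
          by (rule pen_grad_diff[OF D mem]) (use l mem gam_pos in auto)
        also have "\<dots> \<le> K * norm (X' - X) + K * norm (Y' - Y)"
          using pr[OF n(3,4)] pr[OF n(3,1)] D0 l(1) unfolding K_def
          by (intro add_mono mult_right_mono) (auto intro: mult_left_mono add_increasing2)
        finally show ?thesis by (simp add: algebra_simps)
      qed
      moreover have "K \<ge> 0" using D0 l(1) gam_pos by (simp add: K_def)
      ultimately show ?thesis by blast
    qed
  qed
  have grad_eq: "grad (aug_lag f A b \<gamma> \<rho>) z = grad_Lag z" for z
    by (rule grad_eqI) (use Lag_has_gradient[of z] in \<open>simp add: gderiv_def Lag_eq[abs_def] inner_commute\<close>)
  have W_eq: "kkt_set f A b \<gamma> = {w. grad_Lag w = 0}"
    by (auto simp: kkt_set_def grad_Lag_def pen_grad_def adj_map_def[symmetric] zero_prod_def)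
  obtain c d where cd: "c > 0" "d > 0" and loj: "\<And>z w. w \<in> kkt_set f A b \<gamma> \<Longrightarrow> dist z w \<le> d \<Longrightarrow>
      \<bar>aug_lag f A b \<gamma> \<rho> z - aug_lag f A b \<gamma> \<rho> (w :: (real^'r^'n) \<times> (real^'r^'n) \<times> (real^'m))\<bar> powr \<alpha>
        \<le> c * norm (grad (aug_lag f A b \<gamma> \<rho>) z)"
    using A4 unfolding lojasiewicz_on_def by blast
  have "\<bar>Lag (fst x) (fst (snd x)) (snd (snd x)) - Lag (fst w) (fst (snd w)) (snd (snd w))\<bar> powr \<alpha>
        \<le> c * norm (grad_Lag x)" if "grad_Lag w = 0" "dist x w \<le> d" for x w
    using loj[of w x] that by (simp add: W_eq Lag_eq grad_eq)
  note rates = convergence_rates[OF this cd]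
  show ?thesis using rates unfolding W_eq by blast
qed

end
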